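(* Let $N\in\mathbb{N}$, let $X$ be a Banach space whose dual $X'$ is separable and has the approximation property, and let $Z$ be a dual space or a Banach space with property $(\beta)$. Then every symmetric multilinear mapping in $\mathcal{L}_s(^NX;Z)$ can be approximated (in the supremum norm) by symmetric multilinear mappings in $\mathcal{L}_s(^NX;Z)$ all of whose Arens extensions attain the supremum norm at the same $N$-tuple.
   Context: $X'$ is the topological dual of $X$ and $B_X$ its closed unit ball. $\mathcal{L}_s(^NX;Z)$ is the space of continuous symmetric $N$-linear mappings $X\times\cdots\times X\to Z$ with the supremum norm $\|\cdot\|$. Property $(\beta)$ of Lindenstrauss: a Banach space $Z$ has property $(\beta)$ if there is a set $\{(z_\alpha,g_\alpha):\alpha\in\Lambda\}\subset Z\times Z'$ and $0\le\lambda<1$ such that (i) $\|z_\alpha\|=\|g_\alpha\|=g_\alpha(z_\alpha)=1$ for all $\alpha$; (ii) $|g_\alpha(z_\gamma)|\le\lambda$ for $\alpha\ne\gamma$; (iii) $\|z\|=\sup_{\alpha\in\Lambda}|g_\alpha(z)|$ for all $z\in Z$. Arens extensions: for each permutation $\sigma$ of $\{1,\dots,N\}$, the corresponding Arens extension of a continuous $N$-linear $\Phi:X^N\to Z$ is the $N$-linear mapping $(X'')^N\to Z''$ given at $(x_1'',\dots,x_N'')$ by $w^*\text{-}\lim_{\alpha_{\sigma(1)}}\cdots\lim_{\alpha_{\sigma(N)}}\Phi(x_{1,\alpha_1},\dots,x_{N,\alpha_N})$, where $(x_{j,\alpha_j})_{\alpha_j}\subset X$ is a bounded net $w^*$-convergent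 to $x_j''$. There are $N!$ of them, each with norm $\|\Phi\|$. They attain the supremum norm at the same $N$-tuple if there is a single $(a_1'',\dots,a_N'')\in (B_{X''})^N$ at which each of the $N!$ Arens extensions has norm $\|\Phi\|$. *)

theory Defs
  imports "HOL-Analysis.Analysis" "HOL-Combinatorics.Permutations"
begin

text \<open>
  The scalar field is real or complex.  Up to isometric isomorphism, the instances of the
  following class are exactly these two fields, since the image of the embedding is a real
  subalgebra of the complex numbers.
\<close>

class real_or_complex = real_normed_field +
  assumes embeds_in_complex: "\<exists>\<iota> :: 'a \<Rightarrow> complex. \<iota> 1 = 1 \<and> (\<forall>x y. \<iota> (x + y) = \<iota> x + \<iota> y) \<and>
    (\<forall>x y. \<iota> (x * y) = \<iota> x * \<iota> y) \<and> (\<forall>r x. \<iota> (r *\<^sub>R x) = r *\<^sub>R \<iota> x) \<and>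
    (\<forall>x. norm (\<iota> x) = norm x)"

instance real :: real_or_complex
  by standard (rule exI[of _ complex_of_real], simp add: scaleR_conv_of_real)

instance complex :: real_or_complex
  by standard (rule exI[of _ "\<lambda>z. z"], simp)

text \<open>
  A normed space over the scalar field is a real normed space together with a compatible
  scalar multiplication.
\<close>

locale normed_space_over = vector_space scale
  for scale :: "'k::real_or_complex \<Rightarrow> 'x::real_normed_vector \<Rightarrow> 'x" +
  assumes norm_scale: "norm (scale c x) = norm c * norm x"
    and scale_of_real: "scale (of_real r) x = r *\<^sub>R x"


subsection \<open>Dual and bidual\<close>

text \<open>The type of bounded linear functions only knows real linearity, so the topological dual is
  a subspace of it.\<close>

definition dual_space ::
  "('k::real_or_complex \<Rightarrow> 'x::real_normed_vector \<Rightarrow> 'x) \<Rightarrow> ('x \<Rightarrow>\<^sub>L 'k) set" where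
  "dual_space s = {f. Vector_Spaces.linear s (*) (blinfun_apply f)}"

definition dual_scale ::
  "'k::real_or_complex \<Rightarrow> ('x::real_normed_vector \<Rightarrow>\<^sub>L 'k) \<Rightarrow> ('x \<Rightarrow>\<^sub>L 'k)" where
  "dual_scale c f = blinfun_mult_right c o\<^sub>L f"

text \<open>Functionals on the dual are made unique as functions by letting them vanish outside the
  dual.  Hence the product topology on the function type induces exactly the weak-star topology
  on the bidual.\<close>

definition bidual_space ::
  "('k::real_or_complex \<Rightarrow> 'x::real_normed_vector \<Rightarrow> 'x) \<Rightarrow> (('x \<Rightarrow>\<^sub>L 'k) \<Rightarrow> 'k) set" where
  "bidual_space s = {\<phi>.
     (\<forall>f\<in>dual_space s. \<forall>g\<in>dual_space s. \<phi> (f + g) = \<phi> f + \<phi> g) \<and>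
     (\<forall>c. \<forall>f\<in>dual_space s. \<phi> (dual_scale c f) = c * \<phi> f) \<and>
     (\<exists>C. \<forall>f\<in>dual_space s. norm (\<phi> f) \<le> C * norm f) \<and>
     (\<forall>f. f \<notin> dual_space s \<longrightarrow> \<phi> f = 0)}"

definition bidual_norm ::
  "('k::real_or_complex \<Rightarrow> 'x::real_normed_vector \<Rightarrow> 'x) \<Rightarrow> (('x \<Rightarrow>\<^sub>L 'k) \<Rightarrow> 'k) \<Rightarrow> real" where
  "bidual_norm s \<phi> = (SUP f\<in>{f \<in> dual_space s. norm f \<le> 1}. norm (\<phi> f))"

definition canonical_embedding ::
  "('k::real_or_complex \<Rightarrow> 'x::real_normed_vector \<Rightarrow> 'x) \<Rightarrow> 'x \<Rightarrow> (('x \<Rightarrow>\<^sub>L 'k) \<Rightarrow> 'k)" where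
  "canonical_embedding s x = (\<lambda>f. if f \<in> dual_space s then blinfun_apply f x else 0)"


subsection \<open>Conditions on the spaces\<close>

text \<open>The approximation property of a subspace \<open>V\<close>: the identity on \<open>V\<close> is a limit of finite-rank
  operators, uniformly on compact sets.\<close>

definition approximation_property ::
  "('k::real_or_complex \<Rightarrow> 'v::real_normed_vector \<Rightarrow> 'v) \<Rightarrow> 'v set \<Rightarrow> bool" where
  "approximation_property s V \<longleftrightarrow>
     (\<forall>K \<epsilon>. compact K \<and> K \<subseteq> V \<and> 0 < \<epsilon> \<longrightarrow>
       (\<exists>T :: 'v \<Rightarrow> 'v.
          (\<forall>u\<in>V. \<forall>v\<in>V. T (u + v) = T u + T v) \<and>
          (\<forall>c. \<forall>v\<in>V. T (s c v) = s c (T v)) \<and>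
          (\<exists>C. \<forall>v\<in>V. norm (T v) \<le> C * norm v) \<and>
          (\<exists>B. finite B \<and> B \<subseteq> V \<and> T ` V \<subseteq> module.span s B) \<and>
          (\<forall>v\<in>K. norm (T v - v) \<le> \<epsilon>)))"

definition isometric_to_dual_of ::
  "('k::real_or_complex \<Rightarrow> 'z::real_normed_vector \<Rightarrow> 'z) \<Rightarrow>
   ('k \<Rightarrow> 'w::real_normed_vector \<Rightarrow> 'w) \<Rightarrow> bool" where
  "isometric_to_dual_of sZ sW \<longleftrightarrow>
     (\<exists>J :: 'z \<Rightarrow> ('w \<Rightarrow>\<^sub>L 'k). Vector_Spaces.linear sZ dual_scale J \<and>
        (\<forall>z. norm (J z) = norm z) \<and> range J = dual_space sW)"

text \<open>No index set is needed: condition (ii) together with \<open>g z = 1\<close> forces distinct indices to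
  give distinct pairs.  Inserting \<open>0\<close> makes the supremum over the empty set \<open>0\<close>.\<close>

definition property_beta ::
  "('k::real_or_complex \<Rightarrow> 'z::real_normed_vector \<Rightarrow> 'z) \<Rightarrow> bool" where
  "property_beta s \<longleftrightarrow>
     (\<exists>(S :: ('z \<times> ('z \<Rightarrow>\<^sub>L 'k)) set) (t::real). S \<subseteq> UNIV \<times> dual_space s \<and> 0 \<le> t \<and> t < 1 \<and>
        (\<forall>(z, g)\<in>S. norm z = 1 \<and> norm g = 1 \<and> blinfun_apply g z = 1) \<and>
        (\<forall>p\<in>S. \<forall>q\<in>S. p \<noteq> q \<longrightarrow> norm (blinfun_apply (snd p) (fst q)) \<le> t) \<and>
        (\<forall>z. norm z = Sup (insert 0 ((\<lambda>p. norm (blinfun_apply (snd p) z)) ` S))))"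


subsection \<open>Symmetric multilinear mappings\<close>

text \<open>An \<open>N\<close>-tuple is a function on \<open>nat\<close> of which only the values at \<open>0, \<dots>, N - 1\<close> matter.  As a
  mapping depends on these coordinates only, continuity for the product topology on
  \<^typ>\<open>nat \<Rightarrow> 'x\<close> is continuity on the \<open>N\<close>-fold product.\<close>

definition sym_multilinear ::
  "nat \<Rightarrow> ('k::real_or_complex \<Rightarrow> 'x::real_normed_vector \<Rightarrow> 'x) \<Rightarrow>
   ('k \<Rightarrow> 'z::real_normed_vector \<Rightarrow> 'z) \<Rightarrow> ((nat \<Rightarrow> 'x) \<Rightarrow> 'z) set" where
  "sym_multilinear N sX sZ = {\<Phi>.
     (\<forall>x y. (\<forall>i<N. x i = y i) \<longrightarrow> \<Phi> x = \<Phi> y) \<and>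
     (\<forall>i<N. \<forall>x. Vector_Spaces.linear sX sZ (\<lambda>a. \<Phi> (x(i := a)))) \<and>
     continuous_on UNIV \<Phi> \<and>
     (\<forall>\<pi> x. \<pi> permutes {..<N} \<longrightarrow> \<Phi> (x \<circ> \<pi>) = \<Phi> x)}"

definition multilinear_norm ::
  "nat \<Rightarrow> ((nat \<Rightarrow> 'x::real_normed_vector) \<Rightarrow> 'z::real_normed_vector) \<Rightarrow> real" where
  "multilinear_norm N \<Phi> = (SUP x\<in>{x. \<forall>i<N. norm (x i) \<le> 1}. norm (\<Phi> x))"


subsection \<open>Arens extensions\<close>

text \<open>A net is represented by the proper filter generated by its tails.\<close>

definition bounded_wstar_net ::
  "('k::real_or_complex \<Rightarrow> 'x::real_normed_vector \<Rightarrow> 'x) \<Rightarrow> 'x filter \<Rightarrow>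
   (('x \<Rightarrow>\<^sub>L 'k) \<Rightarrow> 'k) \<Rightarrow> bool" where
  "bounded_wstar_net s F \<phi> \<longleftrightarrow>
     F \<noteq> bot \<and> (\<exists>C. \<forall>\<^sub>F x in F. norm x \<le> C) \<and> (canonical_embedding s \<longlongrightarrow> \<phi>) F"

text \<open>The iterated weak-star limit, in the bidual of the codomain, of \<open>\<Phi>\<close> over the coordinates in
  the list.  The head of the list is the outermost limit; \<open>x\<close> holds the coordinates already
  chosen.\<close>

primrec has_iterated_wstar_limit ::
  "('k::real_or_complex \<Rightarrow> 'z::real_normed_vector \<Rightarrow> 'z) \<Rightarrow> ((nat \<Rightarrow> 'x) \<Rightarrow> 'z) \<Rightarrow>
   (nat \<Rightarrow> 'x filter) \<Rightarrow> nat list \<Rightarrow> (nat \<Rightarrow> 'x) \<Rightarrow> (('z \<Rightarrow>\<^sub>L 'k) \<Rightarrow> 'k) \<Rightarrow> bool" where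
  "has_iterated_wstar_limit sZ \<Phi> F [] x \<zeta> \<longleftrightarrow> \<zeta> = canonical_embedding sZ (\<Phi> x)"
| "has_iterated_wstar_limit sZ \<Phi> F (i # is) x \<zeta> \<longleftrightarrow>
     (\<exists>h. (\<forall>a. has_iterated_wstar_limit sZ \<Phi> F is (x(i := a)) (h a)) \<and> (h \<longlongrightarrow> \<zeta>) (F i))"

text \<open>By Goldstine's theorem suitable nets exist, and the iterated limit does not depend on their
  choice.  The starting tuple \<open>\<lambda>_. 0\<close> is irrelevant, as all \<open>N\<close> coordinates get replaced.\<close>

definition arens_extension ::
  "nat \<Rightarrow> ('k::real_or_complex \<Rightarrow> 'x::real_normed_vector \<Rightarrow> 'x) \<Rightarrow>
   ('k \<Rightarrow> 'z::real_normed_vector \<Rightarrow> 'z) \<Rightarrow> ((nat \<Rightarrow> 'x) \<Rightarrow> 'z) \<Rightarrow> (nat \<Rightarrow> nat) \<Rightarrow>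
   (nat \<Rightarrow> (('x \<Rightarrow>\<^sub>L 'k) \<Rightarrow> 'k)) \<Rightarrow> (('z \<Rightarrow>\<^sub>L 'k) \<Rightarrow> 'k)" where
  "arens_extension N sX sZ \<Phi> \<sigma> \<phi> =
     (THE \<zeta>. \<forall>F. (\<forall>j<N. bounded_wstar_net sX (F j) (\<phi> j)) \<longrightarrow>
        has_iterated_wstar_limit sZ \<Phi> F (map \<sigma> [0..<N]) (\<lambda>_. 0) \<zeta>)"

definition arens_extensions_attain_norm_at_same_tuple ::
  "nat \<Rightarrow> ('k::real_or_complex \<Rightarrow> 'x::real_normed_vector \<Rightarrow> 'x) \<Rightarrow>
   ('k \<Rightarrow> 'z::real_normed_vector \<Rightarrow> 'z) \<Rightarrow> ((nat \<Rightarrow> 'x) \<Rightarrow> 'z) \<Rightarrow> bool" where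
  "arens_extensions_attain_norm_at_same_tuple N sX sZ \<Phi> \<longleftrightarrow>
     (\<exists>a. (\<forall>j<N. a j \<in> bidual_space sX \<and> bidual_norm sX (a j) \<le> 1) \<and>
          (\<forall>\<sigma>. \<sigma> permutes {..<N} \<longrightarrow>
             bidual_norm sZ (arens_extension N sX sZ \<Phi> \<sigma> a) = multilinear_norm N \<Phi>))"

end

theory Submission
  imports Defs "HOL-Probability.Probability"
begin

text \<open>
  Let \<open>Z\<close> be the dual of \<open>W\<close>. Symmetric multilinear maps into \<open>Z\<close> are forms on \<open>X\<^sup>N \<times> W\<close>, and their
  space is a dual space. The Bishop--Phelps argument, carried out in its predual, perturbs a given
  map to some \<open>\<Psi>\<close> whose norm is the limit of the averages of \<open>\<Psi>\<close> along finitely supported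
  measures that converge uniformly on the unit ball of forms. The limit functional has two
  representations: a multiple of a single discrete probability measure on the unit balls of \<open>X\<close>
  and \<open>W\<close>, and a weak limit, which is a measure on the bidual balls, known only to compute averages
  of finite-rank modifications of \<open>\<Psi>\<close>. The separability and the approximation property of \<open>X'\<close>
  permit replacing the variables, beginning with the outermost limit, by finite-rank operators with
  small error in the mean for both measures at once. Hence every Arens extension of \<open>\<Psi>\<close> has average
  \<open>\<parallel>\<Psi>\<parallel>\<close> over the second measure, so it equals \<open>\<parallel>\<Psi>\<parallel>\<close> almost everywhere, and the finitely many
  exceptional null sets leave a common point. For property \<open>(\<beta>)\<close> the scalar case is applied to one
  coordinate \<open>g\<^sub>\<alpha> \<circ> \<Phi>\<close>, and the perturbation is made in the direction of \<open>z\<^sub>\<alpha>\<close>.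
\<close>

subsection \<open>The scalar field\<close>

text \<open>A function bounded by m whose average over a probability measure is m equals m almost
  everywhere; attainment is to come from this. The obstacle is that neither representation of the
  limit functional suffices alone. The discrete one gives the right value at \<Psi> itself, but with
  total mass 2 instead of 1, so nothing follows about points. The weak limit has mass 1, but
  averages pass to it only for functions that are continuous in the code, and Arens extensions need
  not be weak-star continuous. Finite-rank modifications of \<Psi> are polynomials in continuous
  functions and mediate: on them both representations agree, being limits of one sequence. So the
  same operators must be close to the identity in the mean for both measures. A bounded measurable
  function into a separable dual is controlled in the mean by one compact set, which reduces this to
  the approximation property. Since each variable receives its own operator, symmetry is lost, and
  convergence of the averages is required on all forms.\<close>

definition emb :: "'k::real_or_complex \<Rightarrow> complex" where
  "emb = (SOME \<iota>. \<iota> 1 = 1 \<and> (\<forall>x y. \<iota> (x + y) = \<iota> x + \<iota> y) \<and>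
    (\<forall>x y. \<iota> (x * y) = \<iota> x * \<iota> y) \<and> (\<forall>r x. \<iota> (r *\<^sub>R x) = r *\<^sub>R \<iota> x) \<and>
    (\<forall>x. norm (\<iota> x) = norm x))"

lemma emb_props:
  "emb (1::'k::real_or_complex) = 1 \<and> (\<forall>x y::'k. emb (x + y) = emb x + emb y) \<and>
    (\<forall>x y::'k. emb (x * y) = emb x * emb y) \<and> (\<forall>r (x::'k). emb (r *\<^sub>R x) = r *\<^sub>R emb x) \<and>
    (\<forall>x::'k. norm (emb x) = norm x)"
  unfolding emb_def using someI_ex[OF embeds_in_complex] .

lemma emb_one [simp]: "emb 1 = 1"
  and emb_add: "emb (x + y) = emb x + emb y"
  and emb_mult: "emb (x * y) = emb x * emb y"
  and emb_scaleR: "emb (r *\<^sub>R x) = r *\<^sub>R emb x"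
  and norm_emb [simp]: "norm (emb x) = norm x"
  using emb_props by blast+

lemma bounded_linear_emb: "bounded_linear emb"
  by (rule bounded_linear_intro[where K = 1]) (auto simp: emb_add emb_scaleR)

lemma emb_diff: "emb (x - y) = emb x - emb y"
  by (rule linear_diff[OF bounded_linear.linear[OF bounded_linear_emb]])

lemma emb_of_real [simp]: "emb (of_real r) = of_real r"
  by (simp add: of_real_def emb_scaleR)

lemma dist_emb: "dist (emb x) (emb y) = dist x y"
  by (simp add: dist_norm flip: emb_diff)

lemma tendsto_emb_iff: "((\<lambda>x. emb (f x)) \<longlongrightarrow> emb l) F \<longleftrightarrow> (f \<longlongrightarrow> l) F"
  by (simp add: tendsto_iff dist_emb)

text \<open>The convexity and separation arguments are real; the phase of a scalar converts bounds
  on real parts back into bounds on moduli, so both fields are treated at once.\<close>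

definition re :: "'k::real_or_complex \<Rightarrow> real" where
  "re c = Re (emb c)"

lemma bounded_linear_re: "bounded_linear re"
  unfolding re_def
  using bounded_linear_compose[OF bounded_linear_Re bounded_linear_emb] by (simp add: o_def)

lemmas re_add = linear_add[OF bounded_linear.linear[OF bounded_linear_re]]
  and re_diff = linear_diff[OF bounded_linear.linear[OF bounded_linear_re]]
  and re_minus = linear_neg[OF bounded_linear.linear[OF bounded_linear_re]]
  and re_zero [simp] = linear_0[OF bounded_linear.linear[OF bounded_linear_re]]
  and re_sum = linear_sum[OF bounded_linear.linear[OF bounded_linear_re]]
  and re_scaleR = linear_cmul[OF bounded_linear.linear[OF bounded_linear_re]]
  and tendsto_re = bounded_linear.tendsto[OF bounded_linear_re]
  and continuous_on_re = bounded_linear.continuous_on[OF bounded_linear_re]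

lemma re_of_real_mult: "re (of_real r * c) = r * re c"
  by (simp add: re_def emb_mult)

lemma re_of_real [simp]: "re (of_real r) = r"
  by (simp add: re_def)

lemma abs_re_le: "\<bar>re c\<bar> \<le> norm c"
  unfolding re_def by (metis abs_Re_le_cmod norm_emb)

lemma re_le: "re c \<le> norm c"
  using abs_re_le[of c] by simp

lemma phase_exists: "\<exists>a::'k::real_or_complex. norm a = 1 \<and> a * c = of_real (norm c)"
proof (cases "c = 0")
  case True
  then show ?thesis by (intro exI[of _ 1]) simp
next
  case False
  then show ?thesis
    by (intro exI[of _ "of_real (norm c) / c"]) (simp add: norm_divide)
qed

lemma norm_le_of_re_le:
  assumes "\<And>a::'k::real_or_complex. norm a = 1 \<Longrightarrow> re (a * c) \<le> B"
  shows "norm c \<le> B"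
  by (metis assms phase_exists re_of_real)

text \<open>The range of \<open>emb\<close> is a real subspace of the complex plane, hence closed,
  so its part in a closed disc is compact. The inverse of \<open>emb\<close> is isometric there and
  carries the compactness back.\<close>

lemma compact_scalar_ball: "compact {c::'k::real_or_complex. norm c \<le> r}"
proof -
  have sub: "subspace (range (emb :: 'k \<Rightarrow> complex))"
    by (simp add: bounded_linear.linear[OF bounded_linear_emb] linear_subspace_image)
  have inj: "inj (emb :: 'k \<Rightarrow> complex)"
    by (rule injI) (metis dist_eq_0_iff dist_emb)
  have cmp: "compact (cball 0 r \<inter> range (emb :: 'k \<Rightarrow> complex))"
    by (intro compact_Int_closed closed_subspace sub) simp
  have "continuous_on (range (emb :: 'k \<Rightarrow> complex)) (inv emb :: complex \<Rightarrow> 'k)"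
    unfolding continuous_on_iff by (auto simp: dist_emb inv_f_f[OF inj])
  then have "continuous_on (cball 0 r \<inter> range (emb :: 'k \<Rightarrow> complex)) (inv emb :: complex \<Rightarrow> 'k)"
    by (rule continuous_on_subset) auto
  from compact_continuous_image[OF this cmp]
  have "compact ((inv emb :: complex \<Rightarrow> 'k) ` (cball 0 r \<inter> range (emb :: 'k \<Rightarrow> complex)))" .
  also have "(inv emb :: complex \<Rightarrow> 'k) ` (cball 0 r \<inter> range (emb :: 'k \<Rightarrow> complex)) = {c::'k. norm c \<le> r}"
  proof (intro set_eqI iffI)
    fix c :: 'k assume "c \<in> (inv emb :: complex \<Rightarrow> 'k) ` (cball 0 r \<inter> range (emb :: 'k \<Rightarrow> complex))"
    then show "c \<in> {c::'k. norm c \<le> r}" using inj by auto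
  next
    fix c :: 'k assume "c \<in> {c::'k. norm c \<le> r}"
    then have "emb c \<in> cball 0 r \<inter> range (emb :: 'k \<Rightarrow> complex)" "c = inv emb (emb c)" using inj by auto
    then show "c \<in> (inv emb :: complex \<Rightarrow> 'k) ` (cball 0 r \<inter> range (emb :: 'k \<Rightarrow> complex))" by blast
  qed
  finally show ?thesis .
qed

section \<open>Compactness and convergence in function spaces\<close>

lemma compact_function_box:
  fixes C :: "'i \<Rightarrow> 'a::topological_space set"
  assumes "\<And>i. compact (C i)"
  shows "compact {f. \<forall>i. f i \<in> C i}"
proof -
  have "compactin (product_topology (\<lambda>i. euclidean) UNIV) (PiE UNIV C)"
    unfolding compactin_PiE using assms by simp
  moreover have "PiE UNIV C = {f. \<forall>i. f i \<in> C i}" by auto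
  ultimately show ?thesis by (simp add: euclidean_product_topology)
qed

text \<open>Tychonoff's theorem in the shape of Banach-Alaoglu: the weak-star topology is the
  pointwise one, and norm bounds make every factor compact.\<close>

lemma compact_scalar_functions:
  "compact {f :: 'i \<Rightarrow> 'k::real_or_complex. \<forall>i. norm (f i) \<le> b i}"
proof -
  have "compact {f. \<forall>i. f i \<in> {c::'k. norm c \<le> b i}}"
    by (rule compact_function_box) (rule compact_scalar_ball)
  then show ?thesis by simp
qed

lemma tendsto_fun_iff:
  fixes f :: "'c \<Rightarrow> 'i \<Rightarrow> 'a::topological_space"
  shows "(f \<longlongrightarrow> l) F \<longleftrightarrow> (\<forall>i. ((\<lambda>x. f x i) \<longlongrightarrow> l i) F)"
proof -
  have "(f \<longlongrightarrow> l) F \<longleftrightarrow> limitin euclidean f l F" by simp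
  also have "\<dots> \<longleftrightarrow> limitin (product_topology (\<lambda>i. euclidean) UNIV) f l F"
    by (simp only: euclidean_product_topology)
  also have "\<dots> \<longleftrightarrow> (\<forall>i. ((\<lambda>x. f x i) \<longlongrightarrow> l i) F)"
    by (subst limitin_componentwise) auto
  finally show ?thesis .
qed

subsection \<open>Expectations of bounded functions\<close>

abbreviation expect :: "'d pmf \<Rightarrow> ('d \<Rightarrow> real) \<Rightarrow> real" where
  "expect p f \<equiv> measure_pmf.expectation p f"

lemma integrable_pmf_bounded:
  fixes f :: "'d \<Rightarrow> real"
  assumes "\<And>d. d \<in> set_pmf p \<Longrightarrow> \<bar>f d\<bar> \<le> B"
  shows "integrable (measure_pmf p) f"
  by (rule measure_pmf.integrable_const_bound[where B = B]) (auto simp: AE_measure_pmf_iff assms)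

lemma expect_le_const:
  fixes f :: "'d \<Rightarrow> real"
  assumes "\<And>d. d \<in> set_pmf p \<Longrightarrow> \<bar>f d\<bar> \<le> B" "\<And>d. d \<in> set_pmf p \<Longrightarrow> f d \<le> c"
  shows "expect p f \<le> c"
  using assms
  by (intro measure_pmf.integral_le_const integrable_pmf_bounded[where B = B]) (auto simp: AE_measure_pmf_iff)

lemma abs_expect_le:
  fixes f :: "'d \<Rightarrow> real"
  assumes "\<And>d. d \<in> set_pmf p \<Longrightarrow> \<bar>f d\<bar> \<le> B"
  shows "\<bar>expect p f\<bar> \<le> B"
proof -
  have "expect p f \<le> B" by (rule expect_le_const[of _ _ B]) (use assms in force)+
  moreover have "expect p (\<lambda>d. - f d) \<le> B" by (rule expect_le_const[of _ _ B]) (use assms in force)+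
  ultimately show ?thesis by simp
qed

lemma expect_cong:
  assumes "\<And>d. d \<in> set_pmf p \<Longrightarrow> f d = g d"
  shows "expect p f = expect p g"
  using assms by (intro integral_cong_AE) (auto simp: AE_measure_pmf_iff)

lemma expect_bind:
  fixes h :: "'d \<Rightarrow> real"
  assumes "\<And>d. d \<in> set_pmf (bind_pmf p f) \<Longrightarrow> \<bar>h d\<bar> \<le> B"
  shows "expect (bind_pmf p f) h = expect p (\<lambda>x. expect (f x) h)"
proof -
  define h' where "h' d = (if d \<in> set_pmf (bind_pmf p f) then h d else 0)" for d
  have "expect (bind_pmf p f) h' = expect p (\<lambda>x. expect (f x) h')"
    unfolding measure_pmf_bind
    by (rule integral_bind[where K = "count_space UNIV" and B' = 1 and B = "\<bar>B\<bar>"])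
       (use assms in \<open>force simp: h'_def measure_pmf_in_subprob_algebra\<close>)+
  moreover have "expect (bind_pmf p f) h' = expect (bind_pmf p f) h"
    by (rule expect_cong) (simp add: h'_def)
  moreover have "expect p (\<lambda>x. expect (f x) h') = expect p (\<lambda>x. expect (f x) h)"
    by (intro expect_cong) (auto simp: h'_def)
  ultimately show ?thesis by simp
qed

subsection \<open>A minimax theorem\<close>

text \<open>The image of \<open>A\<close> under \<open>(f, g)\<close> is convex and compact, so if it misses the closed quadrant, a line separates them.\<close>

lemma minimax_two:
  fixes A :: "'a::topological_space set" and f g :: "'a \<Rightarrow> real"
  assumes "compact A" and contf: "continuous_on A f" and contg: "continuous_on A g"
    and mix: "\<And>\<phi> \<phi>' s. \<lbrakk>\<phi> \<in> A; \<phi>' \<in> A; 0 \<le> s; s \<le> 1\<rbrakk> \<Longrightarrow>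
       \<exists>\<phi>''\<in>A. f \<phi>'' = s * f \<phi> + (1 - s) * f \<phi>' \<and> g \<phi>'' = s * g \<phi> + (1 - s) * g \<phi>'"
    and ex: "\<And>s. \<lbrakk>0 \<le> s; s \<le> 1\<rbrakk> \<Longrightarrow> \<exists>\<phi>\<in>A. 0 \<le> s * f \<phi> + (1 - s) * g \<phi>"
  shows "\<exists>\<phi>\<in>A. 0 \<le> f \<phi> \<and> 0 \<le> g \<phi>"
proof (rule ccontr)
  assume neg: "\<not> ?thesis"
  let ?h = "\<lambda>\<phi>. (f \<phi>, g \<phi>)"
  let ?Q = "{(0::real)..} \<times> {(0::real)..}"
  have "compact (?h ` A)"
    by (intro compact_continuous_image continuous_on_Pair contf contg \<open>compact A\<close>)
  moreover have "?h ` A \<noteq> {}" using ex[of 0] by auto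
  moreover have "convex (?h ` A)"
  proof (rule convexI)
    fix x y and u v :: real
    assume "x \<in> ?h ` A" "y \<in> ?h ` A" and uv: "0 \<le> u" "0 \<le> v" "u + v = 1"
    then obtain \<phi> \<phi>' where xy: "\<phi> \<in> A" "\<phi>' \<in> A" "x = ?h \<phi>" "y = ?h \<phi>'" by auto
    from mix[OF xy(1,2), of u] uv obtain \<phi>'' where "\<phi>'' \<in> A"
      "f \<phi>'' = u * f \<phi> + v * f \<phi>'" "g \<phi>'' = u * g \<phi> + v * g \<phi>'"
      by (metis add_diff_cancel_left' add_increasing2 order_refl le_add_same_cancel1)
    then have "u *\<^sub>R x + v *\<^sub>R y = ?h \<phi>''" using xy by simp
    then show "u *\<^sub>R x + v *\<^sub>R y \<in> ?h ` A" using \<open>\<phi>'' \<in> A\<close> by blast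
  qed
  moreover have "convex ?Q" "closed ?Q" by (intro convex_Times closed_Times; simp)+
  moreover have "?h ` A \<inter> ?Q = {}" using neg by auto
  ultimately obtain n b where sep: "\<forall>x\<in>?h ` A. n \<bullet> x < b" "\<forall>x\<in>?Q. n \<bullet> x > b"
    using separating_hyperplane_compact_closed[of "?h ` A" ?Q] by blast
  obtain n1 n2 where n: "n = (n1, n2)" by (cases n)
  have b: "b < 0" using sep(2)[rule_format, of "(0, 0)"] by (simp add: n)
  \<comment> \<open>If \<open>c < 0\<close>, the parameter \<open>t = b / c\<close> is nonnegative
    and gives exactly the value \<open>b\<close>, against the strict inequality.\<close>
  have ray: "0 \<le> c" if "\<forall>t\<ge>0. b < c * t" for c :: real
  proof (rule ccontr)
    assume "\<not> 0 \<le> c"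
    then have "b < c * (b / c)" using that b by (auto intro: divide_nonpos_nonpos dest!: spec[of _ "b/c"])
    then show False using \<open>\<not> 0 \<le> c\<close> by simp
  qed
  have "0 \<le> n1" by (rule ray) (use sep(2) in \<open>force simp: n dest: bspec[of _ _ "(_,0)"]\<close>)
  have "0 \<le> n2" by (rule ray) (use sep(2) in \<open>force simp: n dest: bspec[of _ _ "(0,_)"]\<close>)
  have lt: "n1 * f \<phi> + n2 * g \<phi> < 0" if "\<phi> \<in> A" for \<phi>
    using sep(1) b that by (force simp: n)
  obtain \<phi>0 where "\<phi>0 \<in> A" using ex[of 0] by auto
  then have "n1 \<noteq> 0 \<or> n2 \<noteq> 0" using lt by force
  then have pos: "0 < n1 + n2" using \<open>0 \<le> n1\<close> \<open>0 \<le> n2\<close> by auto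
  obtain \<phi> where \<phi>: "\<phi> \<in> A" "0 \<le> n1 / (n1 + n2) * f \<phi> + (1 - n1 / (n1 + n2)) * g \<phi>"
    using ex[of "n1 / (n1 + n2)"] \<open>0 \<le> n1\<close> \<open>0 \<le> n2\<close> pos by (auto simp: field_simps)
  have "1 - n1 / (n1 + n2) = n2 / (n1 + n2)" using pos by (simp add: field_simps)
  then have "n1 / (n1 + n2) * f \<phi> + (1 - n1 / (n1 + n2)) * g \<phi> = (n1 * f \<phi> + n2 * g \<phi>) / (n1 + n2)"
    by (simp add: add_divide_distrib)
  then show False using \<phi> lt[OF \<phi>(1)] pos by (simp add: divide_neg_pos zero_le_divide_iff)
qed

text \<open>Induction on \<open>Q\<close>, made possible by the additional free constraint
  \<open>q\<close>. On the compact set \<open>A'\<close> where the constraints in \<open>Q\<close>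
  hold, \<open>minimax_two\<close> is applied to \<open>q\<close> and the new \<open>p\<close>. A
  convex combination of these two is again an element of \<open>P\<close> by \<open>mixP\<close>, so
  solvability of the combined constraint on \<open>A'\<close> is the induction hypothesis at that
  element.\<close>

lemma minimax_finite:
  fixes A :: "'a::topological_space set" and f :: "'a \<Rightarrow> 'p \<Rightarrow> real"
  assumes "finite Q" "Q \<subseteq> P" "compact A" "p0 \<in> P"
    and cont: "\<And>p. p \<in> P \<Longrightarrow> continuous_on A (\<lambda>\<phi>. f \<phi> p)"
    and mixA: "\<And>\<phi> \<phi>' s. \<lbrakk>\<phi> \<in> A; \<phi>' \<in> A; 0 \<le> s; s \<le> 1\<rbrakk> \<Longrightarrow>
       \<exists>\<phi>''\<in>A. \<forall>p\<in>P. f \<phi>'' p = s * f \<phi> p + (1 - s) * f \<phi>' p"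
    and mixP: "\<And>p q s. \<lbrakk>p \<in> P; q \<in> P; 0 \<le> s; s \<le> 1\<rbrakk> \<Longrightarrow>
       \<exists>r\<in>P. \<forall>\<phi>\<in>A. f \<phi> r = s * f \<phi> p + (1 - s) * f \<phi> q"
    and ex: "\<And>p. p \<in> P \<Longrightarrow> \<exists>\<phi>\<in>A. 0 \<le> f \<phi> p"
  shows "\<forall>q\<in>P. \<exists>\<phi>\<in>A. 0 \<le> f \<phi> q \<and> (\<forall>p\<in>Q. 0 \<le> f \<phi> p)"
  using assms(1,2)
proof (induction Q)
  case empty
  then show ?case using ex by simp
next
  case (insert p Q)
  then have IH: "\<forall>q\<in>P. \<exists>\<phi>\<in>A. 0 \<le> f \<phi> q \<and> (\<forall>p\<in>Q. 0 \<le> f \<phi> p)" and p: "p \<in> P" by auto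
  show ?case
  proof
    fix q assume q: "q \<in> P"
    define A' where "A' = A \<inter> (\<Inter>p\<in>Q. {\<phi>\<in>A. 0 \<le> f \<phi> p})"
    have memA': "\<phi> \<in> A' \<longleftrightarrow> \<phi> \<in> A \<and> (\<forall>p\<in>Q. 0 \<le> f \<phi> p)" for \<phi> by (auto simp: A'_def)
    have "compact (A \<inter> (\<Inter>p\<in>Q'. {\<phi>\<in>A. 0 \<le> f \<phi> p}))" if "finite Q'" "Q' \<subseteq> P" for Q'
      using that
    proof (induction Q')
      case empty
      then show ?case using \<open>compact A\<close> by simp
    next
      case (insert r Q')
      let ?B = "A \<inter> (\<Inter>p\<in>Q'. {\<phi>\<in>A. 0 \<le> f \<phi> p})"
      have "compact ?B" using insert by simp
      moreover have "closedin (top_of_set ?B) (?B \<inter> (\<lambda>\<phi>. f \<phi> r) -` {0..})"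
        by (intro continuous_closedin_preimage continuous_on_subset[OF cont]) (use insert in auto)
      ultimately have "compact (?B \<inter> (\<lambda>\<phi>. f \<phi> r) -` {0..})"
        by (rule closedin_compact)
      moreover have "?B \<inter> (\<lambda>\<phi>. f \<phi> r) -` {0..} = A \<inter> (\<Inter>p\<in>insert r Q'. {\<phi>\<in>A. 0 \<le> f \<phi> p})" by auto
      ultimately show ?case by simp
    qed
    then have "compact A'" unfolding A'_def using insert by simp
    have sub: "A' \<subseteq> A" by (simp add: A'_def)
    have "\<exists>\<phi>\<in>A'. 0 \<le> f \<phi> q \<and> 0 \<le> f \<phi> p"
    proof (rule minimax_two[OF \<open>compact A'\<close>])
      show "continuous_on A' (\<lambda>\<phi>. f \<phi> q)" "continuous_on A' (\<lambda>\<phi>. f \<phi> p)"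
        using cont[OF q] cont[OF p] sub continuous_on_subset by blast+
    next
      fix \<phi> \<phi>' and s :: real assume a: "\<phi> \<in> A'" "\<phi>' \<in> A'" "0 \<le> s" "s \<le> 1"
      with mixA[of \<phi> \<phi>' s] sub obtain \<psi> where \<psi>: "\<psi> \<in> A"
        "\<forall>p\<in>P. f \<psi> p = s * f \<phi> p + (1 - s) * f \<phi>' p" by blast
      have "\<psi> \<in> A'" unfolding memA'
      proof (intro conjI ballI \<psi>(1))
        fix r assume "r \<in> Q"
        then have "r \<in> P" "0 \<le> f \<phi> r" "0 \<le> f \<phi>' r" using insert.prems a memA' by auto
        then show "0 \<le> f \<psi> r" using \<psi>(2) a by simp
      qed
      then show "\<exists>\<psi>\<in>A'. f \<psi> q = s * f \<phi> q + (1 - s) * f \<phi>' q \<and> f \<psi> p = s * f \<phi> p + (1 - s) * f \<phi>' p"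
        using \<psi>(2) p q by blast
    next
      fix s :: real assume "0 \<le> s" "s \<le> 1"
      with mixP[OF q p, of s] obtain r where r: "r \<in> P" "\<forall>\<phi>\<in>A. f \<phi> r = s * f \<phi> q + (1 - s) * f \<phi> p"
        by blast
      with IH obtain \<phi> where "\<phi> \<in> A" "0 \<le> f \<phi> r" "\<forall>p\<in>Q. 0 \<le> f \<phi> p" by blast
      then show "\<exists>\<phi>\<in>A'. 0 \<le> s * f \<phi> q + (1 - s) * f \<phi> p" using r(2) memA' by auto
    qed
    then show "\<exists>\<phi>\<in>A. 0 \<le> f \<phi> q \<and> (\<forall>p\<in>insert p Q. 0 \<le> f \<phi> p)" using memA' by auto
  qed
qed

text \<open>Each constraint cuts out a relatively closed subset of the compact set \<open>A\<close>;
  finitely many of them meet by \<open>minimax_finite\<close>, hence all do.\<close>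

lemma minimax:
  fixes A :: "'a::topological_space set" and f :: "'a \<Rightarrow> 'p \<Rightarrow> real"
  assumes "compact A" "A \<noteq> {}"
    and cont: "\<And>p. p \<in> P \<Longrightarrow> continuous_on A (\<lambda>\<phi>. f \<phi> p)"
    and mixA: "\<And>\<phi> \<phi>' s. \<lbrakk>\<phi> \<in> A; \<phi>' \<in> A; 0 \<le> s; s \<le> 1\<rbrakk> \<Longrightarrow>
       \<exists>\<phi>''\<in>A. \<forall>p\<in>P. f \<phi>'' p = s * f \<phi> p + (1 - s) * f \<phi>' p"
    and mixP: "\<And>p q s. \<lbrakk>p \<in> P; q \<in> P; 0 \<le> s; s \<le> 1\<rbrakk> \<Longrightarrow>
       \<exists>r\<in>P. \<forall>\<phi>\<in>A. f \<phi> r = s * f \<phi> p + (1 - s) * f \<phi> q"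
    and ex: "\<And>p. p \<in> P \<Longrightarrow> \<exists>\<phi>\<in>A. 0 \<le> f \<phi> p"
  shows "\<exists>\<phi>\<in>A. \<forall>p\<in>P. 0 \<le> f \<phi> p"
proof (cases "P = {}")
  case True
  then show ?thesis using \<open>A \<noteq> {}\<close> by auto
next
  case False
  then obtain p0 where p0: "p0 \<in> P" by blast
  have "\<exists>T. closed T \<and> A \<inter> T = {\<phi>\<in>A. 0 \<le> f \<phi> p}" if "p \<in> P" for p
    using continuous_closedin_preimage[OF cont[OF that], of "{0..}"]
    by (auto simp: closedin_closed vimage_def Collect_conj_eq)
  then obtain T where T: "\<And>p. p \<in> P \<Longrightarrow> closed (T p)"
    "\<And>p. p \<in> P \<Longrightarrow> A \<inter> T p = {\<phi>\<in>A. 0 \<le> f \<phi> p}" by metis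
  have "A \<inter> \<Inter>(T ` P) \<noteq> {}"
  proof (rule compact_imp_fip[OF \<open>compact A\<close>])
    fix B assume "B \<in> T ` P" then show "closed B" using T by auto
  next
    fix F' assume "finite F'" "F' \<subseteq> T ` P"
    then obtain Q where Q: "finite Q" "Q \<subseteq> P" "F' = T ` Q" by (meson finite_subset_image)
    have "\<forall>q\<in>P. \<exists>\<phi>\<in>A. 0 \<le> f \<phi> q \<and> (\<forall>p\<in>Q. 0 \<le> f \<phi> p)"
      by (rule minimax_finite[OF Q(1,2) \<open>compact A\<close> p0 cont mixA mixP ex])
    then obtain \<phi> where "\<phi> \<in> A" "\<forall>p\<in>Q. 0 \<le> f \<phi> p" using p0 by blast
    then have "\<phi> \<in> A \<inter> \<Inter>F'" using Q T(2) by blast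
    then show "A \<inter> \<Inter>F' \<noteq> {}" by blast
  qed
  then show ?thesis using T(2) by blast
qed

subsection \<open>The Bishop--Phelps argument\<close>

text \<open>\<open>A\<close> models the unit ball of a dual space in its weak-star topology,
  \<open>D\<close> a subset of the predual over which the dual norm is the supremum. As
  \<open>A\<close> carries no algebraic operations, linear relations are expressed by values on
  \<open>D\<close>. The condition \<open>scale_ev\<close> says that \<open>A\<close> is the whole
  ball: an element of norm at most \<open>s\<close> is \<open>s\<close> times an element of
  \<open>A\<close>.\<close>

locale ball_pairing =
  fixes A :: "'a::topological_space set" and D :: "'d set" and ev :: "'a \<Rightarrow> 'd \<Rightarrow> real"
  assumes compactA: "compact A" and A_ne: "A \<noteq> {}" and D_ne: "D \<noteq> {}"
    and cont_ev: "d \<in> D \<Longrightarrow> continuous_on A (\<lambda>\<theta>. ev \<theta> d)"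
    and bound_ev: "\<theta> \<in> A \<Longrightarrow> d \<in> D \<Longrightarrow> \<bar>ev \<theta> d\<bar> \<le> 1"
    and mix_ev: "\<lbrakk>\<theta> \<in> A; \<theta>' \<in> A; 0 \<le> s; s \<le> 1\<rbrakk> \<Longrightarrow>
      \<exists>\<theta>''\<in>A. \<forall>d\<in>D. ev \<theta>'' d = s * ev \<theta> d + (1 - s) * ev \<theta>' d"
    and neg_ev: "\<theta> \<in> A \<Longrightarrow> \<exists>\<theta>'\<in>A. \<forall>d\<in>D. ev \<theta>' d = - ev \<theta> d"
    and scale_ev: "\<lbrakk>\<theta> \<in> A; 0 < s; \<forall>d\<in>D. ev \<theta> d \<le> s\<rbrakk> \<Longrightarrow> \<exists>\<theta>'\<in>A. \<forall>d\<in>D. ev \<theta> d = s * ev \<theta>' d"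
begin

text \<open>The convex hull of \<open>D\<close> in the predual, a convex combination being kept as a
  measure; different measures may represent the same vector.\<close>

definition P :: "'d pmf set" where
  "P = {p. finite (set_pmf p) \<and> set_pmf p \<subseteq> D}"

lemma finite_P: "p \<in> P \<Longrightarrow> finite (set_pmf p)"
  and sub_P: "p \<in> P \<Longrightarrow> set_pmf p \<subseteq> D"
  by (auto simp: P_def)

lemma return_P: "d \<in> D \<Longrightarrow> return_pmf d \<in> P"
  by (simp add: P_def)

lemma mix_P:
  assumes "p \<in> P" "q \<in> P" "0 \<le> s" "s \<le> 1"
  shows "\<exists>r\<in>P. \<forall>h :: 'd \<Rightarrow> real. expect r h = s * expect p h + (1 - s) * expect q h"
proof (intro bexI[of _ "bind_pmf (bernoulli_pmf s) (\<lambda>b. if b then p else q)"] allI)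
  have fin: "finite (set_pmf p \<union> set_pmf q)" using assms finite_P by blast
  fix h :: "'d \<Rightarrow> real"
  define B where "B = Max ((\<lambda>d. \<bar>h d\<bar>) ` (set_pmf p \<union> set_pmf q))"
  have "\<bar>h d\<bar> \<le> B" if "d \<in> set_pmf p \<union> set_pmf q" for d
    unfolding B_def using fin that by (intro Max_ge) auto
  then show "expect (bind_pmf (bernoulli_pmf s) (\<lambda>b. if b then p else q)) h = s * expect p h + (1 - s) * expect q h"
    using assms by (subst expect_bind[where B = B]) (auto split: if_splits)
next
  show "bind_pmf (bernoulli_pmf s) (\<lambda>b. if b then p else q) \<in> P"
    using assms by (auto simp: P_def split: if_splits intro: finite_subset[of _ "set_pmf p \<union> set_pmf q"])
qed

lemma abs_expect_le_one: "set_pmf p \<subseteq> D \<Longrightarrow> \<theta> \<in> A \<Longrightarrow> \<bar>expect p (ev \<theta>)\<bar> \<le> 1"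
  using bound_ev by (intro abs_expect_le) blast

lemma continuous_on_expect: "p \<in> P \<Longrightarrow> continuous_on A (\<lambda>\<theta>. expect p (ev \<theta>))"
  using finite_P[of p] sub_P[of p] cont_ev
  by (subst integral_measure_pmf[of "set_pmf p"]) (auto intro!: continuous_intros)

lemma expect_linear:
  assumes "set_pmf p \<subseteq> D" "\<theta> \<in> A" "\<theta>' \<in> A" "\<theta>'' \<in> A" "\<And>d. d \<in> D \<Longrightarrow> ev \<theta>'' d = a * ev \<theta> d + b * ev \<theta>' d"
  shows "expect p (ev \<theta>'') = a * expect p (ev \<theta>) + b * expect p (ev \<theta>')"
proof -
  have int: "integrable (measure_pmf p) (ev \<theta>)" "integrable (measure_pmf p) (ev \<theta>')"
    by (rule integrable_pmf_bounded[of _ _ 1]; use assms bound_ev in blast)+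
  have "expect p (ev \<theta>'') = expect p (\<lambda>d. a * ev \<theta> d + b * ev \<theta>' d)"
    using assms by (intro expect_cong) auto
  then show ?thesis using int by simp
qed

text \<open>The norm distance of the barycentres in the predual, a pseudometric on measures.\<close>

definition dst :: "'d pmf \<Rightarrow> 'd pmf \<Rightarrow> real" where
  "dst p q = (SUP \<theta>\<in>A. \<bar>expect p (ev \<theta>) - expect q (ev \<theta>)\<bar>)"

lemma dst_ge: "p \<in> P \<Longrightarrow> q \<in> P \<Longrightarrow> \<theta> \<in> A \<Longrightarrow> \<bar>expect p (ev \<theta>) - expect q (ev \<theta>)\<bar> \<le> dst p q"
  unfolding dst_def using abs_expect_le_one[OF sub_P[of p]] abs_expect_le_one[OF sub_P[of q]]
  by (intro cSUP_upper bdd_aboveI2[where M = 2]) force+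

lemma dst_le: "(\<And>\<theta>. \<theta> \<in> A \<Longrightarrow> \<bar>expect p (ev \<theta>) - expect q (ev \<theta>)\<bar> \<le> c) \<Longrightarrow> dst p q \<le> c"
  unfolding dst_def using A_ne by (rule cSUP_least)

lemma dst_triangle:
  assumes "p \<in> P" "q \<in> P" "r \<in> P" shows "dst p r \<le> dst p q + dst q r"
proof (rule dst_le)
  fix \<theta> assume "\<theta> \<in> A"
  then show "\<bar>expect p (ev \<theta>) - expect r (ev \<theta>)\<bar> \<le> dst p q + dst q r"
    using dst_ge[of p q \<theta>] dst_ge[of q r \<theta>] assms by linarith
qed

lemma dst_nonneg: "p \<in> P \<Longrightarrow> q \<in> P \<Longrightarrow> 0 \<le> dst p q"
  using dst_ge A_ne by (meson abs_ge_zero all_not_in_conv order_trans)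

lemma dst_self: "dst p p = 0"
  unfolding dst_def using A_ne by simp

lemma ekeland:
  fixes \<psi> :: "'d \<Rightarrow> real"
  assumes \<psi>: "\<And>d. d \<in> D \<Longrightarrow> \<bar>\<psi> d\<bar> \<le> B" and "0 < \<epsilon>"
  shows "\<exists>u s. (\<forall>n. u n \<in> P) \<and> (\<lambda>n. expect (u n) \<psi>) \<longlonglongrightarrow> s \<and>
    (\<forall>e>0. \<exists>n0. \<forall>m\<ge>n0. \<forall>n\<ge>n0. dst (u m) (u n) < e) \<and>
    (\<forall>p\<in>P. \<forall>c. (\<forall>\<^sub>F n in sequentially. dst p (u n) \<le> c) \<longrightarrow> expect p \<psi> \<le> s + \<epsilon> * c)"
proof -
  \<comment> \<open>Ekeland's order: \<open>q\<close> is above \<open>p\<close> if the gain in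
    \<open>\<psi>\<close> pays for \<epsilon> times the distance travelled. Transitivity is the
    triangle inequality.\<close>
  define S where "S p = {q\<in>P. expect p \<psi> + \<epsilon> * dst q p \<le> expect q \<psi>}" for p
  have bnd: "\<bar>expect p \<psi>\<bar> \<le> B" if "p \<in> P" for p
    by (rule abs_expect_le) (use that \<psi> sub_P in blast)
  have S_self: "p \<in> S p" if "p \<in> P" for p using that by (simp add: S_def dst_self)
  have S_trans: "r \<in> S p" if "p \<in> P" "q \<in> S p" "r \<in> S q" for p q r
  proof -
    have PP: "q \<in> P" "r \<in> P" using that by (auto simp: S_def)
    have "\<epsilon> * dst r p \<le> \<epsilon> * (dst r q + dst q p)"
      using \<open>0 < \<epsilon>\<close> dst_triangle[of r q p] that PP by simp
    then show ?thesis using that by (auto simp: S_def algebra_simps)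
  qed
  have step: "\<exists>q. q \<in> P \<and> q \<in> S p \<and> (\<forall>r\<in>S p. expect r \<psi> \<le> expect q \<psi> + (1/2)^n)" if pP: "p \<in> P" for p and n :: nat
  proof -
    have bdd: "bdd_above ((\<lambda>r. expect r \<psi>) ` S p)"
      using bnd by (intro bdd_aboveI2[where M = B]) (force simp: S_def)
    have "(SUP r\<in>S p. expect r \<psi>) - (1/2)^n < (SUP r\<in>S p. expect r \<psi>)" by simp
    then obtain q where "q \<in> S p" "(SUP r\<in>S p. expect r \<psi>) - (1/2)^n < expect q \<psi>"
      using less_cSUP_iff[OF _ bdd, of "(SUP r\<in>S p. expect r \<psi>) - (1/2)^n"] S_self[OF pP] by auto
    moreover have "expect r \<psi> \<le> (SUP r\<in>S p. expect r \<psi>)" if "r \<in> S p" for r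
      by (rule cSUP_upper[OF that bdd])
    ultimately show ?thesis by (intro exI[of _ q]) (force simp: S_def)
  qed
  obtain d0 where "d0 \<in> D" using D_ne by blast
  then have ex0: "\<exists>p. p \<in> P" using return_P by blast
  have "\<exists>u. \<forall>n. u n \<in> P \<and> (u (Suc n) \<in> S (u n) \<and> (\<forall>r\<in>S (u n). expect r \<psi> \<le> expect (u (Suc n)) \<psi> + (1/2)^n))"
    by (rule dependent_nat_choice[of "\<lambda>_ p. p \<in> P"
        "\<lambda>n p q. q \<in> S p \<and> (\<forall>r\<in>S p. expect r \<psi> \<le> expect q \<psi> + (1/2)^n)"]) (use ex0 step in blast)+
  then obtain u where uP: "\<And>n. u n \<in> P" and uS: "\<And>n. u (Suc n) \<in> S (u n)"
    and umax: "\<And>n r. r \<in> S (u n) \<Longrightarrow> expect r \<psi> \<le> expect (u (Suc n)) \<psi> + (1/2)^n" by blast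
  have u_in: "u (n + k) \<in> S (u n)" for n k
  proof (induction k)
    case 0
    then show ?case using S_self uP by simp
  next
    case (Suc k)
    show ?case using S_trans[OF uP Suc uS] by simp
  qed
  have u_le: "expect (u n) \<psi> + \<epsilon> * dst (u m) (u n) \<le> expect (u m) \<psi>" if "n \<le> m" for m n
    using u_in[of n "m - n"] that by (simp add: S_def)
  have inc: "incseq (\<lambda>n. expect (u n) \<psi>)"
  proof (rule monoI)
    fix m n :: nat assume "m \<le> n"
    moreover have "0 \<le> \<epsilon> * dst (u n) (u m)" using dst_nonneg[OF uP uP] \<open>0 < \<epsilon>\<close> by simp
    ultimately show "expect (u m) \<psi> \<le> expect (u n) \<psi>" using u_le[of m n] by linarith
  qed
  obtain s where s: "(\<lambda>n. expect (u n) \<psi>) \<longlonglongrightarrow> s" and le_s: "\<And>n. expect (u n) \<psi> \<le> s"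
    by (rule incseq_convergent[OF inc, of B]) (use bnd uP abs_le_D1 in blast)+
  have cauchy: "\<exists>n0. \<forall>m\<ge>n0. \<forall>n\<ge>n0. dst (u m) (u n) < e" if "0 < e" for e
  proof -
    have "0 < \<epsilon> * e" using that \<open>0 < \<epsilon>\<close> by simp
    then obtain n0 where n0: "\<And>n. n \<ge> n0 \<Longrightarrow> s - \<epsilon> * e < expect (u n) \<psi>"
      using order_tendstoD(1)[OF s, of "s - \<epsilon> * e"] by (auto simp: eventually_sequentially)
    have *: "dst (u m) (u n) < e" if "n0 \<le> n" "n \<le> m" for m n
    proof -
      have "\<epsilon> * dst (u m) (u n) < \<epsilon> * e"
        using u_le[OF that(2)] n0[OF that(1)] le_s[of m] by linarith
      then show ?thesis using \<open>0 < \<epsilon>\<close> by simp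
    qed
    have sym: "dst p q = dst q p" for p q by (simp add: dst_def abs_minus_commute)
    show ?thesis using * sym nat_le_linear by metis
  qed
  have opt: "expect p \<psi> \<le> s + \<epsilon> * c" if p: "p \<in> P" and ev: "\<forall>\<^sub>F n in sequentially. dst p (u n) \<le> c" for p c
  proof (rule ccontr)
    assume "\<not> ?thesis"
    then have gt: "s + \<epsilon> * c < expect p \<psi>" by simp
    from ev have "\<forall>\<^sub>F n in sequentially. expect p \<psi> \<le> expect (u (Suc n)) \<psi> + (1/2)^n"
    proof eventually_elim
      case (elim n)
      have "\<epsilon> * dst p (u n) \<le> \<epsilon> * c" using elim \<open>0 < \<epsilon>\<close> by simp
      then have "p \<in> S (u n)" using gt le_s[of n] p by (simp add: S_def)
      then show ?case by (rule umax)
    qed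
    moreover have "(\<lambda>n. expect (u (Suc n)) \<psi> + (1/2)^n) \<longlonglongrightarrow> s + 0"
      by (intro tendsto_add LIMSEQ_Suc[OF s] LIMSEQ_realpow_zero) auto
    ultimately have "expect p \<psi> \<le> s + 0"
      by (intro tendsto_lowerbound[of _ "s + 0" sequentially]) auto
    moreover obtain n where "dst p (u n) \<le> c" using ev by (auto simp: eventually_sequentially)
    then have "0 \<le> \<epsilon> * c" using dst_nonneg[OF p uP[of n]] \<open>0 < \<epsilon>\<close> by simp
    ultimately show False using gt by simp
  qed
  show ?thesis using uP s cauchy opt by blast
qed

text \<open>By \<open>ekeland\<close>, the value of \<open>\<psi>\<close> at \<open>p\<close>
  exceeds \<open>s\<close> by at most \<epsilon> times the norm distance of \<open>p\<close> from
  the limit functional \<open>U\<close>. That distance is a maximum over \<open>A\<close>, attained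
  at an element depending on \<open>p\<close>; the minimax theorem exchanges the quantifiers and
  yields one \<phi> for all \<open>p\<close>, the perturbing functional.\<close>

lemma bishop_phelps:
  fixes \<psi> :: "'d \<Rightarrow> real"
  assumes \<psi>: "\<And>d. d \<in> D \<Longrightarrow> \<bar>\<psi> d\<bar> \<le> B" and "0 < \<epsilon>"
  obtains \<phi> u U s where "\<phi> \<in> A" "\<And>n. u n \<in> P"
    "uniform_limit A (\<lambda>n \<theta>. expect (u n) (ev \<theta>)) U sequentially"
    "(\<lambda>n. expect (u n) \<psi>) \<longlonglongrightarrow> s" "\<And>d. d \<in> D \<Longrightarrow> \<psi> d - \<epsilon> * ev \<phi> d \<le> s - \<epsilon> * U \<phi>"
proof -
  obtain u s where uP: "\<And>n. u n \<in> P" and s: "(\<lambda>n. expect (u n) \<psi>) \<longlonglongrightarrow> s"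
    and cauchy: "\<And>e. 0 < e \<Longrightarrow> \<exists>n0. \<forall>m\<ge>n0. \<forall>n\<ge>n0. dst (u m) (u n) < e"
    and opt: "\<And>p c. \<lbrakk>p \<in> P; \<forall>\<^sub>F n in sequentially. dst p (u n) \<le> c\<rbrakk> \<Longrightarrow> expect p \<psi> \<le> s + \<epsilon> * c"
    using ekeland[of \<psi> B \<epsilon>] assms by blast
  have "uniformly_convergent_on A (\<lambda>n \<theta>. expect (u n) (ev \<theta>))"
  proof (rule Cauchy_uniformly_convergent, unfold uniformly_Cauchy_on_def, intro allI impI)
    fix e :: real assume "0 < e"
    then obtain n0 where "\<forall>m\<ge>n0. \<forall>n\<ge>n0. dst (u m) (u n) < e" using cauchy by blast
    then show "\<exists>M. \<forall>\<theta>\<in>A. \<forall>m\<ge>M. \<forall>n\<ge>M. dist (expect (u m) (ev \<theta>)) (expect (u n) (ev \<theta>)) < e"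
      unfolding dist_real_def using dst_ge[OF uP uP] by (meson le_less_trans)
  qed
  then obtain U where U: "uniform_limit A (\<lambda>n \<theta>. expect (u n) (ev \<theta>)) U sequentially"
    by (auto simp: uniformly_convergent_on_def)
  have contU: "continuous_on A U"
    by (rule uniform_limit_theorem[OF _ U]) (auto simp: continuous_on_expect uP)
  have limU: "(\<lambda>n. expect (u n) (ev \<theta>)) \<longlonglongrightarrow> U \<theta>" if "\<theta> \<in> A" for \<theta>
    by (rule tendsto_uniform_limitI[OF U that])
  have U_lin: "U \<theta>'' = a * U \<theta> + b * U \<theta>'"
    if "\<theta> \<in> A" "\<theta>' \<in> A" "\<theta>'' \<in> A" "\<And>d. d \<in> D \<Longrightarrow> ev \<theta>'' d = a * ev \<theta> d + b * ev \<theta>' d" for \<theta> \<theta>' \<theta>'' a b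
  proof (rule LIMSEQ_unique[OF limU[OF that(3)]])
    have "(\<lambda>n. a * expect (u n) (ev \<theta>) + b * expect (u n) (ev \<theta>')) \<longlonglongrightarrow> a * U \<theta> + b * U \<theta>'"
      by (intro tendsto_intros limU that)
    then show "(\<lambda>n. expect (u n) (ev \<theta>'')) \<longlonglongrightarrow> a * U \<theta> + b * U \<theta>'"
      using expect_linear[OF sub_P[OF uP] that] by simp
  qed
  define f where "f \<phi> p = \<epsilon> * (expect p (ev \<phi>) - U \<phi>) - (expect p \<psi> - s)" for \<phi> p
  have "\<exists>\<phi>\<in>A. \<forall>p\<in>P. 0 \<le> f \<phi> p"
  proof (rule minimax[OF compactA A_ne])
    fix p assume "p \<in> P"
    then show "continuous_on A (\<lambda>\<phi>. f \<phi> p)"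
      unfolding f_def by (intro continuous_intros continuous_on_expect contU)
  next
    fix \<phi> \<phi>' and t :: real assume a: "\<phi> \<in> A" "\<phi>' \<in> A" "0 \<le> t" "t \<le> 1"
    from mix_ev[OF this] obtain \<phi>'' where \<phi>'': "\<phi>'' \<in> A" "\<And>d. d \<in> D \<Longrightarrow> ev \<phi>'' d = t * ev \<phi> d + (1 - t) * ev \<phi>' d"
      by blast
    have e1: "U \<phi>'' = t * U \<phi> + (1 - t) * U \<phi>'" by (rule U_lin[OF a(1,2) \<phi>''(1)]) (rule \<phi>''(2))
    have e2: "expect p (ev \<phi>'') = t * expect p (ev \<phi>) + (1 - t) * expect p (ev \<phi>')" if "p \<in> P" for p
      by (rule expect_linear[OF sub_P[OF that] a(1,2) \<phi>''(1)]) (rule \<phi>''(2))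
    have "f \<phi>'' p = t * f \<phi> p + (1 - t) * f \<phi>' p" if "p \<in> P" for p
      unfolding f_def e1 e2[OF that] by (simp add: algebra_simps)
    then show "\<exists>\<phi>''\<in>A. \<forall>p\<in>P. f \<phi>'' p = t * f \<phi> p + (1 - t) * f \<phi>' p" using \<phi>'' by blast
  next
    fix p q and t :: real assume a: "p \<in> P" "q \<in> P" "0 \<le> t" "t \<le> 1"
    from mix_P[OF this] obtain r where "r \<in> P" "\<And>h :: 'd \<Rightarrow> real. expect r h = t * expect p h + (1 - t) * expect q h"
      by blast
    then show "\<exists>r\<in>P. \<forall>\<phi>\<in>A. f \<phi> r = t * f \<phi> p + (1 - t) * f \<phi> q"
      by (intro bexI[of _ r] ballI; simp only: f_def; simp add: field_simps)
  next
    fix p assume p: "p \<in> P"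
    obtain \<phi> where \<phi>: "\<phi> \<in> A" and max: "\<And>\<theta>. \<theta> \<in> A \<Longrightarrow> expect p (ev \<theta>) - U \<theta> \<le> expect p (ev \<phi>) - U \<phi>"
      using continuous_attains_sup[OF compactA A_ne, of "\<lambda>\<theta>. expect p (ev \<theta>) - U \<theta>"]
        continuous_on_diff[OF continuous_on_expect[OF p] contU] by blast
    define c where "c = expect p (ev \<phi>) - U \<phi>"
    have absc: "\<bar>expect p (ev \<theta>) - U \<theta>\<bar> \<le> c" if \<theta>A: "\<theta> \<in> A" for \<theta>
    proof -
      obtain \<theta>' where "\<theta>' \<in> A" "\<And>d. d \<in> D \<Longrightarrow> ev \<theta>' d = - 1 * ev \<theta> d + 0 * ev \<theta> d"
        using neg_ev[OF \<theta>A] by auto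
      then have "expect p (ev \<theta>') - U \<theta>' = - (expect p (ev \<theta>) - U \<theta>)" "\<theta>' \<in> A"
        using U_lin[of \<theta> \<theta> \<theta>' "- 1" 0] expect_linear[OF sub_P[OF p], of \<theta> \<theta> \<theta>' "- 1" 0] \<theta>A by auto
      then show ?thesis using max[OF \<theta>A] max[of \<theta>'] unfolding c_def by linarith
    qed
    have "expect p \<psi> \<le> s + \<epsilon> * c"
    proof (rule field_le_epsilon)
      fix e :: real assume "0 < e"
      then have "0 < e / \<epsilon>" using \<open>0 < \<epsilon>\<close> by simp
      \<comment> \<open>The distance from \<open>p\<close> to \<open>U\<close> is at most
        \<open>c\<close>, so the distance to \<open>u n\<close> is at most \<open>c\<close> plus the
        uniform error; \<open>e / \<epsilon>\<close> leaves exactly \<open>e\<close> after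
        multiplication by \<epsilon>.\<close>
      from uniform_limitD[OF U this]
      have "\<forall>\<^sub>F n in sequentially. dst p (u n) \<le> c + e / \<epsilon>"
      proof eventually_elim
        case (elim n)
        show ?case
        proof (rule dst_le)
          fix \<theta> assume "\<theta> \<in> A"
          then show "\<bar>expect p (ev \<theta>) - expect (u n) (ev \<theta>)\<bar> \<le> c + e / \<epsilon>"
            using elim absc[of \<theta>] by (force simp: dist_real_def)
        qed
      qed
      moreover have "\<epsilon> * (c + e / \<epsilon>) = \<epsilon> * c + e" using \<open>0 < \<epsilon>\<close> by (simp add: distrib_left)
      ultimately show "expect p \<psi> \<le> s + \<epsilon> * c + e" using opt[OF p, of "c + e / \<epsilon>"] by simp
    qed
    then have "0 \<le> f \<phi> p" by (simp add: f_def c_def)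
    then show "\<exists>\<phi>\<in>A. 0 \<le> f \<phi> p" using \<phi> by blast
  qed
  then obtain \<phi> where \<phi>: "\<phi> \<in> A" "\<And>p. p \<in> P \<Longrightarrow> 0 \<le> f \<phi> p" by blast
  have "\<psi> d - \<epsilon> * ev \<phi> d \<le> s - \<epsilon> * U \<phi>" if "d \<in> D" for d
    using \<phi>(2)[OF return_P[OF that]] by (simp add: f_def algebra_simps)
  from that[OF \<phi>(1) uP U s this] show thesis .
qed

text \<open>Weak-star continuous linear functionals on the ball, that is, elements of the predual;
  linearity is read off the values on \<open>D\<close>.\<close>

definition lin :: "('a \<Rightarrow> real) \<Rightarrow> bool" where
  "lin r \<longleftrightarrow> continuous_on A r \<and>
     (\<forall>\<theta>\<in>A. \<forall>\<theta>'\<in>A. \<forall>\<theta>''\<in>A. \<forall>a b. (\<forall>d\<in>D. ev \<theta>'' d = a * ev \<theta> d + b * ev \<theta>' d) \<longrightarrow> r \<theta>'' = a * r \<theta> + b * r \<theta>')"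

lemma linD:
  "\<lbrakk>lin r; \<theta> \<in> A; \<theta>' \<in> A; \<theta>'' \<in> A; \<forall>d\<in>D. ev \<theta>'' d = a * ev \<theta> d + b * ev \<theta>' d\<rbrakk> \<Longrightarrow> r \<theta>'' = a * r \<theta> + b * r \<theta>'"
  unfolding lin_def by blast

text \<open>An element of the predual of norm at most \<open>\<rho>\<close> lies in
  \<open>\<rho>\<close> times the closed convex hull of \<open>D\<close>. Otherwise minimax gives a
  \<theta> with \<open>r \<theta>\<close> above \<open>\<rho> * ev \<theta> d\<close> by a fixed
  margin for all \<open>d\<close>, although \<open>r \<theta>\<close> is at most
  \<open>\<rho>\<close> times the norm of \<theta>. An error of half the norm suffices, as the step
  will be iterated.\<close>

lemma half_approximation:
  assumes "lin r" "0 < \<rho>" and bnd: "\<And>\<theta>. \<theta> \<in> A \<Longrightarrow> \<bar>r \<theta>\<bar> \<le> \<rho>"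
  shows "\<exists>c\<in>P. \<forall>\<theta>\<in>A. \<bar>r \<theta> - \<rho> * expect c (ev \<theta>)\<bar> \<le> \<rho> / 2"
proof -
  define f where "f \<theta> c = r \<theta> - \<rho> * expect c (ev \<theta>) - \<rho> / 2" for \<theta> c
  have "\<exists>c\<in>P. \<forall>\<theta>\<in>A. f \<theta> c < 0"
  proof (rule ccontr)
    assume "\<not> ?thesis"
    then have ex: "\<And>c. c \<in> P \<Longrightarrow> \<exists>\<theta>\<in>A. 0 \<le> f \<theta> c" by (meson not_less)
    have "\<exists>\<theta>\<in>A. \<forall>c\<in>P. 0 \<le> f \<theta> c"
    proof (rule minimax[OF compactA A_ne])
      fix c assume "c \<in> P"
      then show "continuous_on A (\<lambda>\<theta>. f \<theta> c)"
        unfolding f_def using \<open>lin r\<close> by (intro continuous_intros continuous_on_expect) (auto simp: lin_def)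
    next
      fix \<phi> \<phi>' and t :: real assume a: "\<phi> \<in> A" "\<phi>' \<in> A" "0 \<le> t" "t \<le> 1"
      from mix_ev[OF this] obtain \<phi>'' where \<phi>'': "\<phi>'' \<in> A" "\<And>d. d \<in> D \<Longrightarrow> ev \<phi>'' d = t * ev \<phi> d + (1 - t) * ev \<phi>' d"
        by blast
      have "r \<phi>'' = t * r \<phi> + (1 - t) * r \<phi>'" using linD[OF \<open>lin r\<close> a(1,2) \<phi>''(1)] \<phi>''(2) by blast
      then have "f \<phi>'' p = t * f \<phi> p + (1 - t) * f \<phi>' p" if "p \<in> P" for p
        using expect_linear[OF sub_P[OF that] a(1,2) \<phi>''] by (simp only: f_def) (simp add: field_simps)
      then show "\<exists>\<phi>''\<in>A. \<forall>p\<in>P. f \<phi>'' p = t * f \<phi> p + (1 - t) * f \<phi>' p" using \<phi>'' by blast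
    next
      fix p q and t :: real assume a: "p \<in> P" "q \<in> P" "0 \<le> t" "t \<le> 1"
      from mix_P[OF this] obtain r' where "r' \<in> P" "\<And>h :: 'd \<Rightarrow> real. expect r' h = t * expect p h + (1 - t) * expect q h"
        by blast
      then show "\<exists>r\<in>P. \<forall>\<phi>\<in>A. f \<phi> r = t * f \<phi> p + (1 - t) * f \<phi> q"
        by (intro bexI[of _ r'] ballI; simp only: f_def; simp add: field_simps)
    qed (rule ex)
    then obtain \<theta> where \<theta>: "\<theta> \<in> A" "\<And>c. c \<in> P \<Longrightarrow> 0 \<le> f \<theta> c" by blast
    have ge: "\<rho> * ev \<theta> d + \<rho> / 2 \<le> r \<theta>" if "d \<in> D" for d
      using \<theta>(2)[OF return_P[OF that]] by (simp add: f_def)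
    have scaled: "r \<theta> \<le> s * \<rho> \<and> (\<forall>d\<in>D. \<bar>ev \<theta> d\<bar> \<le> s)" if s: "0 < s" "\<And>d. d \<in> D \<Longrightarrow> ev \<theta> d \<le> s" for s
    proof -
      obtain \<theta>' where \<theta>': "\<theta>' \<in> A" "\<forall>d\<in>D. ev \<theta> d = s * ev \<theta>' d"
        using scale_ev[OF \<theta>(1) s(1)] s(2) by blast
      then have "r \<theta> = s * r \<theta>'" using linD[OF \<open>lin r\<close> \<theta>'(1) \<theta>'(1) \<theta>(1), of s 0] by simp
      moreover have "r \<theta>' \<le> \<rho>" using bnd[OF \<theta>'(1)] by simp
      moreover have "\<bar>ev \<theta> d\<bar> \<le> s" if "d \<in> D" for d
        using \<theta>' bound_ev[OF \<theta>'(1) that] s that by (simp add: abs_mult)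
      ultimately show ?thesis using s by simp
    qed
    let ?m = "SUP d\<in>D. ev \<theta> d"
    have bdd: "bdd_above (ev \<theta> ` D)"
      using bound_ev[OF \<theta>(1)] by (intro bdd_aboveI2[where M = 1]) force
    have le_m: "ev \<theta> d \<le> ?m" if "d \<in> D" for d by (rule cSUP_upper[OF that bdd])
    have "?m \<le> (r \<theta> - \<rho> / 2) / \<rho>"
    proof (rule cSUP_least[OF D_ne])
      fix d assume "d \<in> D"
      from ge[OF this] show "ev \<theta> d \<le> (r \<theta> - \<rho> / 2) / \<rho>" using \<open>0 < \<rho>\<close> by (simp add: field_simps)
    qed
    then have m: "\<rho> * ?m + \<rho> / 2 \<le> r \<theta>" using \<open>0 < \<rho>\<close> by (simp add: field_simps)
    \<comment> \<open>\<open>scale_ev\<close> needs a positive factor, but \<open>?m\<close> may be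
      0 or negative. If \<open>?m\<close> is nonnegative, the factor \<open>?m + 1/4\<close> stays
      below the margin 1/2. If it is negative, all values are at most 1/8, then also in modulus, and
      -1/8 + 1/2 exceeds 1/8.\<close>
    show False
    proof (cases "0 \<le> ?m")
      case True
      then have "r \<theta> \<le> (?m + 1/4) * \<rho>" using scaled[of "?m + 1/4"] le_m by force
      then show False using m \<open>0 < \<rho>\<close> by (simp add: algebra_simps)
    next
      case False
      then have "\<And>d. d \<in> D \<Longrightarrow> ev \<theta> d \<le> 1/8" using le_m by force
      then have s: "r \<theta> \<le> 1/8 * \<rho>" "\<forall>d\<in>D. \<bar>ev \<theta> d\<bar> \<le> 1/8" using scaled[of "1/8"] by auto
      obtain d where "d \<in> D" using D_ne by blast
      have "\<rho> * (- (1/8)) \<le> \<rho> * ev \<theta> d"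
        using s(2) \<open>d \<in> D\<close> \<open>0 < \<rho>\<close> by (intro mult_left_mono) force+
      then show False using ge[OF \<open>d \<in> D\<close>] s(1) \<open>0 < \<rho>\<close> by simp
    qed
  qed
  then obtain c where c: "c \<in> P" "\<And>\<theta>. \<theta> \<in> A \<Longrightarrow> r \<theta> - \<rho> * expect c (ev \<theta>) < \<rho> / 2"
    by (auto simp: f_def)
  have "\<bar>r \<theta> - \<rho> * expect c (ev \<theta>)\<bar> \<le> \<rho> / 2" if \<theta>A: "\<theta> \<in> A" for \<theta>
  proof -
    obtain \<theta>' where \<theta>': "\<theta>' \<in> A" "\<And>d. d \<in> D \<Longrightarrow> ev \<theta>' d = - 1 * ev \<theta> d + 0 * ev \<theta> d"
      using neg_ev[OF \<theta>A] by auto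
    then have "r \<theta>' = - r \<theta>" "expect c (ev \<theta>') = - expect c (ev \<theta>)"
      using linD[OF \<open>lin r\<close> \<theta>A \<theta>A \<theta>'(1), of "- 1" 0] expect_linear[OF sub_P[OF c(1)] \<theta>A \<theta>A \<theta>'] by auto
    then show ?thesis using c(2)[OF \<theta>A] c(2)[OF \<theta>'(1)] by (simp only: abs_le_iff) simp
  qed
  then show ?thesis using c(1) by blast
qed

text \<open>Iterating the halving step writes the limit as \<open>\<Sum>n. 2\<^sup>-\<^sup>n E(c\<^sub>n)\<close>; total mass \<open>2\<close> explains the factor.\<close>

lemma limit_representation:
  assumes uP: "\<And>n. u n \<in> P" and U: "uniform_limit A (\<lambda>n \<theta>. expect (u n) (ev \<theta>)) U sequentially"
  obtains q where "set_pmf q \<subseteq> D" "\<And>\<theta>. \<theta> \<in> A \<Longrightarrow> U \<theta> = 2 * expect q (ev \<theta>)"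
proof -
  have limU: "(\<lambda>n. expect (u n) (ev \<theta>)) \<longlonglongrightarrow> U \<theta>" if "\<theta> \<in> A" for \<theta>
    by (rule tendsto_uniform_limitI[OF U that])
  have linU: "lin U"
    unfolding lin_def
  proof (intro conjI ballI allI impI)
    show "continuous_on A U"
      by (rule uniform_limit_theorem[OF _ U]) (auto simp: continuous_on_expect uP)
    fix \<theta> \<theta>' \<theta>'' a b
    assume a: "\<theta> \<in> A" "\<theta>' \<in> A" "\<theta>'' \<in> A" "\<forall>d\<in>D. ev \<theta>'' d = a * ev \<theta> d + b * ev \<theta>' d"
    show "U \<theta>'' = a * U \<theta> + b * U \<theta>'"
    proof (rule LIMSEQ_unique[OF limU[OF a(3)]])
      have "(\<lambda>n. a * expect (u n) (ev \<theta>) + b * expect (u n) (ev \<theta>')) \<longlonglongrightarrow> a * U \<theta> + b * U \<theta>'"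
        by (intro tendsto_intros limU a)
      then show "(\<lambda>n. expect (u n) (ev \<theta>'')) \<longlonglongrightarrow> a * U \<theta> + b * U \<theta>'"
        using expect_linear[OF sub_P[OF uP] a(1-3)] a(4) by simp
    qed
  qed
  have U_le: "\<bar>U \<theta>\<bar> \<le> 1" if "\<theta> \<in> A" for \<theta>
    by (rule tendsto_upperbound[OF tendsto_rabs[OF limU[OF that]]])
       (use abs_expect_le_one[OF sub_P[OF uP] that] in auto)
  let ?Q = "\<lambda>n r. lin r \<and> (\<forall>\<theta>\<in>A. \<bar>r \<theta>\<bar> \<le> (1/2)^n)"
  let ?R = "\<lambda>n r r'. \<exists>c\<in>P. \<forall>\<theta>\<in>A. r' \<theta> = r \<theta> - (1/2)^n * expect c (ev \<theta>)"
  have step: "\<exists>r'. ?Q (Suc n) r' \<and> ?R n r r'" if Qr: "?Q n r" for n r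
  proof -
    obtain c where c: "c \<in> P" "\<And>\<theta>. \<theta> \<in> A \<Longrightarrow> \<bar>r \<theta> - (1/2)^n * expect c (ev \<theta>)\<bar> \<le> (1/2)^n / 2"
      using half_approximation[of r "(1/2)^n"] Qr by (metis zero_less_power half_gt_zero zero_less_one)
    have "lin (\<lambda>\<theta>. r \<theta> - (1/2)^n * expect c (ev \<theta>))"
      unfolding lin_def
    proof (intro conjI ballI allI impI)
      show "continuous_on A (\<lambda>\<theta>. r \<theta> - (1/2)^n * expect c (ev \<theta>))"
        using that by (intro continuous_intros continuous_on_expect c) (auto simp: lin_def)
      fix \<theta> \<theta>' \<theta>'' a b
      assume a: "\<theta> \<in> A" "\<theta>' \<in> A" "\<theta>'' \<in> A" "\<forall>d\<in>D. ev \<theta>'' d = a * ev \<theta> d + b * ev \<theta>' d"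
      have "r \<theta>'' = a * r \<theta> + b * r \<theta>'" using linD[OF _ a] that by blast
      moreover have "expect c (ev \<theta>'') = a * expect c (ev \<theta>) + b * expect c (ev \<theta>')"
        using expect_linear[OF sub_P[OF c(1)] a(1-3)] a(4) by blast
      ultimately show "r \<theta>'' - (1/2)^n * expect c (ev \<theta>'') =
          a * (r \<theta> - (1/2)^n * expect c (ev \<theta>)) + b * (r \<theta>' - (1/2)^n * expect c (ev \<theta>'))"
        by (simp add: algebra_simps)
    qed
    then show ?thesis using c by (intro exI[of _ "\<lambda>\<theta>. r \<theta> - (1/2)^n * expect c (ev \<theta>)"]) auto
  qed
  have "?Q 0 U" using linU U_le by simp
  have "\<exists>R. \<forall>n. (?Q n (R n) \<and> (n = 0 \<longrightarrow> R n = U)) \<and> ?R n (R n) (R (Suc n))"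
    by (rule dependent_nat_choice[of "\<lambda>n r. ?Q n r \<and> (n = 0 \<longrightarrow> r = U)" ?R])
       (use \<open>?Q 0 U\<close> step in blast)+
  then obtain R where R: "\<And>n. ?Q n (R n)" "R 0 = U" "\<And>n. ?R n (R n) (R (Suc n))" by blast
  from R(3) obtain c where c: "\<And>n. c n \<in> P"
    "\<And>n \<theta>. \<theta> \<in> A \<Longrightarrow> R (Suc n) \<theta> = R n \<theta> - (1/2)^n * expect (c n) (ev \<theta>)" by metis
  \<comment> \<open>The geometric law gives \<open>c n\<close> the weight
    \<open>(1/2)^(n+1)\<close>, half of its coefficient in the series.\<close>
  define q where "q = bind_pmf (geometric_pmf (1/2)) c"
  have setq: "set_pmf q \<subseteq> D" using sub_P[OF c(1)] by (auto simp: q_def)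
  have "U \<theta> = 2 * expect q (ev \<theta>)" if "\<theta> \<in> A" for \<theta>
  proof -
    have partial: "(\<Sum>n<m. (1/2)^n * expect (c n) (ev \<theta>)) = U \<theta> - R m \<theta>" for m
      by (induction m) (auto simp: R(2) c(2)[OF that])
    have "(\<lambda>m. R m \<theta>) \<longlonglongrightarrow> 0"
      by (rule Lim_null_comparison[where g = "\<lambda>n. (1/2)^n"])
         (use R(1) that in \<open>auto intro: LIMSEQ_realpow_zero\<close>)
    then have "(\<lambda>m. U \<theta> - R m \<theta>) \<longlonglongrightarrow> U \<theta> - 0" by (intro tendsto_intros)
    then have sums: "(\<lambda>n. (1/2)^n * expect (c n) (ev \<theta>)) sums U \<theta>"
      by (simp add: sums_def partial)
    have "expect q (ev \<theta>) = expect (geometric_pmf (1/2)) (\<lambda>n. expect (c n) (ev \<theta>))"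
      unfolding q_def by (rule expect_bind[where B = 1]) (use setq that bound_ev in \<open>unfold q_def, blast\<close>)
    also have "\<dots> = (\<integral>n. pmf (geometric_pmf (1/2)) n *\<^sub>R expect (c n) (ev \<theta>) \<partial>count_space UNIV)"
      unfolding measure_pmf_eq_density by (rule integral_density) auto
    also have "\<dots> = (\<Sum>n. (1/2)^n * (1/2) * expect (c n) (ev \<theta>))"
    proof (subst integral_count_space_nat)
      have "summable (\<lambda>n. norm ((1/2::real)^n * (1/2) * expect (c n) (ev \<theta>)))"
      proof (rule summable_comparison_test'[where g = "\<lambda>n. (1/2)^n"])
        fix n :: nat
        have "(1/2::real)^n * ((1/2) * \<bar>expect (c n) (ev \<theta>)\<bar>) \<le> (1/2)^n * 1"
          using abs_expect_le_one[OF sub_P[OF c(1)[of n]] that] by (intro mult_left_mono) auto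
        then show "norm (norm ((1/2::real)^n * (1/2) * expect (c n) (ev \<theta>))) \<le> (1/2)^n"
          by (simp add: abs_mult mult_ac)
      qed (simp add: summable_geometric)
      then show "integrable (count_space UNIV) (\<lambda>n. pmf (geometric_pmf (1/2)) n *\<^sub>R expect (c n) (ev \<theta>))"
        by (simp add: integrable_count_space_nat_iff)
    qed simp
    also have "\<dots> = (\<Sum>n. (1/2) * ((1/2)^n * expect (c n) (ev \<theta>)))" by (simp add: mult_ac)
    also have "\<dots> = (1/2) * U \<theta>"
      using sums_mult[OF sums, of "1/2"] by (simp add: sums_iff)
    finally show ?thesis by simp
  qed
  from that[OF setq this] show thesis .
qed

end

subsection \<open>Bounded multilinear mappings\<close>

lemma normed_space_over_mult: "normed_space_over ((*) :: 'k \<Rightarrow> 'k \<Rightarrow> 'k::real_or_complex)"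
  by unfold_locales (auto simp: algebra_simps norm_mult scaleR_conv_of_real)

lemma linear_spaces_iff:
  assumes "normed_space_over s" "normed_space_over t"
  shows "Vector_Spaces.linear s t f \<longleftrightarrow> (\<forall>a b. f (a + b) = f a + f b) \<and> (\<forall>c a. f (s c a) = t c (f a))"
  using assms by (simp add: Vector_Spaces.linear_iff normed_space_over_def)

lemma dual_space_iff:
  assumes "normed_space_over s"
  shows "f \<in> dual_space s \<longleftrightarrow> (\<forall>c a. blinfun_apply f (s c a) = c * blinfun_apply f a)"
  unfolding dual_space_def
  by (simp add: linear_spaces_iff[OF assms normed_space_over_mult] blinfun.add_right)

lemma dual_scale_apply [simp]: "blinfun_apply (dual_scale c f) a = c * blinfun_apply f a"
  by (simp add: dual_scale_def)

lemma norm_dual_scale: "norm (dual_scale c f) = norm c * norm f"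
proof (cases "c = 0")
  case True
  then show ?thesis by (simp add: dual_scale_def blinfun_eqI)
next
  case False
  have le: "norm (dual_scale c f) \<le> norm c * norm f" for c and f :: "'a \<Rightarrow>\<^sub>L 'b"
    by (rule norm_blinfun_bound) (auto simp: norm_mult mult.assoc intro!: mult_left_mono norm_blinfun)
  have "f = dual_scale (inverse c) (dual_scale c f)"
    using False by (intro blinfun_eqI) simp
  then have "norm f \<le> norm (inverse c) * norm (dual_scale c f)" by (metis le)
  then have "norm c * norm f \<le> norm (dual_scale c f)"
    using False by (simp add: norm_inverse norm_divide field_simps)
  then show ?thesis using le[of c f] by simp
qed

lemma normed_space_over_dual_scale:
  "normed_space_over (dual_scale :: 'k \<Rightarrow> ('x::real_normed_vector \<Rightarrow>\<^sub>L 'k::real_or_complex) \<Rightarrow> _)"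
  by unfold_locales
     (auto simp: norm_dual_scale scaleR_conv_of_real blinfun.add_left blinfun.scaleR_left algebra_simps intro!: blinfun_eqI)

context normed_space_over
begin

lemma zero_dual: "0 \<in> dual_space scale"
  and dual_add: "f \<in> dual_space scale \<Longrightarrow> g \<in> dual_space scale \<Longrightarrow> f + g \<in> dual_space scale"
  and dual_diff: "f \<in> dual_space scale \<Longrightarrow> g \<in> dual_space scale \<Longrightarrow> f - g \<in> dual_space scale"
  and dual_dual_scale: "f \<in> dual_space scale \<Longrightarrow> dual_scale c f \<in> dual_space scale"
  and dual_scaleR: "f \<in> dual_space scale \<Longrightarrow> r *\<^sub>R f \<in> dual_space scale"
  by (auto simp: dual_space_iff[OF normed_space_over_axioms] blinfun.add_left blinfun.diff_left
      blinfun.scaleR_left algebra_simps)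

lemma dual_sum: "(\<And>i. i \<in> I \<Longrightarrow> f i \<in> dual_space scale) \<Longrightarrow> (\<Sum>i\<in>I. f i) \<in> dual_space scale"
  by (induction I rule: infinite_finite_induct) (auto simp: zero_dual dual_add)

lemma dual_apply_scale: "f \<in> dual_space scale \<Longrightarrow> blinfun_apply f (scale c a) = c * blinfun_apply f a"
  by (simp add: dual_space_iff[OF normed_space_over_axioms])

end

definition unit_tuples :: "nat \<Rightarrow> (nat \<Rightarrow> 'x::real_normed_vector) set" where
  "unit_tuples N = {x. \<forall>i<N. norm (x i) \<le> 1}"

text \<open>Multilinearity separated from continuity, which is expressed by a bound on
  \<open>unit_tuples\<close> instead; such a bound is easier to transport through
  constructions.\<close>

definition mlin :: "nat \<Rightarrow> ('k \<Rightarrow> 'x \<Rightarrow> 'x) \<Rightarrow> ('k \<Rightarrow> 'z \<Rightarrow> 'z) \<Rightarrow> ((nat \<Rightarrow> 'x::plus) \<Rightarrow> 'z::plus) \<Rightarrow> bool" where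
  "mlin N sX sZ \<Psi> \<longleftrightarrow> (\<forall>x y. (\<forall>i<N. x i = y i) \<longrightarrow> \<Psi> x = \<Psi> y) \<and>
     (\<forall>i<N. \<forall>x a b. \<Psi> (x(i := a + b)) = \<Psi> (x(i := a)) + \<Psi> (x(i := b))) \<and>
     (\<forall>i<N. \<forall>x c a. \<Psi> (x(i := sX c a)) = sZ c (\<Psi> (x(i := a))))"

lemma mlin_cong: "mlin N sX sZ \<Psi> \<Longrightarrow> (\<And>i. i < N \<Longrightarrow> x i = y i) \<Longrightarrow> \<Psi> x = \<Psi> y"
  and mlin_add: "mlin N sX sZ \<Psi> \<Longrightarrow> i < N \<Longrightarrow> \<Psi> (x(i := a + b)) = \<Psi> (x(i := a)) + \<Psi> (x(i := b))"
  and mlin_scale: "mlin N sX sZ \<Psi> \<Longrightarrow> i < N \<Longrightarrow> \<Psi> (x(i := sX c a)) = sZ c (\<Psi> (x(i := a)))"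
  unfolding mlin_def by blast+

locale normed_space_pair = X: normed_space_over sX + Z: normed_space_over sZ
  for sX :: "'k::real_or_complex \<Rightarrow> 'x::real_normed_vector \<Rightarrow> 'x"
    and sZ :: "'k \<Rightarrow> 'z::real_normed_vector \<Rightarrow> 'z"
begin

lemma mlin_real: 
  assumes "mlin N sX sZ \<Psi>" "i < N" shows "\<Psi> (x(i := r *\<^sub>R a)) = r *\<^sub>R \<Psi> (x(i := a))"
  using mlin_scale[OF assms, of x "of_real r" a] by (simp add: X.scale_of_real Z.scale_of_real)

lemma mlin_zero: "mlin N sX sZ \<Psi> \<Longrightarrow> i < N \<Longrightarrow> \<Psi> (x(i := 0)) = 0"
  using mlin_real[of N \<Psi> i x 0] by simp

lemma mlin_diff:
  assumes "mlin N sX sZ \<Psi>" "i < N" shows "\<Psi> (x(i := a - b)) = \<Psi> (x(i := a)) - \<Psi> (x(i := b))"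
  using mlin_add[OF assms, of x "a - b" b] by (simp add: algebra_simps)

lemma mlin_scaleR:
  assumes "mlin N sX sZ \<Psi>"
  shows "\<Psi> (\<lambda>i. r i *\<^sub>R x i) = (\<Prod>i<N. r i) *\<^sub>R \<Psi> x"
proof -
  have "\<Psi> (\<lambda>i. if i < m then r i *\<^sub>R x i else x i) = (\<Prod>i<m. r i) *\<^sub>R \<Psi> x" if "m \<le> N" for m
    using that
  proof (induction m)
    case (Suc m)
    let ?y = "\<lambda>i. if i < m then r i *\<^sub>R x i else x i"
    have "(\<lambda>i. if i < Suc m then r i *\<^sub>R x i else x i) = ?y(m := r m *\<^sub>R x m)" by (auto simp: less_Suc_eq)
    then have "\<Psi> (\<lambda>i. if i < Suc m then r i *\<^sub>R x i else x i) = r m *\<^sub>R \<Psi> (?y(m := x m))"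
      using mlin_real[OF assms, of m ?y] Suc.prems by simp
    also have "?y(m := x m) = ?y" by auto
    finally show ?case using Suc by (simp add: mult.commute)
  qed simp
  from this[OF order_refl] show ?thesis
    using mlin_cong[OF assms, of "\<lambda>i. r i *\<^sub>R x i" "\<lambda>i. if i < N then r i *\<^sub>R x i else x i"] by simp
qed

lemma mlin_bound:
  assumes "mlin N sX sZ \<Psi>" and B: "\<And>x. x \<in> unit_tuples N \<Longrightarrow> norm (\<Psi> x) \<le> B"
  shows "norm (\<Psi> x) \<le> B * (\<Prod>i<N. norm (x i))"
proof -
  have "norm a *\<^sub>R sgn a = a" for a :: 'x by (cases "a = 0") (simp_all add: sgn_div_norm)
  then have "\<Psi> x = \<Psi> (\<lambda>i. norm (x i) *\<^sub>R sgn (x i))" by simp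
  also have "\<dots> = (\<Prod>i<N. norm (x i)) *\<^sub>R \<Psi> (\<lambda>i. sgn (x i))" by (rule mlin_scaleR[OF assms(1)])
  finally have "norm (\<Psi> x) = (\<Prod>i<N. norm (x i)) * norm (\<Psi> (\<lambda>i. sgn (x i)))"
    by (simp add: prod_nonneg)
  also have "\<dots> \<le> (\<Prod>i<N. norm (x i)) * B"
    by (intro mult_left_mono B prod_nonneg) (auto simp: unit_tuples_def norm_sgn)
  finally show ?thesis by (simp add: mult.commute)
qed

lemma mlin_continuous:
  assumes \<Psi>: "mlin N sX sZ \<Psi>" and B: "\<And>x. norm (\<Psi> x) \<le> B * (\<Prod>i<N. norm (x i))"
  shows "continuous_on UNIV \<Psi>"
  unfolding continuous_on_def
proof (intro ballI)
  fix a :: "nat \<Rightarrow> 'x"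
  let ?F = "at a within UNIV"
  have co: "((\<lambda>x. x i) \<longlongrightarrow> a i) ?F" for i
  proof -
    have "((\<lambda>x. x) \<longlongrightarrow> a) ?F" by (rule tendsto_ident_at)
    then show ?thesis by (simp only: tendsto_fun_iff)
  qed
  \<comment> \<open>A hybrid of \<open>x\<close> and \<open>a\<close>: raising \<open>m\<close> by
    one changes a single coordinate by \<open>x m - a m\<close>, which tends to 0 while the other
    factors of the bound converge.\<close>
  define mx where "mx m x i = (if i < m then x i else a i)" for m :: nat and x i
  have "((\<lambda>x. \<Psi> (mx m x)) \<longlongrightarrow> \<Psi> a) ?F" if "m \<le> N" for m
    using that
  proof (induction m)
    case 0
    then show ?case by (simp add: mx_def)
  next
    case (Suc m)
    then have m: "m < N" by simp
    have "\<Psi> (mx (Suc m) x) - \<Psi> (mx m x) = \<Psi> ((mx m x)(m := x m - a m))" for x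
    proof -
      have "mx (Suc m) x = (mx m x)(m := x m)" "mx m x = (mx m x)(m := a m)"
        by (auto simp: mx_def less_Suc_eq)
      then show ?thesis using mlin_diff[OF \<Psi> m, of "mx m x" "x m" "a m"] by metis
    qed
    moreover have "((\<lambda>x. \<Psi> ((mx m x)(m := x m - a m))) \<longlongrightarrow> 0) ?F"
    proof (rule Lim_null_comparison)
      show "\<forall>\<^sub>F x in ?F. norm (\<Psi> ((mx m x)(m := x m - a m))) \<le>
          B * (\<Prod>i<N. norm (((mx m x)(m := x m - a m)) i))"
        by (intro always_eventually allI B)
      have lim: "((\<lambda>x. norm (((mx m x)(m := x m - a m)) i)) \<longlongrightarrow> (if i = m then 0 else norm (a i))) ?F" for i
        using tendsto_norm[OF tendsto_diff[OF co[of m] tendsto_const[of "a m"]]] tendsto_norm[OF co[of i]]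
        by (cases "i = m"; cases "i < m"; simp add: mx_def)
      have "((\<lambda>x. B * (\<Prod>i<N. norm (((mx m x)(m := x m - a m)) i))) \<longlongrightarrow>
          B * (\<Prod>i<N. if i = m then 0 else norm (a i))) ?F"
        by (intro tendsto_intros lim)
      also have "(\<Prod>i<N. if i = m then 0 else norm (a i)) = 0" using m by (intro prod_zero) auto
      finally show "((\<lambda>x. B * (\<Prod>i<N. norm (((mx m x)(m := x m - a m)) i))) \<longlongrightarrow> 0) ?F" by simp
    qed
    ultimately have "((\<lambda>x. \<Psi> (mx (Suc m) x) - \<Psi> (mx m x)) \<longlongrightarrow> 0) ?F" by simp
    from tendsto_add[OF this Suc.IH] m show ?case by simp
  qed
  from this[OF order_refl] have "((\<lambda>x. \<Psi> (mx N x)) \<longlongrightarrow> \<Psi> a) ?F" .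
  moreover have "\<Psi> (mx N x) = \<Psi> x" for x by (rule mlin_cong[OF \<Psi>]) (simp add: mx_def)
  ultimately show "(\<Psi> \<longlongrightarrow> \<Psi> a) ?F" by simp
qed

text \<open>Without a bound there are unit tuples with values beyond \<open>(n+1)^(N+1)\<close>.
  Scaling all coordinates by \<open>1/(n+1)\<close> costs only the factor \<open>(n+1)^N\<close>, so
  the values still exceed \<open>n+1\<close>, while the scaled tuples tend to 0, against continuity
  there.\<close>

lemma mlin_continuous_bounded:
  assumes \<Psi>: "mlin N sX sZ \<Psi>" and cont: "continuous_on UNIV \<Psi>"
  shows "\<exists>B. \<forall>x\<in>unit_tuples N. norm (\<Psi> x) \<le> B"
proof (rule ccontr)
  assume "\<not> ?thesis"
  then have "\<exists>x\<in>unit_tuples N. real (Suc n) ^ N * real (Suc n) < norm (\<Psi> x)" for n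
    by (meson not_le)
  then obtain x where x: "\<And>n. x n \<in> unit_tuples N" "\<And>n. real (Suc n) ^ N * real (Suc n) < norm (\<Psi> (x n))"
    by metis
  define y where "y n i = (if i < N then (1 / real (Suc n)) *\<^sub>R x n i else 0)" for n i
  have "\<Psi> (y n) = \<Psi> (\<lambda>i. (1 / real (Suc n)) *\<^sub>R x n i)" for n
    by (rule mlin_cong[OF \<Psi>]) (simp add: y_def)
  then have \<Psi>y: "\<Psi> (y n) = (1 / real (Suc n)) ^ N *\<^sub>R \<Psi> (x n)" for n
    by (simp add: mlin_scaleR[OF \<Psi>])
  have "y \<longlonglongrightarrow> (\<lambda>i. 0)"
    unfolding tendsto_fun_iff
  proof
    fix i
    show "(\<lambda>n. y n i) \<longlonglongrightarrow> 0"
    proof (rule Lim_null_comparison)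
      have "norm (y n i) \<le> inverse (real (Suc n))" for n
      proof (cases "i < N")
        case True
        then have "norm (x n i) \<le> 1" using x(1)[of n] by (simp add: unit_tuples_def)
        then have "1 / real (Suc n) * norm (x n i) \<le> 1 / real (Suc n) * 1" by (intro mult_left_mono) auto
        then show ?thesis using True by (simp add: y_def inverse_eq_divide)
      qed (simp add: y_def)
      then show "\<forall>\<^sub>F n in sequentially. norm (y n i) \<le> inverse (real (Suc n))" by simp
    qed (rule LIMSEQ_inverse_real_of_nat)
  qed
  then have "(\<lambda>n. \<Psi> (y n)) \<longlonglongrightarrow> \<Psi> (\<lambda>i. 0)"
    using continuous_on_tendsto_compose[OF cont] by simp
  then have "Bseq (\<lambda>n. \<Psi> (y n))" using convergentI convergent_imp_Bseq by blast
  then obtain K where K: "\<And>n. norm (\<Psi> (y n)) \<le> K" by (auto simp: Bseq_def)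
  obtain n where n: "K < real n" using reals_Archimedean2 by blast
  have "real (Suc n) < norm (\<Psi> (y n))"
  proof -
    have "norm (\<Psi> (y n)) = norm (\<Psi> (x n)) / real (Suc n) ^ N"
      by (simp add: \<Psi>y power_one_over divide_inverse mult.commute power_inverse)
    then have "real (Suc n) ^ N * norm (\<Psi> (y n)) = norm (\<Psi> (x n))"
      by (simp add: field_simps del: of_nat_Suc)
    then have "real (Suc n) ^ N * real (Suc n) < real (Suc n) ^ N * norm (\<Psi> (y n))"
      using x(2)[of n] by simp
    then show ?thesis by (simp add: mult_less_cancel_left_pos del: of_nat_Suc)
  qed
  then show False using K[of n] n by simp
qed

lemma sym_multilinear_iff:
  "\<Psi> \<in> sym_multilinear N sX sZ \<longleftrightarrow> mlin N sX sZ \<Psi> \<and> (\<exists>B. \<forall>x\<in>unit_tuples N. norm (\<Psi> x) \<le> B) \<and>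
     (\<forall>\<pi> x. \<pi> permutes {..<N} \<longrightarrow> \<Psi> (x \<circ> \<pi>) = \<Psi> x)"
proof -
  have "mlin N sX sZ \<Psi> \<longleftrightarrow> (\<forall>x y. (\<forall>i<N. x i = y i) \<longrightarrow> \<Psi> x = \<Psi> y) \<and>
     (\<forall>i<N. \<forall>x. Vector_Spaces.linear sX sZ (\<lambda>a. \<Psi> (x(i := a))))"
    unfolding mlin_def linear_spaces_iff[OF X.normed_space_over_axioms Z.normed_space_over_axioms] by blast
  moreover have "continuous_on UNIV \<Psi> \<longleftrightarrow> (\<exists>B. \<forall>x\<in>unit_tuples N. norm (\<Psi> x) \<le> B)" if "mlin N sX sZ \<Psi>"
  proof
    assume "\<exists>B. \<forall>x\<in>unit_tuples N. norm (\<Psi> x) \<le> B"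
    then obtain B where "\<And>x. x \<in> unit_tuples N \<Longrightarrow> norm (\<Psi> x) \<le> B" by blast
    then show "continuous_on UNIV \<Psi>"
      by (intro mlin_continuous[OF that, of B] mlin_bound[OF that]) 
  qed (rule mlin_continuous_bounded[OF that])
  ultimately show ?thesis
    unfolding sym_multilinear_def mem_Collect_eq by argo
qed

lemma multilinear_norm_ge:
  assumes "mlin N sX sZ \<Psi>" "\<forall>x\<in>unit_tuples N. norm (\<Psi> x) \<le> B" "x \<in> unit_tuples N"
  shows "norm (\<Psi> x) \<le> multilinear_norm N \<Psi>"
  unfolding multilinear_norm_def unit_tuples_def[symmetric]
  using assms by (intro cSUP_upper bdd_aboveI2[where M = B]) auto

end

lemma unit_tuples_ne: "(\<lambda>_. 0) \<in> unit_tuples N" by (simp add: unit_tuples_def)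

lemma multilinear_norm_le:
  assumes "\<And>x. x \<in> unit_tuples N \<Longrightarrow> norm (\<Psi> x) \<le> B"
  shows "multilinear_norm N \<Psi> \<le> B"
  unfolding multilinear_norm_def unit_tuples_def[symmetric]
  using unit_tuples_ne[of N] by (intro cSUP_least assms) auto

subsection \<open>Multilinear forms on the product with a predual\<close>

locale form_space = X: normed_space_over sX + W: normed_space_over sW
  for sX :: "'k::real_or_complex \<Rightarrow> 'x::real_normed_vector \<Rightarrow> 'x"
    and sW :: "'k \<Rightarrow> 'w::real_normed_vector \<Rightarrow> 'w" +
  fixes N :: nat
begin

sublocale XK: normed_space_pair sX "(*)"
  by (intro normed_space_pair.intro X.normed_space_over_axioms normed_space_over_mult)

text \<open>Maps into the dual of \<open>W\<close> written as scalar forms with the predual variable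
  last. The bound is imposed at every argument and not only on \<open>D\<close>, so that pointwise
  limits stay in the set and each value is confined to a fixed ball.\<close>

definition forms :: "real \<Rightarrow> ((nat \<Rightarrow> 'x) \<times> 'w \<Rightarrow> 'k) set" where
  "forms B = {\<theta>. (\<forall>w. mlin N sX (*) (\<lambda>x. \<theta> (x, w))) \<and>
     (\<forall>x v w. \<theta> (x, v + w) = \<theta> (x, v) + \<theta> (x, w)) \<and>
     (\<forall>x c w. \<theta> (x, sW c w) = c * \<theta> (x, w)) \<and>
     (\<forall>x w. norm (\<theta> (x, w)) \<le> B * (\<Prod>i<N. norm (x i)) * norm w)}"

definition sforms :: "real \<Rightarrow> ((nat \<Rightarrow> 'x) \<times> 'w \<Rightarrow> 'k) set" where
  "sforms B = {\<theta> \<in> forms B. \<forall>\<pi> x w. \<pi> permutes {..<N} \<longrightarrow> \<theta> (x \<circ> \<pi>, w) = \<theta> (x, w)}"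

definition D :: "((nat \<Rightarrow> 'x) \<times> 'w) set" where
  "D = {(x, w). x \<in> unit_tuples N \<and> norm w \<le> 1}"

lemma formsD:
  assumes "\<theta> \<in> forms B"
  shows "mlin N sX (*) (\<lambda>x. \<theta> (x, w))" "\<theta> (x, v + w) = \<theta> (x, v) + \<theta> (x, w)"
    "\<theta> (x, sW c w) = c * \<theta> (x, w)" "norm (\<theta> (x, w)) \<le> B * (\<Prod>i<N. norm (x i)) * norm w"
  using assms by (simp_all add: forms_def)

lemma sforms_forms: "\<theta> \<in> sforms B \<Longrightarrow> \<theta> \<in> forms B"
  by (simp add: sforms_def)

lemma forms_bound_D:
  assumes "\<theta> \<in> forms B" "0 \<le> B" "d \<in> D" shows "norm (\<theta> d) \<le> B"
proof -
  obtain x w where d: "d = (x, w)" "x \<in> unit_tuples N" "norm w \<le> 1" using assms by (auto simp: D_def)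
  have "norm (\<theta> (x, w)) \<le> B * (\<Prod>i<N. norm (x i)) * norm w" using formsD(4)[OF assms(1)] .
  also have "\<dots> \<le> B * 1 * 1"
    using d assms(2) by (intro mult_mono mult_nonneg_nonneg prod_nonneg prod_le_1) (auto simp: unit_tuples_def)
  finally show ?thesis using d by simp
qed

lemma forms_mono:
  assumes "\<theta> \<in> forms B" "B \<le> C" shows "\<theta> \<in> forms C"
proof -
  have "B * (\<Prod>i<N. norm (x i)) * norm w \<le> C * (\<Prod>i<N. norm (x i)) * norm w" for x :: "nat \<Rightarrow> 'x" and w :: 'w
    using assms by (intro mult_right_mono prod_nonneg) auto
  then show ?thesis using assms unfolding forms_def mem_Collect_eq by (meson order_trans)
qed

lemma forms_combination:
  assumes "\<theta> \<in> forms B" "\<theta>' \<in> forms B'"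
  shows "(\<lambda>d. a * \<theta> d + b * \<theta>' d) \<in> forms (norm a * B + norm b * B')"
proof -
  have "norm (a * \<theta> (x, w) + b * \<theta>' (x, w)) \<le> (norm a * B + norm b * B') * (\<Prod>i<N. norm (x i)) * norm w" for x w
  proof -
    have "norm (a * \<theta> (x, w) + b * \<theta>' (x, w)) \<le> norm a * norm (\<theta> (x, w)) + norm b * norm (\<theta>' (x, w))"
      by (metis norm_mult norm_triangle_ineq)
    also have "\<dots> \<le> norm a * (B * (\<Prod>i<N. norm (x i)) * norm w) + norm b * (B' * (\<Prod>i<N. norm (x i)) * norm w)"
      using formsD(4)[OF assms(1)] formsD(4)[OF assms(2)] by (intro add_mono mult_left_mono) auto
    finally show ?thesis by (simp add: algebra_simps)
  qed
  moreover have "mlin N sX (*) (\<lambda>x. a * \<theta> (x, w) + b * \<theta>' (x, w))" for w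
    unfolding mlin_def
  proof (intro conjI allI impI)
    fix x y :: "nat \<Rightarrow> 'x" assume eq: "\<forall>i<N. x i = y i"
    have "\<theta> (x, w) = \<theta> (y, w)" by (rule mlin_cong[OF formsD(1)[OF assms(1)]]) (use eq in simp)
    moreover have "\<theta>' (x, w) = \<theta>' (y, w)" by (rule mlin_cong[OF formsD(1)[OF assms(2)]]) (use eq in simp)
    ultimately show "a * \<theta> (x, w) + b * \<theta>' (x, w) = a * \<theta> (y, w) + b * \<theta>' (y, w)" by simp
  next
    fix i x y z assume i: "i < N"
    show "a * \<theta> (x(i := y + z), w) + b * \<theta>' (x(i := y + z), w) =
        a * \<theta> (x(i := y), w) + b * \<theta>' (x(i := y), w) + (a * \<theta> (x(i := z), w) + b * \<theta>' (x(i := z), w))"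
      by (simp add: mlin_add[OF formsD(1)[OF assms(1)] i] mlin_add[OF formsD(1)[OF assms(2)] i] algebra_simps)
    show "a * \<theta> (x(i := sX c y), w) + b * \<theta>' (x(i := sX c y), w) =
        c * (a * \<theta> (x(i := y), w) + b * \<theta>' (x(i := y), w))" for c
      by (simp add: mlin_scale[OF formsD(1)[OF assms(1)] i] mlin_scale[OF formsD(1)[OF assms(2)] i] algebra_simps)
  qed
  ultimately show ?thesis
    unfolding forms_def mem_Collect_eq
    by (simp add: formsD(2,3)[OF assms(1)] formsD(2,3)[OF assms(2)] algebra_simps)
qed

lemma sforms_combination:
  assumes "\<theta> \<in> sforms B" "\<theta>' \<in> sforms B'"
  shows "(\<lambda>d. a * \<theta> d + b * \<theta>' d) \<in> sforms (norm a * B + norm b * B')"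
  using assms forms_combination[of \<theta> B \<theta>' B' a b] by (auto simp: sforms_def)

text \<open>Multiplying \<open>w\<close> by a unimodular scalar stays in \<open>D\<close> and
  rotates the value, so a one-sided bound on real parts bounds moduli. Thus the supremum of
  \<open>re\<close> over \<open>D\<close> is the norm of the form.\<close>

lemma forms_norm_le:
  assumes \<theta>: "\<theta> \<in> forms B" and le: "\<And>d. d \<in> D \<Longrightarrow> re (\<theta> d) \<le> s"
  shows "\<theta> \<in> forms s" "d \<in> D \<Longrightarrow> norm (\<theta> d) \<le> s"
proof -
  have norm_le: "norm (\<theta> d) \<le> s" if dD: "d \<in> D" for d
  proof (rule norm_le_of_re_le)
    fix a :: 'k assume a: "norm a = 1"
    obtain x w where d: "d = (x, w)" "x \<in> unit_tuples N" "norm w \<le> 1" using dD by (auto simp: D_def)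
    then have "(x, sW a w) \<in> D" by (simp add: D_def W.norm_scale a)
    from le[OF this] show "re (a * \<theta> d) \<le> s" by (simp add: d formsD(3)[OF \<theta>])
  qed
  then show "d \<in> D \<Longrightarrow> norm (\<theta> d) \<le> s" .
  have "norm (\<theta> (x, w)) \<le> (s * norm w) * (\<Prod>i<N. norm (x i))" for x w
  proof (rule XK.mlin_bound[OF formsD(1)[OF \<theta>]])
    fix x :: "nat \<Rightarrow> 'x" assume x: "x \<in> unit_tuples N"
    have "norm w *\<^sub>R sgn w = w" by (cases "w = 0") (simp_all add: sgn_div_norm)
    then have "w = sW (of_real (norm w)) (sgn w)" by (simp add: W.scale_of_real)
    then have "\<theta> (x, w) = of_real (norm w) * \<theta> (x, sgn w)" by (metis formsD(3)[OF \<theta>])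
    moreover have "norm (\<theta> (x, sgn w)) \<le> s" using x by (intro norm_le) (simp add: D_def norm_sgn)
    ultimately show "norm (\<theta> (x, w)) \<le> s * norm w"
      by (simp add: norm_mult mult.commute[of s] mult_left_mono)
  qed
  then show "\<theta> \<in> forms s"
    using \<theta> by (simp add: forms_def mult_ac)
qed

lemma closed_sforms: "closed (sforms B)"
proof -
  have [simp]: "continuous_on UNIV (\<lambda>\<theta> :: (nat \<Rightarrow> 'x) \<times> 'w \<Rightarrow> 'k. \<theta> d)" for d
    by (rule continuous_on_product_coordinates)
  show ?thesis
    unfolding sforms_def forms_def mlin_def mem_Collect_eq
    by (intro closed_Collect_conj closed_Collect_all closed_Collect_imp closed_Collect_eq closed_Collect_le
      open_Collect_const continuous_intros) auto
qed

text \<open>Banach-Alaoglu for symmetric forms: every defining condition involves finitely many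
  evaluations, hence is closed, and the values lie in compact balls.\<close>

lemma compact_sforms: "compact (sforms B)"
proof -
  have "compact ({\<theta> :: (nat \<Rightarrow> 'x) \<times> 'w \<Rightarrow> 'k. \<forall>d. norm (\<theta> d) \<le> B * (\<Prod>i<N. norm (fst d i)) * norm (snd d)} \<inter> sforms B)"
    by (intro compact_Int_closed closed_sforms compact_scalar_functions)
  moreover have "{\<theta> :: (nat \<Rightarrow> 'x) \<times> 'w \<Rightarrow> 'k. \<forall>d. norm (\<theta> d) \<le> B * (\<Prod>i<N. norm (fst d i)) * norm (snd d)} \<inter> sforms B
      = sforms B"
    by (auto simp: sforms_def forms_def)
  ultimately show ?thesis by simp
qed

lemma zero_sforms: "0 \<le> B \<Longrightarrow> (\<lambda>_. 0) \<in> sforms B"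
  by (auto simp: sforms_def forms_def mlin_def intro!: mult_nonneg_nonneg prod_nonneg)

lemma ball_pairing_forms: "ball_pairing (sforms 1) D (\<lambda>\<theta> d. re (\<theta> d))"
proof
  show "compact (sforms 1)" by (rule compact_sforms)
  show "sforms 1 \<noteq> {}" using zero_sforms[of 1] by auto
  show "D \<noteq> {}" using unit_tuples_ne[of N] by (auto simp: D_def intro!: exI[of _ "0 :: 'w"])
  show "continuous_on (sforms 1) (\<lambda>\<theta>. re (\<theta> d))" for d
    by (intro continuous_on_re continuous_on_subset[OF continuous_on_product_coordinates]) auto
  fix \<theta> assume \<theta>: "\<theta> \<in> sforms 1"
  show "\<bar>re (\<theta> d)\<bar> \<le> 1" if "d \<in> D" for d
    using abs_re_le[of "\<theta> d"] forms_bound_D[OF sforms_forms[OF \<theta>] _ that] by simp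
  show "\<exists>\<theta>''\<in>sforms 1. \<forall>d\<in>D. re (\<theta>'' d) = s * re (\<theta> d) + (1 - s) * re (\<theta>' d)"
    if "\<theta>' \<in> sforms 1" "0 \<le> s" "s \<le> 1" for \<theta>' s
    using sforms_combination[OF \<theta> that(1), of "of_real s" "of_real (1 - s)"] that
    by (intro bexI[of _ "\<lambda>d. of_real s * \<theta> d + of_real (1 - s) * \<theta>' d"])
       (auto simp: re_add re_of_real_mult simp del: of_real_diff)
  show "\<exists>\<theta>'\<in>sforms 1. \<forall>d\<in>D. re (\<theta>' d) = - re (\<theta> d)"
    using sforms_combination[OF \<theta> \<theta>, of "- 1" 0]
    by (intro bexI[of _ "\<lambda>d. - 1 * \<theta> d + 0 * \<theta> d"]) (auto simp: re_minus)
  show "\<exists>\<theta>'\<in>sforms 1. \<forall>d\<in>D. re (\<theta> d) = s * re (\<theta>' d)" if s: "0 < s" "\<forall>d\<in>D. re (\<theta> d) \<le> s" for s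
  proof (intro bexI[of _ "\<lambda>d. of_real (1 / s) * \<theta> d + 0 * \<theta> d"] ballI)
    have "\<theta> \<in> sforms s" using forms_norm_le(1)[OF sforms_forms[OF \<theta>], of s] s \<theta> by (auto simp: sforms_def)
    from sforms_combination[OF this this, of "of_real (1 / s)" 0]
    show "(\<lambda>d. of_real (1 / s) * \<theta> d + 0 * \<theta> d) \<in> sforms 1" using s by (simp add: norm_divide)
    show "re (\<theta> d) = s * re (of_real (1 / s) * \<theta> d + 0 * \<theta> d)" for d
      using s by (simp add: re_of_real_mult del: of_real_divide)
  qed
qed

section \<open>Symmetrization of forms and of measures\<close>

abbreviation Perms :: "(nat \<Rightarrow> nat) set" where
  "Perms \<equiv> {\<pi>. \<pi> permutes {..<N}}"

lemma finite_Perms: "finite Perms" and Perms_ne: "Perms \<noteq> {}"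
  using finite_permutations[of "{..<N}"] permutes_id[of "{..<N}"] by (simp, blast)

definition sym_form :: "((nat \<Rightarrow> 'x) \<times> 'w \<Rightarrow> 'k) \<Rightarrow> (nat \<Rightarrow> 'x) \<times> 'w \<Rightarrow> 'k" where
  "sym_form \<theta> d = (\<Sum>\<pi>\<in>Perms. \<theta> (fst d \<circ> \<pi>, snd d)) / of_nat (card Perms)"

text \<open>Updating coordinate \<open>i\<close> before composing with \<pi> updates coordinate
  \<open>inv \<pi> i\<close> afterwards, so every summand is multilinear. Permutations preserve the
  product of the norms, hence the average keeps the bound; a shift of the summation index gives
  symmetry.\<close>

lemma sym_form_sforms:
  assumes \<theta>: "\<theta> \<in> forms B"
  shows "sym_form \<theta> \<in> sforms B"
proof -
  have card: "0 < card Perms" using finite_Perms Perms_ne by (simp add: card_gt_0_iff)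
  have mlin: "mlin N sX (*) (\<lambda>x. sym_form \<theta> (x, w))" for w
    unfolding mlin_def
  proof (intro conjI allI impI)
    fix x y :: "nat \<Rightarrow> 'x" assume eq: "\<forall>i<N. x i = y i"
    have "\<theta> (x \<circ> \<pi>, w) = \<theta> (y \<circ> \<pi>, w)" if "\<pi> \<in> Perms" for \<pi>
      by (rule mlin_cong[OF formsD(1)[OF \<theta>]]) (use that eq in \<open>auto simp: permutes_in_image dest: permutes_in_image\<close>)
    then show "sym_form \<theta> (x, w) = sym_form \<theta> (y, w)" by (simp add: sym_form_def)
  next
    fix i and x :: "nat \<Rightarrow> 'x" and a b :: 'x assume i: "i < N"
    have upd: "(x(i := c)) \<circ> \<pi> = (x \<circ> \<pi>)(inv \<pi> i := c)" if "\<pi> \<in> Perms" for \<pi> c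
      using that by (auto simp: fun_eq_iff permutes_inverses)
    have inv: "inv \<pi> i < N" if "\<pi> \<in> Perms" for \<pi>
      using permutes_in_image[OF permutes_inv, of \<pi> "{..<N}" i] that i by auto
    show "sym_form \<theta> (x(i := a + b), w) = sym_form \<theta> (x(i := a), w) + sym_form \<theta> (x(i := b), w)"
      unfolding sym_form_def fst_conv snd_conv add_divide_distrib[symmetric] sum.distrib[symmetric]
      by (intro arg_cong2[where f = "(/)"] sum.cong refl)
         (simp add: upd mlin_add[OF formsD(1)[OF \<theta>] inv])
    show "sym_form \<theta> (x(i := sX c a), w) = c * sym_form \<theta> (x(i := a), w)" for c
      unfolding sym_form_def fst_conv snd_conv times_divide_eq_right sum_distrib_left
      by (intro arg_cong2[where f = "(/)"] sum.cong refl)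
         (simp add: upd mlin_scale[OF formsD(1)[OF \<theta>] inv])
  qed
  have bound: "norm (sym_form \<theta> (x, w)) \<le> B * (\<Prod>i<N. norm (x i)) * norm w" for x w
  proof -
    have "norm (\<theta> (x \<circ> \<pi>, w)) \<le> B * (\<Prod>i<N. norm (x i)) * norm w" if "\<pi> \<in> Perms" for \<pi>
    proof -
      have "(\<Prod>i<N. norm ((x \<circ> \<pi>) i)) = (\<Prod>i<N. norm (x i))"
        using prod.permute[of \<pi> "{..<N}" "\<lambda>i. norm (x i)"] that by (simp add: o_def)
      then show ?thesis using formsD(4)[OF \<theta>, of "x \<circ> \<pi>" w] by simp
    qed
    then have "norm (\<Sum>\<pi>\<in>Perms. \<theta> (x \<circ> \<pi>, w)) \<le> of_nat (card Perms) * (B * (\<Prod>i<N. norm (x i)) * norm w)"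
      by (rule sum_norm_bound)
    then show ?thesis using card by (simp add: sym_form_def norm_divide field_simps)
  qed
  have sym: "sym_form \<theta> (x \<circ> \<sigma>, w) = sym_form \<theta> (x, w)" if \<sigma>: "\<sigma> permutes {..<N}" for \<sigma> x w
  proof -
    have "(\<Sum>\<pi>\<in>Perms. \<theta> (x \<circ> \<sigma> \<circ> \<pi>, w)) = (\<Sum>\<pi>\<in>Perms. \<theta> (x \<circ> \<pi>, w))"
    proof (rule sum.reindex_bij_witness[of _ "\<lambda>\<pi>. inv \<sigma> \<circ> \<pi>" "\<lambda>\<pi>. \<sigma> \<circ> \<pi>"])
      fix \<pi> assume "\<pi> \<in> Perms"
      then have \<pi>: "\<pi> permutes {..<N}" by simp
      show "inv \<sigma> \<circ> (\<sigma> \<circ> \<pi>) = \<pi>" "\<sigma> \<circ> (inv \<sigma> \<circ> \<pi>) = \<pi>"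
        by (simp_all only: o_assoc permutes_inv_o[OF \<sigma>] id_o)
      show "\<sigma> \<circ> \<pi> \<in> Perms" "inv \<sigma> \<circ> \<pi> \<in> Perms"
        using permutes_compose[OF \<pi> \<sigma>] permutes_compose[OF \<pi> permutes_inv[OF \<sigma>]] by simp_all
      show "\<theta> (x \<circ> (\<sigma> \<circ> \<pi>), w) = \<theta> (x \<circ> \<sigma> \<circ> \<pi>, w)" by (simp only: o_assoc)
    qed
    then show ?thesis by (simp add: sym_form_def)
  qed
  show ?thesis
    unfolding sforms_def forms_def mem_Collect_eq
    using mlin bound sym
    by (auto simp: sym_form_def formsD(2,3)[OF \<theta>] sum.distrib add_divide_distrib sum_distrib_left)
qed

text \<open>Convergence is known on symmetric forms only; symmetric measures extend it to all forms.\<close>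

definition sym_pmf :: "((nat \<Rightarrow> 'x) \<times> 'w) pmf \<Rightarrow> ((nat \<Rightarrow> 'x) \<times> 'w) pmf" where
  "sym_pmf p = bind_pmf p (\<lambda>d. map_pmf (\<lambda>\<pi>. (fst d \<circ> \<pi>, snd d)) (pmf_of_set Perms))"

lemma set_sym_pmf: "set_pmf p \<subseteq> D \<Longrightarrow> set_pmf (sym_pmf p) \<subseteq> D"
  unfolding sym_pmf_def using finite_Perms Perms_ne
  by (auto simp: D_def unit_tuples_def subset_iff) (metis lessThan_iff permutes_in_image)

text \<open>Symmetrizing measures is the adjoint of symmetrizing forms.\<close>

lemma expect_sym_pmf:
  assumes "set_pmf p \<subseteq> D" "\<theta> \<in> forms B"
  shows "expect (sym_pmf p) (\<lambda>d. re (\<theta> d)) = expect p (\<lambda>d. re (sym_form \<theta> d))"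
proof -
  have \<theta>: "\<theta> \<in> forms \<bar>B\<bar>" by (rule forms_mono[OF assms(2)]) simp
  have bd: "\<bar>re (\<theta> d)\<bar> \<le> \<bar>B\<bar>" if "d \<in> set_pmf (sym_pmf p)" for d
    using abs_re_le[of "\<theta> d"] forms_bound_D[OF \<theta> _ subsetD[OF set_sym_pmf[OF assms(1)] that]] by simp
  have "expect (sym_pmf p) (\<lambda>d. re (\<theta> d)) =
      expect p (\<lambda>d. expect (map_pmf (\<lambda>\<pi>. (fst d \<circ> \<pi>, snd d)) (pmf_of_set Perms)) (\<lambda>d. re (\<theta> d)))"
    unfolding sym_pmf_def
    by (rule expect_bind[where B = "\<bar>B\<bar>"]) (rule bd[unfolded sym_pmf_def])
  also have "(\<lambda>d. expect (map_pmf (\<lambda>\<pi>. (fst d \<circ> \<pi>, snd d)) (pmf_of_set Perms)) (\<lambda>d. re (\<theta> d))) =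
      (\<lambda>d. re (sym_form \<theta> d))"
  proof
    fix d
    have "sym_form \<theta> d = of_real (1 / real (card Perms)) * (\<Sum>\<pi>\<in>Perms. \<theta> (fst d \<circ> \<pi>, snd d))"
      by (simp add: sym_form_def)
    then show "expect (map_pmf (\<lambda>\<pi>. (fst d \<circ> \<pi>, snd d)) (pmf_of_set Perms)) (\<lambda>d. re (\<theta> d)) = re (sym_form \<theta> d)"
      using finite_Perms Perms_ne
      by (simp only: re_of_real_mult) (simp add: integral_pmf_of_set re_sum)
  qed
  finally show ?thesis .
qed

lemma sym_form_eq: "\<theta> \<in> sforms B \<Longrightarrow> sym_form \<theta> = \<theta>"
  using finite_Perms Perms_ne by (auto simp: sym_form_def sforms_def fun_eq_iff)

text \<open>\<open>bishop_phelps\<close> on the ball of symmetric forms, with both descriptions of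
  the limit functional: averages along \<open>p\<close>, and twice the average over
  \<open>q\<close>. The real part of the perturbed form is bounded on \<open>D\<close> by
  \<open>s - \<epsilon> * U \<phi>\<close>, which is the value of the limit functional at that form
  and becomes \<open>m\<close>. Scaling extends convergence from the ball to all symmetric forms,
  symmetrized measures extend it to arbitrary ones.\<close>

lemma attaining_perturbation:
  assumes \<theta>0: "\<theta>0 \<in> sforms B" and "0 < \<epsilon>"
  shows "\<exists>\<phi> p q m. \<phi> \<in> sforms 1 \<and> (\<forall>n::nat. set_pmf (p n) \<subseteq> D) \<and> set_pmf q \<subseteq> D \<and>
    (\<forall>d\<in>D. norm (\<theta>0 d - of_real \<epsilon> * \<phi> d) \<le> m) \<and> 2 * expect q (\<lambda>d. re (\<theta>0 d - of_real \<epsilon> * \<phi> d)) = m \<and>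
    (\<forall>C. \<forall>\<Theta>\<in>forms C. (\<lambda>n. expect (p n) (\<lambda>d. re (\<Theta> d))) \<longlonglongrightarrow> 2 * expect q (\<lambda>d. re (\<Theta> d)))"
proof -
  interpret ball_pairing "sforms 1" D "\<lambda>\<theta> d. re (\<theta> d)" by (rule ball_pairing_forms)
  have \<theta>0': "\<theta>0 \<in> sforms \<bar>B\<bar>" using \<theta>0 forms_mono[of \<theta>0 B "\<bar>B\<bar>"] by (auto simp: sforms_def)
  have "\<bar>re (\<theta>0 d)\<bar> \<le> \<bar>B\<bar>" if "d \<in> D" for d
    using abs_re_le[of "\<theta>0 d"] forms_bound_D[OF sforms_forms[OF \<theta>0'] _ that] by simp
  then obtain \<phi> u U s where \<phi>: "\<phi> \<in> sforms 1" and u: "\<And>n. u n \<in> P"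
    and U: "uniform_limit (sforms 1) (\<lambda>n \<theta>. expect (u n) (\<lambda>d. re (\<theta> d))) U sequentially"
    and s: "(\<lambda>n. expect (u n) (\<lambda>d. re (\<theta>0 d))) \<longlonglongrightarrow> s"
    and max: "\<And>d. d \<in> D \<Longrightarrow> re (\<theta>0 d) - \<epsilon> * re (\<phi> d) \<le> s - \<epsilon> * U \<phi>"
    using bishop_phelps[of "\<lambda>d. re (\<theta>0 d)" "\<bar>B\<bar>" \<epsilon>] \<open>0 < \<epsilon>\<close> by blast
  obtain q where q: "set_pmf q \<subseteq> D" "\<And>\<theta>. \<theta> \<in> sforms 1 \<Longrightarrow> U \<theta> = 2 * expect q (\<lambda>d. re (\<theta> d))"
    using limit_representation[OF u U] by blast
  have lim: "(\<lambda>n. expect (u n) (\<lambda>d. re (\<theta> d))) \<longlonglongrightarrow> 2 * expect q (\<lambda>d. re (\<theta> d))" if "\<theta> \<in> sforms C" for \<theta> C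
  proof -
    define c where "c = \<bar>C\<bar> + 1"
    have c: "0 < c" by (simp add: c_def add_nonneg_pos)
    have "\<theta> \<in> sforms c" using that forms_mono[of \<theta> C c] by (auto simp: sforms_def c_def)
    from sforms_combination[OF this this, of "of_real (1 / c)" 0] c
    have \<theta>': "(\<lambda>d. of_real (1 / c) * \<theta> d) \<in> sforms 1" (is "?\<theta>' \<in> _") by (simp add: norm_divide)
    have re: "re (\<theta> d) = c * re (?\<theta>' d)" for d using c by (simp only: re_of_real_mult) simp
    have "(\<lambda>n. c * expect (u n) (\<lambda>d. re (?\<theta>' d))) \<longlonglongrightarrow> c * U ?\<theta>'"
      by (intro tendsto_intros tendsto_uniform_limitI[OF U \<theta>'])
    then show ?thesis unfolding q(2)[OF \<theta>'] re by (simp add: mult_ac)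
  qed
  define \<psi> where "\<psi> d = \<theta>0 d - of_real \<epsilon> * \<phi> d" for d
  have \<psi>: "\<psi> \<in> sforms (B + \<epsilon>)"
    using sforms_combination[OF \<theta>0 \<phi>, of 1 "- of_real \<epsilon>"] \<open>0 < \<epsilon>\<close> unfolding \<psi>_def by simp
  define m where "m = s - \<epsilon> * U \<phi>"
  have re\<psi>: "re (\<psi> d) = re (\<theta>0 d) - \<epsilon> * re (\<phi> d)" for d
    by (simp add: \<psi>_def re_diff re_of_real_mult)
  have norm_le: "norm (\<psi> d) \<le> m" if "d \<in> D" for d
    by (rule forms_norm_le(2)[OF sforms_forms[OF \<psi>] _ that]) (use max in \<open>simp add: re\<psi> m_def\<close>)
  have attain: "2 * expect q (\<lambda>d. re (\<psi> d)) = m"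
  proof (rule LIMSEQ_unique[OF lim[OF \<psi>]])
    have "expect (u n) (\<lambda>d. re (\<psi> d)) = expect (u n) (\<lambda>d. re (\<theta>0 d)) - \<epsilon> * expect (u n) (\<lambda>d. re (\<phi> d))" for n
      unfolding re\<psi>
      by (subst Bochner_Integration.integral_diff) (auto intro!: integrable_measure_pmf_finite finite_P u)
    moreover have "(\<lambda>n. expect (u n) (\<lambda>d. re (\<theta>0 d)) - \<epsilon> * expect (u n) (\<lambda>d. re (\<phi> d))) \<longlonglongrightarrow> m"
      unfolding m_def by (intro tendsto_intros s tendsto_uniform_limitI[OF U \<phi>])
    ultimately show "(\<lambda>n. expect (u n) (\<lambda>d. re (\<psi> d))) \<longlonglongrightarrow> m" by simp
  qed
  show ?thesis
  proof (intro exI[of _ \<phi>] exI[of _ "\<lambda>n. sym_pmf (u n)"] exI[of _ "sym_pmf q"] exI[of _ m] conjI allI ballI)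
    show "set_pmf (sym_pmf (u n)) \<subseteq> D" for n by (rule set_sym_pmf[OF sub_P[OF u]])
    show "set_pmf (sym_pmf q) \<subseteq> D" by (rule set_sym_pmf[OF q(1)])
    show "norm (\<theta>0 d - of_real \<epsilon> * \<phi> d) \<le> m" if "d \<in> D" for d
      using norm_le[OF that] by (simp add: \<psi>_def)
    show "2 * expect (sym_pmf q) (\<lambda>d. re (\<theta>0 d - of_real \<epsilon> * \<phi> d)) = m"
      using attain expect_sym_pmf[OF q(1) sforms_forms[OF \<psi>]] unfolding sym_form_eq[OF \<psi>] by (simp add: \<psi>_def)
    show "(\<lambda>n. expect (sym_pmf (u n)) (\<lambda>d. re (\<Theta> d))) \<longlonglongrightarrow> 2 * expect (sym_pmf q) (\<lambda>d. re (\<Theta> d))"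
      if "\<Theta> \<in> forms C" for C \<Theta>
      unfolding expect_sym_pmf[OF q(1) that] expect_sym_pmf[OF sub_P[OF u] that]
      by (rule lim[OF sym_form_sforms[OF that]])
  qed (rule \<phi>)
qed

end

subsection \<open>Finite-rank approximation in a separable dual\<close>

lemma blinfun_almost_norm:
  fixes f :: "'a::real_normed_vector \<Rightarrow>\<^sub>L 'b::real_normed_vector"
  assumes "0 < e"
  shows "\<exists>x. norm x \<le> 1 \<and> norm f - e < norm (f x)"
proof (rule ccontr)
  assume "\<not> ?thesis"
  then have le: "norm (f x) \<le> norm f - e" if "norm x \<le> 1" for x using that not_le by blast
  have "norm f \<le> norm f - e"
  proof (rule norm_blinfun_bound)
    show "0 \<le> norm f - e" using le[of 0] by simp
    fix x :: 'a
    have "norm x *\<^sub>R sgn x = x" by (cases "x = 0") (simp_all add: sgn_div_norm)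
    then have "norm (f x) = norm x * norm (f (sgn x))"
      by (metis abs_norm_cancel blinfun.scaleR_right norm_scaleR)
    also have "\<dots> \<le> norm x * (norm f - e)" by (intro mult_left_mono le) (auto simp: norm_sgn)
    finally show "norm (f x) \<le> (norm f - e) * norm x" by (simp add: mult.commute)
  qed
  then show False using assms by simp
qed

text \<open>Square roots of the tails serve as \<sigma>. A term is the difference of two successive
  tails, and factoring this difference of squares bounds the quotient by twice the difference of the
  roots, a telescoping series.\<close>

lemma summable_rescale:
  fixes a :: "nat \<Rightarrow> real"
  assumes "summable a" and pos: "\<And>i. 0 < a i"
  shows "\<exists>\<sigma>. (\<forall>i. 0 < \<sigma> i) \<and> \<sigma> \<longlonglongrightarrow> 0 \<and> summable (\<lambda>i. a i / \<sigma> i)"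
proof -
  define r where "r n = (\<Sum>i. a (i + n))" for n
  have r_pos: "0 < r n" for n
    unfolding r_def using assms by (intro suminf_pos summable_ignore_initial_segment) auto
  have r_Suc: "r n = a n + r (Suc n)" for n
    unfolding r_def using suminf_split_head[OF summable_ignore_initial_segment[OF \<open>summable a\<close>, of n]] by simp
  have r0: "r \<longlonglongrightarrow> 0"
    unfolding r_def using suminf_exist_split2[OF \<open>summable a\<close>] .
  have sq0: "(\<lambda>n. sqrt (r n)) \<longlonglongrightarrow> 0" using tendsto_real_sqrt[OF r0] by simp
  have "summable (\<lambda>n. a n / sqrt (r n))"
  proof (rule summable_comparison_test'[where g = "\<lambda>n. 2 * (sqrt (r n) - sqrt (r (Suc n)))"])
    have "summable (\<lambda>n. sqrt (r n) - sqrt (r (Suc n)))"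
      using telescope_summable'[OF sq0] by simp
    then show "summable (\<lambda>n. 2 * (sqrt (r n) - sqrt (r (Suc n))))" by (rule summable_mult)
    fix n
    let ?s = "sqrt (r n)" and ?t = "sqrt (r (Suc n))"
    have s: "0 < ?s" "0 < ?t" using r_pos by auto
    have "?t \<le> ?s" using r_Suc[of n] pos[of n] by simp
    have "a n = (?s - ?t) * (?s + ?t)"
      using r_Suc[of n] r_pos[of n] r_pos[of "Suc n"] by (simp add: algebra_simps flip: power2_eq_square)
    also have "\<dots> \<le> (?s - ?t) * (2 * ?s)" using s \<open>?t \<le> ?s\<close> by (intro mult_left_mono) auto
    finally have "a n \<le> 2 * (?s - ?t) * ?s" by (simp only: mult_ac)
    then have "a n / ?s \<le> 2 * (?s - ?t)" by (simp only: pos_divide_le_eq[OF s(1)])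
    then show "norm (a n / ?s) \<le> 2 * (?s - ?t)" using s pos[of n] by simp
  qed
  then show ?thesis using r_pos sq0 by (intro exI[of _ "\<lambda>n. sqrt (r n)"]) simp
qed

lemma vector_space_dual_scale:
  "vector_space (dual_scale :: 'k \<Rightarrow> ('x::real_normed_vector \<Rightarrow>\<^sub>L 'k::real_or_complex) \<Rightarrow> _)"
  by (rule normed_space_over.axioms(1)[OF normed_space_over_dual_scale])

context normed_space_over
begin

abbreviation V :: "('x \<Rightarrow>\<^sub>L 'k) set" where "V \<equiv> dual_space scale"

text \<open>Points separate functionals, so coordinates in a finite-dimensional subspace of the dual
  can be computed by evaluation at finitely many points. The induction is a Gram-Schmidt step: what
  the old representation fails to reproduce of \<open>g\<close> is the new basis vector, unless it
  vanishes.\<close>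

lemma dual_basis:
  assumes "finite B" "B \<subseteq> V"
  shows "\<exists>(m::nat) b e. (\<forall>j<m. b j \<in> V) \<and>
    (\<forall>f\<in>module.span dual_scale B. f = (\<Sum>j<m. dual_scale (blinfun_apply f (e j)) (b j)))"
  using assms
proof (induction B)
  case empty
  interpret D: vector_space "dual_scale :: 'k \<Rightarrow> ('x \<Rightarrow>\<^sub>L 'k) \<Rightarrow> _" by (rule vector_space_dual_scale)
  show ?case by (intro exI[of _ "0::nat"]) simp
next
  case (insert g B)
  interpret D: vector_space "dual_scale :: 'k \<Rightarrow> ('x \<Rightarrow>\<^sub>L 'k) \<Rightarrow> _" by (rule vector_space_dual_scale)
  obtain m :: nat and b e where b: "\<And>j. j < m \<Longrightarrow> b j \<in> V"
    and rep: "\<And>f. f \<in> D.span B \<Longrightarrow> f = (\<Sum>j<m. dual_scale (blinfun_apply f (e j)) (b j))"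
    using insert by blast
  have gV: "g \<in> V" using insert by simp
  define Pr where "Pr f = (\<Sum>j<m. dual_scale (blinfun_apply f (e j)) (b j))" for f :: "'x \<Rightarrow>\<^sub>L 'k"
  have Pr_lin: "Pr (f + dual_scale c h) = Pr f + dual_scale c (Pr h)" for f h c
    by (simp add: Pr_def blinfun.add_left D.scale_left_distrib sum.distrib D.scale_sum_right)
  define r where "r = g - Pr g"
  have rV: "r \<in> V" unfolding r_def Pr_def using gV b by (intro dual_diff dual_sum dual_dual_scale) auto
  have split: "\<exists>c. f = Pr f + dual_scale c r" if fsp: "f \<in> D.span (insert g B)" for f
  proof -
    obtain c where c: "f - dual_scale c g \<in> D.span B" using fsp D.span_breakdown_eq by blast
    let ?h = "f - dual_scale c g"
    have "Pr f = ?h + dual_scale c (Pr g)" using Pr_lin[of ?h c g] rep[OF c] by (simp add: Pr_def)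
    then have "f = Pr f + dual_scale c r" by (simp add: r_def D.scale_right_diff_distrib)
    then show ?thesis ..
  qed
  show ?case
  proof (cases "r = 0")
    case True
    then have "f = Pr f" if "f \<in> D.span (insert g B)" for f using split[OF that] by simp
    then show ?thesis using b unfolding Pr_def by blast
  next
    case False
    then obtain x where x: "blinfun_apply r x \<noteq> 0" by (metis blinfun_eqI zero_blinfun.rep_eq)
    \<comment> \<open>The correction by the old points makes evaluation at \<open>y\<close> blind to
      \<open>Pr f\<close>: it returns \<open>f x - Pr f x\<close>, which is \<open>c * r x\<close>.
      Dividing by \<open>r x\<close> reads off the new coefficient.\<close>
    define y where "y = x - (\<Sum>j<m. scale (b j x) (e j))"
    define z where "z = scale (1 / r x) y"
    have "f = (\<Sum>j<Suc m. dual_scale (blinfun_apply f ((e(m := z)) j)) ((b(m := r)) j))"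
      if f: "f \<in> D.span (insert g B)" for f
    proof -
      have fV: "f \<in> V"
      proof -
        have "D.span (insert g B) \<subseteq> V"
          by (rule D.span_minimal) (use insert in \<open>auto simp: D.subspace_def zero_dual dual_add dual_dual_scale\<close>)
        then show ?thesis using f by blast
      qed
      obtain c where c: "f = Pr f + dual_scale c r" using split[OF f] by blast
      have "f x = Pr f x + c * r x" using arg_cong[OF c, of "\<lambda>h. blinfun_apply h x"] by (simp add: blinfun.add_left)
      moreover have "f y = f x - Pr f x"
        by (simp add: y_def blinfun.diff_right blinfun.sum_right dual_apply_scale[OF fV] Pr_def blinfun.sum_left mult.commute)
      ultimately have "f z = c" using x by (simp add: z_def dual_apply_scale[OF fV])
      then show ?thesis using c by (simp add: Pr_def)
    qed
    then show ?thesis using b rV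
      by (intro exI[of _ "Suc m"] exI[of _ "b(m := r)"] exI[of _ "e(m := z)"]) (auto simp: less_Suc_eq)
  qed
qed

text \<open>Countability turns norms of functionals into countable suprema, hence measurable ones,
  and leaves only countably many tuples of points to be coded. The approximating operators take
  their values in the span of such a set.\<close>

definition norming :: "'x set \<Rightarrow> bool" where
  "norming Q \<longleftrightarrow> countable Q \<and> (\<forall>x\<in>Q. norm x \<le> 1) \<and> (\<forall>f\<in>V. \<forall>e>0. \<exists>x\<in>Q. norm f - e < norm (blinfun_apply f x))"

lemma norming_le_iff:
  assumes "norming Q" "f \<in> V"
  shows "norm f \<le> r \<longleftrightarrow> (\<forall>x\<in>Q. norm (blinfun_apply f x) \<le> r)"
proof
  assume "norm f \<le> r"
  show "\<forall>x\<in>Q. norm (f x) \<le> r"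
  proof
    fix x assume "x \<in> Q"
    then have "norm f * norm x \<le> norm f * 1" using assms by (intro mult_left_mono) (auto simp: norming_def)
    then show "norm (f x) \<le> r" using norm_blinfun[of f x] \<open>norm f \<le> r\<close> by linarith
  qed
next
  assume le: "\<forall>x\<in>Q. norm (f x) \<le> r"
  show "norm f \<le> r"
  proof (rule field_le_epsilon)
    fix e :: real assume "0 < e"
    then obtain x where "x \<in> Q" "norm f - e < norm (f x)" using assms unfolding norming_def by blast
    then show "norm f \<le> r + e" using le by force
  qed
qed

lemma dense_sequence_exists:
  assumes "separable_space (top_of_set V)"
  shows "\<exists>q::nat \<Rightarrow> _. range q \<subseteq> V \<and> (\<forall>f\<in>V. \<forall>e>0. \<exists>i. norm (f - q i) < e)"
proof -
  obtain C where C: "countable C" "C \<subseteq> V" "(top_of_set V) closure_of C = V"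
    using assms by (auto simp: separable_space_def)
  have cl: "V \<subseteq> closure C"
    using C(2,3) closure_of_subtopology[of euclidean V C] by (auto simp: Int_absorb1)
  then have "C \<noteq> {}" using zero_dual by auto
  show ?thesis
  proof (intro exI[of _ "from_nat_into C"] conjI ballI allI impI)
    show "range (from_nat_into C) \<subseteq> V" using C \<open>C \<noteq> {}\<close> by (auto intro: from_nat_into)
    fix f and e :: real assume "f \<in> V" "0 < e"
    then obtain c where "c \<in> C" "dist c f < e" using cl closure_approachable by blast
    then show "\<exists>i. norm (f - from_nat_into C i) < e"
      using from_nat_into_surj[OF C(1)] by (metis dist_commute dist_norm)
  qed
qed

lemma norming_exists:
  assumes "separable_space (top_of_set V)"
  shows "\<exists>Q. norming Q"
proof -
  obtain q :: "nat \<Rightarrow> _" where q: "range q \<subseteq> V" "\<And>f e. f \<in> V \<Longrightarrow> 0 < e \<Longrightarrow> \<exists>i. norm (f - q i) < e"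
    using dense_sequence_exists[OF assms] by blast
  have "\<exists>x. norm x \<le> 1 \<and> norm (q i) - 1 / real (Suc n) < norm (q i x)" for i n
    by (rule blinfun_almost_norm) simp
  then obtain x where x: "\<And>i n. norm (x i n) \<le> 1" "\<And>i n. norm (q i) - 1 / real (Suc n) < norm (q i (x i n))"
    by metis
  have "norming (range (\<lambda>(i, n). x i n))"
    unfolding norming_def
  proof (intro conjI ballI allI impI)
    show "countable (range (\<lambda>(i, n). x i n))" by simp
    show "norm y \<le> 1" if "y \<in> range (\<lambda>(i, n). x i n)" for y using that x by auto
    fix f and e :: real assume f: "f \<in> V" and e: "0 < e"
    then obtain i where i: "norm (f - q i) < e / 3" using q(2)[of f "e / 3"] by auto
    obtain n where n: "1 / real (Suc n) < e / 3" using e nat_approx_posE[of "e / 3"] by auto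
    have "norm ((f - q i) (x i n)) \<le> norm (f - q i) * 1"
      using norm_blinfun[of "f - q i" "x i n"] x(1)[of i n] mult_left_mono[OF x(1)[of i n] norm_ge_zero[of "f - q i"]]
      by linarith
    then have "norm (q i (x i n)) - e / 3 < norm (f (x i n))"
      using i norm_triangle_ineq3[of "f (x i n)" "q i (x i n)"] by (simp add: blinfun.diff_left)
    moreover have "norm f - e / 3 < norm (q i)" using i norm_triangle_ineq3[of f "q i"] by simp
    ultimately have "norm f - e < norm (f (x i n))" using x(2)[of i n] n by linarith
    then show "\<exists>x\<in>range (\<lambda>(i, n). x i n). norm f - e < norm (f x)" by (intro bexI[of _ "x i n"]) auto
  qed
  then show ?thesis ..
qed

lemma convex_V: "convex V"
  by (rule convexI) (simp add: dual_add dual_scaleR)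

text \<open>Goldstine's theorem with approximants from the span of \<open>Q\<close>. If no
  \<open>y\<close> works, minimax gives a single convex combination \<phi> of test functionals such
  that \<open>re (\<xi> \<phi>)\<close> is at least \<open>re (\<phi> y) + \<delta> / 2\<close> for
  every admissible \<open>y\<close>; but the supremum of the \<open>re (\<phi> y)\<close> is
  \<open>C * norm \<phi>\<close>, because \<open>Q\<close> is norming.\<close>

lemma goldstine:
  assumes "norming Q" "finite F" "F \<subseteq> V" "0 < \<delta>" "0 < C"
    and add: "\<And>f g. f \<in> V \<Longrightarrow> g \<in> V \<Longrightarrow> \<xi> (f + g) = \<xi> f + \<xi> g"
    and hom: "\<And>c f. f \<in> V \<Longrightarrow> \<xi> (dual_scale c f) = c * (\<xi> f :: 'k)"
    and bnd: "\<And>f. f \<in> V \<Longrightarrow> norm (\<xi> f) \<le> C * norm f"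
  shows "\<exists>y\<in>span Q. norm y \<le> C \<and> (\<forall>f\<in>F. norm (\<xi> f - blinfun_apply f y) \<le> \<delta>)"
proof -
  have cmp: "compact ({c::'k. norm c \<le> 1} \<inter> {c. norm c = 1})"
    by (intro compact_Int_closed compact_scalar_ball closed_Collect_eq continuous_intros)
  have cov: "{c::'k. norm c \<le> 1} \<inter> {c. norm c = 1} \<subseteq> (\<Union>c\<in>{c. norm c = 1}. ball c (1/2))" by auto
  \<comment> \<open>A finite 1/2-net of the unimodular scalars. Testing the multiples of
    \<open>f\<close> by its elements bounds the modulus through real parts at the price of a factor
    2, whence the \<delta> / 2 in \<open>h\<close>.\<close>
  obtain T where T: "T \<subseteq> {c::'k. norm c = 1}" "finite T"
    "{c::'k. norm c \<le> 1} \<inter> {c. norm c = 1} \<subseteq> (\<Union>c\<in>T. ball c (1/2))"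
    using compactE_image[OF cmp open_ball cov] by blast
  define E where "E = (\<lambda>(c, f). dual_scale c f) ` (T \<times> F)"
  define A where "A = convex hull E"
  define P where "P = {y\<in>span Q. norm y \<le> C}"
  define h where "h \<phi> y = re (\<xi> \<phi>) - re (blinfun_apply \<phi> y) - \<delta> / 2" for \<phi> y
  have EV: "E \<subseteq> V" using assms(3) by (auto simp: E_def intro!: dual_dual_scale)
  have AV: "A \<subseteq> V" unfolding A_def by (intro hull_minimal EV convex_V)
  have "compact A" unfolding A_def E_def using T(2) assms(2) by (intro finite_imp_compact_convex_hull) auto
  have real_hom: "\<xi> (r *\<^sub>R f) = of_real r * \<xi> f" if "f \<in> V" for r f
  proof -
    have "r *\<^sub>R f = dual_scale (of_real r) f" by (intro blinfun_eqI) (simp add: blinfun.scaleR_left scaleR_conv_of_real)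
    then show ?thesis using hom[OF that] by simp
  qed
  have diff: "\<xi> (f - g) = \<xi> f - \<xi> g" if "f \<in> V" "g \<in> V" for f g
    using add[of f "(- 1) *\<^sub>R g"] real_hom[of g "- 1"] dual_scaleR[of g "- 1"] that by simp
  have cont\<xi>: "continuous_on V \<xi>"
    unfolding continuous_on_iff
  proof (intro ballI allI impI)
    fix f and e :: real assume f: "f \<in> V" and e: "0 < e"
    show "\<exists>d>0. \<forall>g\<in>V. dist g f < d \<longrightarrow> dist (\<xi> g) (\<xi> f) < e"
    proof (intro exI[of _ "e / C"] conjI ballI impI)
      fix g assume g: "g \<in> V" "dist g f < e / C"
      have "dist (\<xi> g) (\<xi> f) \<le> C * dist g f"
        using bnd[OF dual_diff[OF g(1) f]] diff[OF g(1) f] by (simp add: dist_norm)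
      also have "\<dots> < e" using g(2) \<open>0 < C\<close> by (simp add: field_simps)
      finally show "dist (\<xi> g) (\<xi> f) < e" .
    qed (use e \<open>0 < C\<close> in simp)
  qed
  have "\<exists>y\<in>P. \<forall>\<phi>\<in>A. h \<phi> y < 0"
  proof (cases "A = {}")
    case True
    then show ?thesis using span_zero \<open>0 < C\<close> by (intro bexI[of _ 0]) (auto simp: P_def)
  next
    case False
    show ?thesis
    proof (rule ccontr)
      assume "\<not> ?thesis"
      then have ex: "\<And>y. y \<in> P \<Longrightarrow> \<exists>\<phi>\<in>A. 0 \<le> h \<phi> y" by (meson not_less)
      have "\<exists>\<phi>\<in>A. \<forall>y\<in>P. 0 \<le> h \<phi> y"
      proof (rule minimax[OF \<open>compact A\<close> False])
        show "continuous_on A (\<lambda>\<phi>. h \<phi> y)" for y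
          unfolding h_def
          by (intro continuous_on_diff continuous_on_re continuous_on_subset[OF cont\<xi> AV] continuous_intros)
      next
        fix \<phi> \<phi>' and s :: real assume a: "\<phi> \<in> A" "\<phi>' \<in> A" "0 \<le> s" "s \<le> 1"
        have "s *\<^sub>R \<phi> + (1 - s) *\<^sub>R \<phi>' \<in> A"
          unfolding A_def by (rule convexD[OF convex_convex_hull]) (use a in \<open>auto simp: A_def\<close>)
        moreover have "\<xi> (s *\<^sub>R \<phi> + (1 - s) *\<^sub>R \<phi>') = of_real s * \<xi> \<phi> + of_real (1 - s) * \<xi> \<phi>'"
          using subsetD[OF AV a(1)] subsetD[OF AV a(2)] by (simp add: add dual_scaleR real_hom del: of_real_diff)
        then have "h (s *\<^sub>R \<phi> + (1 - s) *\<^sub>R \<phi>') y = s * h \<phi> y + (1 - s) * h \<phi>' y" for y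
          unfolding h_def blinfun.add_left blinfun.scaleR_left
          by (simp only: re_add re_of_real_mult re_scaleR) (simp add: algebra_simps diff_divide_distrib)
        ultimately show "\<exists>\<psi>\<in>A. \<forall>y\<in>P. h \<psi> y = s * h \<phi> y + (1 - s) * h \<phi>' y" by blast
      next
        fix y z and s :: real assume a: "y \<in> P" "z \<in> P" "0 \<le> s" "s \<le> 1"
        let ?w = "s *\<^sub>R y + (1 - s) *\<^sub>R z"
        have "norm ?w \<le> s * norm y + (1 - s) * norm z"
          by (rule order_trans[OF norm_triangle_ineq]) (use a in simp)
        also have "\<dots> \<le> s * C + (1 - s) * C"
          using a by (intro add_mono mult_left_mono) (auto simp: P_def)
        finally have "norm ?w \<le> C" by (simp add: algebra_simps)
        moreover have "?w \<in> span Q"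
          using a unfolding P_def scale_of_real[symmetric] by (auto intro!: span_add span_scale)
        ultimately have "?w \<in> P" by (simp add: P_def)
        moreover have "h \<phi> ?w = s * h \<phi> y + (1 - s) * h \<phi> z" for \<phi>
          unfolding h_def blinfun.add_right blinfun.scaleR_right
          by (simp only: re_add re_scaleR) (simp add: algebra_simps diff_divide_distrib)
        ultimately show "\<exists>r\<in>P. \<forall>\<phi>\<in>A. h \<phi> r = s * h \<phi> y + (1 - s) * h \<phi> z" by blast
      qed (rule ex)
      then obtain \<phi> where \<phi>: "\<phi> \<in> A" "\<And>y. y \<in> P \<Longrightarrow> 0 \<le> h \<phi> y" by blast
      then have \<phi>V: "\<phi> \<in> V" using AV by blast
      \<comment> \<open>After multiplication by \<open>C\<close> the loss is \<delta> / 2; the phase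
        \<open>a\<close> makes the value of \<phi> at \<open>y\<close> real and nonnegative.\<close>
      obtain x where x: "x \<in> Q" "norm \<phi> - \<delta> / (2 * C) < norm (\<phi> x)"
        using assms(1,4,5) \<phi>V by (force simp: norming_def dest!: bspec[of _ _ \<phi>] spec[of _ "\<delta> / (2 * C)"])
      obtain a where a: "norm a = 1" "a * \<phi> x = of_real (norm (\<phi> x))" using phase_exists by blast
      define y where "y = scale (of_real C * a) x"
      have "norm y \<le> C"
        using assms(1,5) x(1) mult_left_mono[of "norm x" 1 C] by (auto simp: y_def norm_scale norm_mult a norming_def)
      then have "y \<in> P" using x(1) by (simp add: P_def y_def span_scale span_base)
      have "\<phi> y = of_real (C * norm (\<phi> x))"
        by (simp add: y_def dual_apply_scale[OF \<phi>V] mult.assoc a)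
      then have "re (\<phi> y) = C * norm (\<phi> x)" by (simp only: re_of_real)
      moreover have "C * (norm \<phi> - \<delta> / (2 * C)) < C * norm (\<phi> x)" using x(2) \<open>0 < C\<close> by simp
      moreover have "C * (norm \<phi> - \<delta> / (2 * C)) = C * norm \<phi> - \<delta> / 2" using \<open>0 < C\<close> by (simp add: field_simps)
      ultimately show False
        using \<phi>(2)[OF \<open>y \<in> P\<close>] bnd[OF \<phi>V] re_le[of "\<xi> \<phi>"] by (simp add: h_def)
    qed
  qed
  then obtain y where y: "y \<in> P" "\<And>\<phi>. \<phi> \<in> A \<Longrightarrow> h \<phi> y < 0" by blast
  have "norm (\<xi> f - blinfun_apply f y) \<le> \<delta>" if f: "f \<in> F" for f
  proof -
    have fV: "f \<in> V" using f assms(3) by blast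
    let ?z = "\<xi> f - blinfun_apply f y"
    obtain a where a: "norm a = 1" "a * ?z = of_real (norm ?z)" using phase_exists by blast
    then obtain c where c: "c \<in> T" "dist c a < 1/2" using T(3) by (auto dest!: subsetD[of _ _ a])
    have "dual_scale c f \<in> A" unfolding A_def E_def using c f by (intro hull_inc) force
    from y(2)[OF this] have le: "re (c * ?z) < \<delta> / 2"
      by (simp add: h_def hom[OF fV] right_diff_distrib re_diff)
    have "norm ?z = re (a * ?z)" using a by simp
    also have "\<dots> = re (c * ?z) + re ((a - c) * ?z)" by (simp add: left_diff_distrib re_diff)
    also have "re ((a - c) * ?z) \<le> norm (a - c) * norm ?z" using re_le[of "(a - c) * ?z"] by (simp add: norm_mult)
    also have "\<dots> \<le> 1/2 * norm ?z" using c(2) by (intro mult_right_mono) (auto simp: dist_norm norm_minus_commute)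
    finally show ?thesis using le by simp
  qed
  then show ?thesis using y(1) by (auto simp: P_def)
qed

definition finite_rank :: "'x set \<Rightarrow> ('x \<Rightarrow>\<^sub>L 'x) \<Rightarrow> bool" where
  "finite_rank S T \<longleftrightarrow> (\<exists>(m::nat) b y. (\<forall>j<m. b j \<in> V \<and> y j \<in> S) \<and>
     (\<forall>x. blinfun_apply T x = (\<Sum>j<m. scale (blinfun_apply (b j) x) (y j))))"

lemma bounded_linear_scale_right: "bounded_linear (\<lambda>a. scale a y)"
  by (rule bounded_linear_intro[where K = "norm y"])
     (auto simp: scale_left_distrib norm_scale mult.commute scaleR_conv_of_real scale_of_real[symmetric])

lemma finite_rank_exists:
  fixes b :: "nat \<Rightarrow> 'x \<Rightarrow>\<^sub>L 'k"
  shows "\<exists>T. \<forall>x. blinfun_apply T x = (\<Sum>j<m. scale (blinfun_apply (b j) x) (y j))"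
proof -
  have "bounded_linear (\<lambda>x. \<Sum>j<m. scale (blinfun_apply (b j) x) (y j))"
    by (intro bounded_linear_sum bounded_linear_compose[OF bounded_linear_scale_right] blinfun.bounded_linear_right)
  from bounded_linear_Blinfun_apply[OF this] show ?thesis by (intro exI allI) (rule fun_cong)
qed

lemma dual_compose_finite_rank:
  assumes "f \<in> V" "\<And>x. blinfun_apply T x = (\<Sum>j<m. scale (blinfun_apply (b j) x) (y j))"
  shows "f o\<^sub>L T = (\<Sum>j<m. dual_scale (blinfun_apply f (y j)) (b j))"
  by (rule blinfun_eqI) (simp add: assms(2) blinfun.sum_right blinfun.sum_left dual_apply_scale[OF assms(1)] mult.commute)

text \<open>The approximation property provides finite-rank operators on the dual, while adjoints of
  operators on the space are wanted. The coefficient functionals \<open>\<xi> j\<close> of the given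
  operator belong to the bidual of the space; \<open>goldstine\<close> replaces them by points
  \<open>y j\<close> that are close on a finite net of \<open>L\<close>, and these points define the
  operator.\<close>

lemma finite_rank_approximation:
  assumes "norming Q" and AP: "approximation_property dual_scale V"
    and L: "compact L" "L \<subseteq> V" and "0 < \<epsilon>"
  shows "\<exists>T. finite_rank (span Q) T \<and> (\<forall>f\<in>L. norm ((f o\<^sub>L T) - f) \<le> \<epsilon>)"
proof -
  have "compact L \<and> L \<subseteq> V \<and> 0 < \<epsilon> / 2" using L \<open>0 < \<epsilon>\<close> by simp
  from AP[unfolded approximation_property_def, THEN spec, THEN spec, THEN mp, OF this]
  obtain T0 C0 B where add': "\<forall>u\<in>V. \<forall>v\<in>V. T0 (u + v) = T0 u + T0 v"
    and hom': "\<forall>c. \<forall>v\<in>V. T0 (dual_scale c v) = dual_scale c (T0 v)"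
    and bnd': "\<forall>v\<in>V. norm (T0 v) \<le> C0 * norm v"
    and B: "finite B" "B \<subseteq> V" "T0 ` V \<subseteq> module.span dual_scale B"
    and T0': "\<forall>v\<in>L. norm (T0 v - v) \<le> \<epsilon> / 2"
    by (elim exE conjE) (rule that; assumption)
  note add = add'[rule_format] and hom = hom'[rule_format] and T0 = T0'[rule_format] and bnd = bnd'[rule_format]
  obtain m :: nat and b e where b: "\<And>j. j < m \<Longrightarrow> b j \<in> V"
    and rep: "\<And>f. f \<in> module.span dual_scale B \<Longrightarrow> f = (\<Sum>j<m. dual_scale (blinfun_apply f (e j)) (b j))"
    using dual_basis[OF B(1,2)] by blast
  define \<xi> where "\<xi> j v = blinfun_apply (T0 v) (e j)" for j v
  have T0_rep: "T0 v = (\<Sum>j<m. dual_scale (\<xi> j v) (b j))" if "v \<in> V" for v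
    unfolding \<xi>_def using rep B(3) that by blast
  define C where "C = (\<Sum>j<m. \<bar>C0\<bar> * norm (e j)) + 1"
  have C: "0 < C" unfolding C_def by (intro add_nonneg_pos sum_nonneg) auto
  have \<xi>_bnd: "norm (\<xi> j v) \<le> C * norm v" if "j < m" "v \<in> V" for j v
  proof -
    have "norm (\<xi> j v) \<le> norm (T0 v) * norm (e j)" unfolding \<xi>_def by (rule norm_blinfun)
    also have "\<dots> \<le> (\<bar>C0\<bar> * norm v) * norm (e j)"
      by (intro mult_right_mono order_trans[OF bnd[OF that(2)]]) auto
    also have "\<dots> = (\<bar>C0\<bar> * norm (e j)) * norm v" by simp
    also have "\<dots> \<le> C * norm v"
      unfolding C_def using that member_le_sum[of j "{..<m}" "\<lambda>j. \<bar>C0\<bar> * norm (e j)"]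
      by (intro mult_right_mono) auto
    finally show ?thesis .
  qed
  have \<xi>_diff: "\<xi> j (u - v) = \<xi> j u - \<xi> j v" if "u \<in> V" "v \<in> V" for j u v
    using add[OF dual_diff[OF that] that(2)] by (simp add: \<xi>_def blinfun.add_left)
  define K where "K = (\<Sum>j<m. norm (b j)) + 1"
  have K: "0 < K" unfolding K_def by (intro add_nonneg_pos sum_nonneg) auto
  \<comment> \<open>Two net errors \<open>C * \<delta>1\<close> and the Goldstine error
    \<open>\<delta>\<close> make \<open>\<epsilon> / (2 * K)\<close> per coefficient, and the norms
    of the \<open>b j\<close> sum to \<open>K - 1\<close>. This uses up half of \<epsilon>; the
    other half is the error of \<open>T0\<close>.\<close>
  define \<delta>1 where "\<delta>1 = \<epsilon> / (8 * K * C)"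
  define \<delta> where "\<delta> = \<epsilon> / (4 * K)"
  have \<delta>: "0 < \<delta>" "0 < \<delta>1" using \<open>0 < \<epsilon>\<close> K C by (auto simp: \<delta>_def \<delta>1_def)
  have cov: "L \<subseteq> (\<Union>f\<in>L. ball f \<delta>1)" using \<delta> by auto
  obtain F where F: "F \<subseteq> L" "finite F" "L \<subseteq> (\<Union>f\<in>F. ball f \<delta>1)"
    using compactE_image[OF L(1) open_ball cov] by blast
  have "\<exists>y\<in>span Q. norm y \<le> C \<and> (\<forall>f\<in>F. norm (\<xi> j f - f y) \<le> \<delta>)" if "j < m" for j
    by (rule goldstine[OF assms(1) F(2) _ \<delta>(1) C])
       (use F L \<xi>_bnd that in \<open>auto simp: \<xi>_def add hom blinfun.add_left\<close>)
  then obtain y where y: "\<And>j. j < m \<Longrightarrow> y j \<in> span Q" "\<And>j. j < m \<Longrightarrow> norm (y j) \<le> C"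
    "\<And>j f. j < m \<Longrightarrow> f \<in> F \<Longrightarrow> norm (\<xi> j f - f (y j)) \<le> \<delta>" by metis
  have close: "norm (\<xi> j v - v (y j)) \<le> \<epsilon> / (2 * K)" if j: "j < m" and v: "v \<in> L" for j v
  proof -
    obtain f where f: "f \<in> F" "dist f v < \<delta>1" using F(3) v by auto
    then have fv: "norm (v - f) < \<delta>1" and fV: "f \<in> V" and vV: "v \<in> V"
      using F L v by (auto simp: dist_norm norm_minus_commute)
    have 1: "norm (\<xi> j v - \<xi> j f) \<le> C * \<delta>1"
    proof -
      have "C * norm (v - f) \<le> C * \<delta>1" using fv C by simp
      then show ?thesis using \<xi>_bnd[OF j dual_diff[OF vV fV]] by (simp add: \<xi>_diff[OF vV fV])
    qed
    have 2: "norm (f (y j) - v (y j)) \<le> \<delta>1 * C"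
    proof -
      have "norm (f (y j) - v (y j)) \<le> norm (f - v) * norm (y j)"
        using norm_blinfun[of "f - v" "y j"] by (simp add: blinfun.diff_left)
      also have "\<dots> \<le> \<delta>1 * C" using fv y(2)[OF j] \<delta>(2) by (intro mult_mono) (auto simp: norm_minus_commute)
      finally show ?thesis .
    qed
    have "norm (\<xi> j v - v (y j)) \<le> norm (\<xi> j v - \<xi> j f) + norm (\<xi> j f - f (y j)) + norm (f (y j) - v (y j))"
    proof -
      have "norm ((\<xi> j v - \<xi> j f) + (\<xi> j f - f (y j)) + (f (y j) - v (y j))) \<le>
          norm (\<xi> j v - \<xi> j f) + norm (\<xi> j f - f (y j)) + norm (f (y j) - v (y j))"
        by (intro norm_triangle_mono order_refl)
      then show ?thesis by simp
    qed
    also have "\<dots> \<le> C * \<delta>1 + \<delta> + \<delta>1 * C" using 1 2 y(3)[OF j f(1)] by linarith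
    also have "\<dots> = \<epsilon> / (2 * K)" using C K by (simp add: \<delta>_def \<delta>1_def field_simps)
    finally show ?thesis .
  qed
  obtain T where T: "\<And>x. blinfun_apply T x = (\<Sum>j<m. scale (blinfun_apply (b j) x) (y j))"
    using finite_rank_exists by blast
  have "norm ((v o\<^sub>L T) - v) \<le> \<epsilon>" if v: "v \<in> L" for v
  proof -
    have vV: "v \<in> V" using v L by blast
    interpret D: vector_space "dual_scale :: 'k \<Rightarrow> ('x \<Rightarrow>\<^sub>L 'k) \<Rightarrow> _" by (rule vector_space_dual_scale)
    have "(v o\<^sub>L T) - T0 v = (\<Sum>j<m. dual_scale (v (y j) - \<xi> j v) (b j))"
      unfolding dual_compose_finite_rank[OF vV T] T0_rep[OF vV]
      by (simp add: D.scale_left_diff_distrib sum_subtractf)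
    also have "norm \<dots> \<le> (\<Sum>j<m. \<epsilon> / (2 * K) * norm (b j))"
    proof (rule sum_norm_le)
      fix j assume "j \<in> {..<m}"
      then have "norm (v (y j) - \<xi> j v) \<le> \<epsilon> / (2 * K)" using close[OF _ v] by (simp add: norm_minus_commute)
      then show "norm (dual_scale (v (y j) - \<xi> j v) (b j)) \<le> \<epsilon> / (2 * K) * norm (b j)"
        unfolding norm_dual_scale by (rule mult_right_mono) simp
    qed
    also have "\<dots> = \<epsilon> / (2 * K) * (K - 1)" by (simp add: K_def sum_distrib_left)
    also have "\<dots> \<le> \<epsilon> / (2 * K) * K" using K \<open>0 < \<epsilon>\<close> by (intro mult_left_mono) auto
    also have "\<dots> = \<epsilon> / 2" using K by simp
    finally have "norm ((v o\<^sub>L T) - T0 v) \<le> \<epsilon> / 2" .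
    then show ?thesis
      using T0[OF v] norm_diff_triangle_le[of "v o\<^sub>L T" "T0 v" "\<epsilon> / 2" v "\<epsilon> / 2"] by simp
  qed
  moreover have "finite_rank (span Q) T" unfolding finite_rank_def using b y(1) T by blast
  ultimately show ?thesis by blast
qed

end

subsection \<open>Integrals of dual-valued functions\<close>

lemma compact_insert_range:
  fixes f :: "nat \<Rightarrow> 'a::topological_space"
  assumes "f \<longlonglongrightarrow> l"
  shows "compact (insert l (range f))"
  unfolding compact_eq_Heine_Borel
proof (intro allI impI)
  fix C assume C': "(\<forall>t\<in>C. open t) \<and> insert l (range f) \<subseteq> \<Union>C"
  then have C: "\<forall>t\<in>C. open t" "insert l (range f) \<subseteq> \<Union>C" by blast+
  then obtain U where U: "U \<in> C" "l \<in> U" by blast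
  then obtain n0 where n0: "\<And>n. n \<ge> n0 \<Longrightarrow> f n \<in> U"
    using topological_tendstoD[OF assms, of U] C(1) by (auto simp: eventually_sequentially)
  have "\<forall>n. \<exists>T. T \<in> C \<and> f n \<in> T" using C(2) by blast
  then obtain g where g: "\<And>n. g n \<in> C" "\<And>n. f n \<in> g n" by metis
  have "f n \<in> \<Union>(insert U (g ` {..<n0}))" for n
    using n0[of n] g(2)[of n] by (cases "n < n0") auto
  then have "insert l (range f) \<subseteq> \<Union>(insert U (g ` {..<n0}))" using U by blast
  then show "\<exists>C'\<subseteq>C. finite C' \<and> insert l (range f) \<subseteq> \<Union>C'"
    using U g(1) by (intro exI[of _ "insert U (g ` {..<n0})"]) auto
qed

context normed_space_over
begin

text \<open>The function is the sum of differences of countably valued approximations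
  \<open>G l\<close> with geometrically decreasing error. Every value of a difference, multiplied by
  the measure of the set where it is taken, becomes a \<open>v n\<close>. This is the expansion of
  an integrable function as an element of a projective tensor product, and one summable sequence
  controls the integral for all operators \<open>S\<close> at once.\<close>

lemma countable_decomposition:
  assumes fin: "finite_measure M" and q: "range q \<subseteq> V" "\<And>f e. f \<in> V \<Longrightarrow> 0 < e \<Longrightarrow> \<exists>i::nat. norm (f - q i) < e"
    and F: "\<And>y. y \<in> space M \<Longrightarrow> F y \<in> V" "\<And>y. y \<in> space M \<Longrightarrow> norm (F y) \<le> B"
    and meas: "\<And>v r. v \<in> V \<Longrightarrow> {y\<in>space M. norm (F y - v) \<le> r} \<in> sets M"
  shows "\<exists>v::nat \<Rightarrow> _. range v \<subseteq> V \<and> summable (\<lambda>n. norm (v n)) \<and>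
    (\<forall>S :: ('x \<Rightarrow>\<^sub>L 'k) \<Rightarrow>\<^sub>L ('x \<Rightarrow>\<^sub>L 'k). (\<integral>\<^sup>+y. ennreal (norm (S (F y))) \<partial>M) \<le> (\<Sum>n. ennreal (norm (S (v n)))))"
proof -
  interpret M: finite_measure M by (rule fin)
  define Nl where "Nl l y = (LEAST i. norm (F y - q i) \<le> (1/2)^l)" for l :: nat and y
  have Nl_meas: "Nl l \<in> measurable M (count_space UNIV)" for l
  proof -
    have "Measurable.pred M (\<lambda>y. norm (F y - q i) \<le> (1/2)^l)" for i
      unfolding pred_def using q(1) by (intro meas) auto
    then show ?thesis unfolding Nl_def by (rule measurable_Least)
  qed
  have Nl: "norm (F y - q (Nl l y)) \<le> (1/2)^l" if y: "y \<in> space M" for l y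
  proof -
    obtain i where "norm (F y - q i) < (1/2)^l" using q(2)[OF F(1)[OF y], of "(1/2)^l"] by auto
    then show ?thesis unfolding Nl_def by (intro LeastI[of "\<lambda>i. norm (F y - q i) \<le> (1/2)^l" i]) simp
  qed
  \<comment> \<open>The value 0 is put in front of the dense sequence so that
    \<open>G 0 y = 0\<close> and the telescoping sum has no initial term.\<close>
  define q' where "q' = case_nat 0 q"
  have q'V: "q' i \<in> V" for i using q(1) zero_dual by (auto simp: q'_def split: nat.split)
  define K where "K l y = (case l of 0 \<Rightarrow> 0 | Suc m \<Rightarrow> Suc (Nl m y))" for l y
  have K_meas: "K l \<in> measurable M (count_space UNIV)" for l
    unfolding K_def using measurable_compose[OF Nl_meas, of Suc "count_space UNIV"] by (cases l) auto
  define G where "G l y = q' (K l y)" for l y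
  have G0: "G 0 y = 0" for y by (simp add: G_def K_def q'_def)
  have GS: "norm (F y - G (Suc l) y) \<le> (1/2)^l" if "y \<in> space M" for l y
    using Nl[OF that] by (simp add: G_def K_def q'_def)
  \<comment> \<open>The first difference is at most \<open>B + 1\<close>, a later one at most the
    sum of two consecutive errors, which is \<open>3 * (1/2)^l\<close>; one constant covers
    both.\<close>
  define c where "c = \<bar>B\<bar> + 3"
  have d_le: "norm (G (Suc l) y - G l y) \<le> c * (1/2)^l" if "y \<in> space M" for l y
  proof (cases l)
    case 0
    have "norm (G (Suc 0) y) \<le> norm (F y) + norm (G (Suc 0) y - F y)"
      by (rule norm_triangle_sub)
    then show ?thesis using GS[OF that, of 0] F(2)[OF that] 0 by (simp add: G0 c_def norm_minus_commute)
  next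
    case (Suc m)
    have "norm (G (Suc l) y - G l y) \<le> norm (G (Suc l) y - F y) + norm (F y - G l y)"
      using norm_triangle_ineq[of "G (Suc l) y - F y" "F y - G l y"] by simp
    also have "\<dots> \<le> (1/2)^l + (1/2)^m"
      using GS[OF that, of l] GS[OF that, of m] Suc by (simp add: norm_minus_commute)
    also have "\<dots> = 3 * (1/2)^l" using Suc by simp
    also have "\<dots> \<le> c * (1/2)^l" by (intro mult_right_mono) (auto simp: c_def)
    finally show ?thesis .
  qed
  define A where "A l p = {y\<in>space M. (K l y, K (Suc l) y) = prod_decode p}" for l p
  have A_sets: "A l p \<in> sets M" for l p
  proof -
    have "A l p = (K l -` {fst (prod_decode p)} \<inter> space M) \<inter> (K (Suc l) -` {snd (prod_decode p)} \<inter> space M)"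
      by (auto simp: A_def prod_eq_iff)
    then show ?thesis
      using measurable_sets[OF K_meas, of "{_}"] by auto
  qed
  define u where "u p = q' (snd (prod_decode p)) - q' (fst (prod_decode p))" for p
  have single: "h (G (Suc l) y - G l y) = (\<Sum>p. h (u p) * indicator (A l p) y)" if "y \<in> space M" for h :: "_ \<Rightarrow> ennreal" and l y
  proof -
    let ?i = "prod_encode (K l y, K (Suc l) y)"
    have "disjoint_family (A l)" by (auto simp: disjoint_family_on_def A_def dest: arg_cong[of _ _ prod_encode])
    moreover have "y \<in> A l ?i" using that by (simp add: A_def)
    ultimately have "(\<Sum>p. h (u p) * indicator (A l p) y) = h (u ?i)"
      by (rule suminf_cmult_indicator)
    then show ?thesis by (simp add: u_def G_def)
  qed
  have integral_h: "(\<integral>\<^sup>+y. h (G (Suc l) y - G l y) \<partial>M) = (\<Sum>p. h (u p) * emeasure M (A l p))" for h :: "_ \<Rightarrow> ennreal" and l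
  proof -
    have "(\<integral>\<^sup>+y. h (G (Suc l) y - G l y) \<partial>M) = (\<integral>\<^sup>+y. (\<Sum>p. h (u p) * indicator (A l p) y) \<partial>M)"
      by (rule nn_integral_cong) (rule single)
    also have "\<dots> = (\<Sum>p. \<integral>\<^sup>+y. h (u p) * indicator (A l p) y \<partial>M)"
      using A_sets by (intro nn_integral_suminf) auto
    finally show ?thesis using A_sets by (simp add: nn_integral_cmult_indicator)
  qed
  define v where "v n = (case prod_decode n of (l, p) \<Rightarrow> measure M (A l p) *\<^sub>R u p)" for n
  have sum_v: "(\<Sum>n. ennreal (norm (S (v n)))) = (\<Sum>l. \<integral>\<^sup>+y. ennreal (norm (S (G (Suc l) y - G l y))) \<partial>M)"
    for S :: "('x \<Rightarrow>\<^sub>L 'k) \<Rightarrow>\<^sub>L ('x \<Rightarrow>\<^sub>L 'k)"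
  proof -
    define f where "f lp = ennreal (norm (S (u (snd lp)))) * emeasure M (A (fst lp) (snd lp))" for lp :: "nat \<times> nat"
    have "ennreal (norm (S (v n))) = f (prod_decode n)" for n
      by (simp add: v_def f_def split_beta blinfun.scaleR_right M.emeasure_eq_measure ennreal_mult mult.commute)
    moreover have "(\<Sum>n. f (prod_decode n)) = (\<Sum>l. \<Sum>p. f (l, p))"
      by (rule suminf_ennreal_2dimen) simp
    ultimately show ?thesis
      unfolding integral_h[of "\<lambda>z. ennreal (norm (S z))"] by (simp add: f_def)
  qed
  have meas_h: "(\<lambda>y. h (G (Suc l) y - G l y)) \<in> borel_measurable M" for h :: "_ \<Rightarrow> ennreal" and l
  proof -
    have "(\<lambda>y. (\<lambda>i y. (\<lambda>j y. h (q' j - q' i)) (K (Suc l) y) y) (K l y) y) \<in> borel_measurable M"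
      by (rule measurable_compose_countable[OF measurable_compose_countable[OF _ K_meas] K_meas]) simp
    then show ?thesis by (simp add: G_def)
  qed
  have geo: "summable (\<lambda>l. C * (1/2)^l)" for C :: real by (intro summable_mult summable_geometric) simp
  have dominated: "(\<integral>\<^sup>+y. ennreal (norm (S (F y))) \<partial>M) \<le> (\<Sum>n. ennreal (norm (S (v n))))"
    for S :: "('x \<Rightarrow>\<^sub>L 'k) \<Rightarrow>\<^sub>L ('x \<Rightarrow>\<^sub>L 'k)"
  proof -
    have "(\<integral>\<^sup>+y. ennreal (norm (S (F y))) \<partial>M) \<le> (\<integral>\<^sup>+y. (\<Sum>l. ennreal (norm (S (G (Suc l) y - G l y)))) \<partial>M)"
    proof (rule nn_integral_mono)
      fix y assume y: "y \<in> space M"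
      have "(\<lambda>l. norm (F y - G (Suc l) y)) \<longlonglongrightarrow> 0"
        by (rule Lim_null_comparison[where g = "\<lambda>l. (1/2)^l"]) (use GS[OF y] in \<open>auto intro: LIMSEQ_realpow_zero\<close>)
      then have "(\<lambda>l. F y - G (Suc l) y) \<longlonglongrightarrow> 0" by (simp add: tendsto_norm_zero_iff)
      then have "(\<lambda>l. F y - (F y - G (Suc l) y)) \<longlonglongrightarrow> F y - 0" by (intro tendsto_intros)
      then have "(\<lambda>l. G (Suc l) y) \<longlonglongrightarrow> F y" by simp
      then have "(\<lambda>l. G l y) \<longlonglongrightarrow> F y" by (rule LIMSEQ_imp_Suc)
      then have "(\<lambda>l. S (G l y)) \<longlonglongrightarrow> S (F y)" by (intro tendsto_intros)
      from telescope_sums[OF this] have sums: "(\<lambda>l. S (G (Suc l) y - G l y)) sums S (F y)"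
        by (simp add: G0 blinfun.diff_right)
      have "norm (S (G (Suc l) y - G l y)) \<le> norm S * c * (1/2)^l" for l
        using norm_blinfun[of S "G (Suc l) y - G l y"] mult_left_mono[OF d_le[OF y, of l] norm_ge_zero[of S]]
        by (simp add: mult.assoc)
      then have summ: "summable (\<lambda>l. norm (S (G (Suc l) y - G l y)))"
        by (intro summable_comparison_test'[OF geo[of "norm S * c"]]) simp
      have "norm (S (F y)) \<le> (\<Sum>l. norm (S (G (Suc l) y - G l y)))"
      proof (rule tendsto_upperbound[OF tendsto_norm[OF sums[unfolded sums_def]]])
        have "norm (\<Sum>l<n. S (G (Suc l) y - G l y)) \<le> (\<Sum>l. norm (S (G (Suc l) y - G l y)))" for n
          by (rule order_trans[OF norm_sum sum_le_suminf[OF summ]]) auto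
        then show "\<forall>\<^sub>F n in sequentially. norm (\<Sum>l<n. S (G (Suc l) y - G l y)) \<le> (\<Sum>l. norm (S (G (Suc l) y - G l y)))"
          by simp
      qed simp
      then show "ennreal (norm (S (F y))) \<le> (\<Sum>l. ennreal (norm (S (G (Suc l) y - G l y))))"
        by (subst suminf_ennreal2[OF _ summ]) (auto intro: ennreal_leI)
    qed
    also have "\<dots> = (\<Sum>l. \<integral>\<^sup>+y. ennreal (norm (S (G (Suc l) y - G l y))) \<partial>M)"
      by (rule nn_integral_suminf) (rule meas_h)
    finally show ?thesis by (simp add: sum_v)
  qed
  have "(\<Sum>n. ennreal (norm (v n))) \<noteq> \<top>"
  proof -
    have "(\<integral>\<^sup>+y. ennreal (norm (G (Suc l) y - G l y)) \<partial>M) \<le> ennreal (c * measure M (space M) * (1/2)^l)" for l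
    proof -
      have "(\<integral>\<^sup>+y. ennreal (norm (G (Suc l) y - G l y)) \<partial>M) \<le> (\<integral>\<^sup>+y. ennreal (c * (1/2)^l) \<partial>M)"
        by (intro nn_integral_mono ennreal_leI d_le)
      also have "\<dots> = ennreal (c * measure M (space M) * (1/2)^l)"
        by (simp add: M.emeasure_eq_measure c_def ennreal_mult'[symmetric] mult_ac)
      finally show ?thesis .
    qed
    then have "(\<Sum>l. \<integral>\<^sup>+y. ennreal (norm (G (Suc l) y - G l y)) \<partial>M) \<le> (\<Sum>l. ennreal (c * measure M (space M) * (1/2)^l))"
      by (intro suminf_le) auto
    also have "\<dots> = ennreal (\<Sum>l. c * measure M (space M) * (1/2)^l)"
      by (rule suminf_ennreal2[OF _ geo]) (simp add: c_def)
    finally show ?thesis using sum_v[of id_blinfun] by (auto simp: top_unique)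
  qed
  then have "summable (\<lambda>n. norm (v n))" by (rule summable_suminf_not_top[rotated]) simp
  moreover have "range v \<subseteq> V"
    using q'V by (auto simp: v_def u_def split: prod.split intro!: dual_scaleR dual_diff)
  ultimately show ?thesis using dominated by blast
qed

text \<open>The passage from smallness in the mean to smallness on a compact set, about which the
  approximation property speaks. The summable sequence of \<open>countable_decomposition\<close> is
  written as summable weights times a null sequence \<open>w\<close>. The terms of \<open>w\<close>
  together with 0 form the compact set, and the sum of the weights is the constant.\<close>

lemma compact_domination:
  assumes fin: "finite_measure M" and sep: "separable_space (top_of_set V)"
    and F: "\<And>y. y \<in> space M \<Longrightarrow> F y \<in> V" "\<And>y. y \<in> space M \<Longrightarrow> norm (F y) \<le> B"
    and meas: "\<And>v r. v \<in> V \<Longrightarrow> {y\<in>space M. norm (F y - v) \<le> r} \<in> sets M"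
  shows "\<exists>L C. compact L \<and> L \<subseteq> V \<and> 0 < C \<and>
    (\<forall>(S :: ('x \<Rightarrow>\<^sub>L 'k) \<Rightarrow>\<^sub>L ('x \<Rightarrow>\<^sub>L 'k)) e. 0 \<le> e \<longrightarrow> (\<forall>f\<in>L. norm (S f) \<le> e) \<longrightarrow>
      (\<integral>\<^sup>+y. ennreal (norm (S (F y))) \<partial>M) \<le> ennreal (C * e))"
proof -
  obtain q :: "nat \<Rightarrow> _" where q: "range q \<subseteq> V" "\<And>f e. f \<in> V \<Longrightarrow> 0 < e \<Longrightarrow> \<exists>i. norm (f - q i) < e"
    using dense_sequence_exists[OF sep] by blast
  obtain v :: "nat \<Rightarrow> _" where v: "range v \<subseteq> V" "summable (\<lambda>n. norm (v n))"
    and dom: "\<And>S :: ('x \<Rightarrow>\<^sub>L 'k) \<Rightarrow>\<^sub>L ('x \<Rightarrow>\<^sub>L 'k).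
      (\<integral>\<^sup>+y. ennreal (norm (S (F y))) \<partial>M) \<le> (\<Sum>n. ennreal (norm (S (v n))))"
    using countable_decomposition[OF fin q F meas] by blast
  \<comment> \<open>The summand \<open>(1/2)^n\<close> keeps the weight positive where
    \<open>v n\<close> vanishes.\<close>
  define a where "a n = norm (v n) + (1/2)^n" for n
  have "summable (\<lambda>n. (1/2::real)^n)" by (rule summable_geometric) simp
  then have "summable a" unfolding a_def by (rule summable_add[OF v(2)])
  moreover have a_pos: "0 < a n" for n unfolding a_def by (intro add_nonneg_pos) auto
  ultimately obtain \<sigma> where \<sigma>: "\<And>n. 0 < \<sigma> n" "\<sigma> \<longlonglongrightarrow> 0" "summable (\<lambda>n. a n / \<sigma> n)"
    using summable_rescale by blast
  define w where "w n = (\<sigma> n / a n) *\<^sub>R v n" for n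
  define L where "L = insert 0 (range w)"
  define C where "C = (\<Sum>n. a n / \<sigma> n)"
  have "w \<longlonglongrightarrow> 0"
  proof (rule Lim_null_comparison[OF _ \<sigma>(2)])
    have "norm (w n) \<le> \<sigma> n" for n
    proof -
      have "norm (w n) = \<sigma> n * (norm (v n) / a n)" using \<sigma>(1)[of n] a_pos[of n] by (simp add: w_def)
      also have "norm (v n) / a n \<le> 1" using a_pos[of n] by (simp add: a_def)
      finally show ?thesis using \<sigma>(1)[of n] by (simp add: mult_left_le)
    qed
    then show "\<forall>\<^sub>F n in sequentially. norm (w n) \<le> \<sigma> n" by simp
  qed
  then have "compact L" unfolding L_def by (rule compact_insert_range)
  moreover have "L \<subseteq> V" using v(1) by (auto simp: L_def w_def zero_dual intro!: dual_scaleR)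
  moreover have "0 < C" unfolding C_def using \<sigma> a_pos by (intro suminf_pos) auto
  moreover have "(\<integral>\<^sup>+y. ennreal (norm (S (F y))) \<partial>M) \<le> ennreal (C * e)"
    if e: "0 \<le> e" "\<forall>f\<in>L. norm (S f) \<le> e" for S :: "('x \<Rightarrow>\<^sub>L 'k) \<Rightarrow>\<^sub>L ('x \<Rightarrow>\<^sub>L 'k)" and e
  proof -
    have le: "norm (S (v n)) \<le> a n / \<sigma> n * e" for n
    proof -
      have "v n = (a n / \<sigma> n) *\<^sub>R w n" using \<sigma>(1)[of n] a_pos[of n] by (simp add: w_def)
      then have "norm (S (v n)) = a n / \<sigma> n * norm (S (w n))"
        using \<sigma>(1)[of n] a_pos[of n] by (simp add: blinfun.scaleR_right)
      also have "\<dots> \<le> a n / \<sigma> n * e"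
        using e(2) \<sigma>(1)[of n] a_pos[of n] by (intro mult_left_mono) (auto simp: L_def)
      finally show ?thesis .
    qed
    have summ: "summable (\<lambda>n. a n / \<sigma> n * e)" by (rule summable_mult2[OF \<sigma>(3)])
    have "(\<Sum>n. ennreal (norm (S (v n)))) \<le> (\<Sum>n. ennreal (a n / \<sigma> n * e))"
      using le by (intro suminf_le ennreal_leI) auto
    also have "\<dots> = ennreal (\<Sum>n. a n / \<sigma> n * e)"
      using e(1) \<sigma>(1) a_pos by (intro suminf_ennreal2[OF _ summ]) (simp add: less_imp_le)
    also have "(\<Sum>n. a n / \<sigma> n * e) = C * e" unfolding C_def by (rule suminf_mult2[OF \<sigma>(3), symmetric])
    finally show ?thesis using dom[of S] by (rule order_trans[rotated])
  qed
  ultimately show ?thesis by blast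
qed

end

subsection \<open>Coding countably many functions by a real number\<close>

text \<open>Expansions in base 3 with digits 0 and 1 leave gaps, so close codes have equal leading digits.\<close>

lemma coding_sets:
  fixes B :: "nat \<Rightarrow> 'd set"
  shows "\<exists>t :: 'd \<Rightarrow> real. (\<forall>d. 0 \<le> t d \<and> t d \<le> 3 / 2) \<and>
    (\<forall>n. \<exists>\<delta>>0. \<forall>d d'. \<bar>t d - t d'\<bar> < \<delta> \<longrightarrow> (\<forall>j\<le>n. d \<in> B j \<longleftrightarrow> d' \<in> B j))"
proof -
  define b where "b d j = (indicator (B j) d :: real)" for d j
  define t where "t d = (\<Sum>j. b d j * (1/3)^j)" for d
  have geo: "(\<lambda>j. (1/3::real)^j) sums (3/2)" using geometric_sums[of "1/3 :: real"] by simp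
  have summ: "summable (\<lambda>j. b d j * (1/3)^j)" for d
    by (rule summable_comparison_test'[OF sums_summable[OF geo]]) (simp add: b_def indicator_def)
  have t_bounds: "0 \<le> t d \<and> t d \<le> 3 / 2" for d
  proof
    show "0 \<le> t d" unfolding t_def by (intro suminf_nonneg summ) (simp add: b_def)
    have "t d \<le> (\<Sum>j. (1/3)^j)"
      unfolding t_def by (intro suminf_le summ sums_summable[OF geo]) (simp add: b_def indicator_def)
    then show "t d \<le> 3 / 2" using geo by (simp add: sums_iff)
  qed
  have gap: "(1/3)^j / 2 \<le> t d - t d'" if ag: "\<And>i. i < j \<Longrightarrow> d \<in> B i \<longleftrightarrow> d' \<in> B i" and j: "d \<in> B j" "d' \<notin> B j" for d d' j
  proof -
    let ?c = "\<lambda>i. b d i * (1/3)^i - b d' i * (1/3)^i"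
    have summ_c: "summable ?c" by (rule summable_diff[OF summ summ])
    have "t d - t d' = (\<Sum>i. ?c i)" unfolding t_def by (rule suminf_diff[OF summ summ])
    also have "\<dots> = (\<Sum>i. ?c (i + Suc j)) + (\<Sum>i<Suc j. ?c i)" by (rule suminf_split_initial_segment[OF summ_c])
    also have "(\<Sum>i<Suc j. ?c i) = (1/3)^j"
      using ag j by (simp add: b_def indicator_def)
    finally have eq: "t d - t d' = (\<Sum>i. ?c (i + Suc j)) + (1/3)^j" .
    have geo': "(\<lambda>i. (1/3)^Suc j * (1/3::real)^i) sums ((1/3)^Suc j * (3/2))" by (rule sums_mult[OF geo])
    have "- (\<Sum>i. (1/3)^Suc j * (1/3::real)^i) \<le> (\<Sum>i. ?c (i + Suc j))"
      unfolding suminf_minus[OF sums_summable[OF geo'], symmetric]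
    proof (rule suminf_le)
      fix i
      show "- ((1/3)^Suc j * (1/3::real)^i) \<le> ?c (i + Suc j)"
        by (simp add: b_def indicator_def power_add)
    qed (rule summable_minus[OF sums_summable[OF geo']], rule summable_ignore_initial_segment[OF summ_c])
    also have "(\<Sum>i. (1/3)^Suc j * (1/3::real)^i) = (1/3)^j / 2" using geo' by (simp add: sums_iff)
    finally show ?thesis unfolding eq by simp
  qed
  have "\<forall>j\<le>n. d \<in> B j \<longleftrightarrow> d' \<in> B j" if near: "\<bar>t d - t d'\<bar> < (1/3)^n / 2" for n d d'
  proof (rule ccontr)
    assume "\<not> ?thesis"
    let ?P = "\<lambda>j. (d \<in> B j) \<noteq> (d' \<in> B j)"
    from \<open>\<not> (\<forall>j\<le>n. d \<in> B j \<longleftrightarrow> d' \<in> B j)\<close> obtain j1 where j1: "?P j1" "j1 \<le> n" by blast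
    define j where "j = (LEAST j. ?P j)"
    have j: "?P j" unfolding j_def by (rule LeastI[of ?P, OF j1(1)])
    have ag: "d \<in> B i \<longleftrightarrow> d' \<in> B i" if "i < j" for i using not_less_Least[of i ?P] that unfolding j_def by blast
    have "j \<le> n" using Least_le[of ?P, OF j1(1)] j1(2) unfolding j_def by simp
    then have "(1/3::real)^n / 2 \<le> (1/3)^j / 2" by (intro divide_right_mono power_decreasing) auto
    moreover have "(1/3)^j / 2 \<le> \<bar>t d - t d'\<bar>"
    proof (cases "d \<in> B j")
      case True
      then have "(1/3)^j / 2 \<le> t d - t d'" using j ag by (intro gap) auto
      then show ?thesis by linarith
    next
      case False
      then have "(1/3)^j / 2 \<le> t d' - t d" using j ag by (intro gap) auto
      then show ?thesis by linarith
    qed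
    ultimately show False using near by linarith
  qed
  then have "\<exists>\<delta>>0. \<forall>d d'. \<bar>t d - t d'\<bar> < \<delta> \<longrightarrow> (\<forall>j\<le>n. d \<in> B j \<longleftrightarrow> d' \<in> B j)" for n
    by (intro exI[of _ "(1/3)^n / 2"]) simp
  then show ?thesis using t_bounds by blast
qed

text \<open>A real code \<open>t\<close> replaces the weak-star topology, so that Helly selection on the line yields limit measures.\<close>

definition coded :: "'d set \<Rightarrow> ('d \<Rightarrow> real) \<Rightarrow> ('d \<Rightarrow> 'b::metric_space) \<Rightarrow> bool" where
  "coded D t r \<longleftrightarrow> (\<forall>e>0. \<exists>\<delta>>0. \<forall>d\<in>D. \<forall>d'\<in>D. \<bar>t d - t d'\<bar> < \<delta> \<longrightarrow> dist (r d) (r d') < e)"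

text \<open>For every function and every \<open>m\<close>, finitely many balls of radius
  \<open>1 / (m+1)\<close> cover the compact set containing the range. The preimages of all these
  balls are countably many sets, which \<open>coding_sets\<close> encodes; agreement in finitely
  many of them puts two values into a common small ball.\<close>

lemma coding_functions:
  fixes r :: "nat \<Rightarrow> 'd \<Rightarrow> 'b::metric_space"
  assumes "\<And>c. compact (K c)" and "\<And>c. r c ` D \<subseteq> K c"
  shows "\<exists>t. (\<forall>d. 0 \<le> t d \<and> t d \<le> 3 / 2) \<and> (\<forall>c. coded D t (r c))"
proof -
  have "\<exists>(l::nat) e. K c \<subseteq> (\<Union>i<l. ball (e i) (1 / real (Suc m)))" for c m
  proof -
    have cov: "K c \<subseteq> (\<Union>x\<in>K c. ball x (1 / real (Suc m)))" by auto
    obtain T where T: "T \<subseteq> K c" "finite T" "K c \<subseteq> (\<Union>x\<in>T. ball x (1 / real (Suc m)))"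
      using compactE_image[OF assms(1) open_ball cov] by blast
    obtain l :: nat and e where "T = e ` {i. i < l}" using finite_imp_nat_seg_image_inj_on[OF T(2)] by metis
    then show ?thesis using T(3) by (intro exI[of _ l] exI[of _ e]) (auto simp: lessThan_def)
  qed
  then obtain l e where le: "\<And>c m. K c \<subseteq> (\<Union>i<(l c m :: nat). ball (e c m i) (1 / real (Suc m)))" by metis
  define B where "B n = (case prod_decode n of (c, k) \<Rightarrow> case prod_decode k of (m, i) \<Rightarrow>
    {d. dist (e c m i) (r c d) < 1 / real (Suc m)})" for n
  obtain t :: "'d \<Rightarrow> real" where t: "\<And>d. 0 \<le> t d \<and> t d \<le> 3 / 2"
    "\<And>n. \<exists>\<delta>>0. \<forall>d d'. \<bar>t d - t d'\<bar> < \<delta> \<longrightarrow> (\<forall>j\<le>n. d \<in> B j \<longleftrightarrow> d' \<in> B j)"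
    using coding_sets[of B] by blast
  have "coded D t (r c)" for c
    unfolding coded_def
  proof (intro allI impI)
    fix \<epsilon> :: real assume "0 < \<epsilon>"
    then obtain m where m: "1 / real (Suc m) < \<epsilon> / 2" using nat_approx_posE[of "\<epsilon> / 2"] by auto
    define idx where "idx i = prod_encode (c, prod_encode (m, i))" for i
    have B_idx: "d \<in> B (idx i) \<longleftrightarrow> dist (e c m i) (r c d) < 1 / real (Suc m)" for d i
      by (simp add: B_def idx_def)
    obtain \<delta> where \<delta>: "0 < \<delta>" "\<And>d d' j. \<bar>t d - t d'\<bar> < \<delta> \<Longrightarrow> j \<le> (\<Sum>i<l c m. idx i) \<Longrightarrow> d \<in> B j \<longleftrightarrow> d' \<in> B j"
      using t(2)[of "\<Sum>i<l c m. idx i"] by blast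
    show "\<exists>\<delta>>0. \<forall>d\<in>D. \<forall>d'\<in>D. \<bar>t d - t d'\<bar> < \<delta> \<longrightarrow> dist (r c d) (r c d') < \<epsilon>"
    proof (intro exI[of _ \<delta>] conjI ballI impI \<delta>(1))
      fix d d' assume "d \<in> D" "d' \<in> D" and near: "\<bar>t d - t d'\<bar> < \<delta>"
      then have "r c d \<in> K c" using assms(2) by blast
      then obtain i where i: "i < l c m" "dist (e c m i) (r c d) < 1 / real (Suc m)" using le[of c m] by auto
      have "idx i \<le> (\<Sum>i<l c m. idx i)" using i(1) by (intro member_le_sum) auto
      then have "dist (e c m i) (r c d') < 1 / real (Suc m)" using \<delta>(2)[OF near, of "idx i"] i(2) B_idx by blast
      then show "dist (r c d) (r c d') < \<epsilon>"
        using i(2) m dist_triangle3[of "r c d" "r c d'" "e c m i"] by linarith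
    qed
  qed
  then show ?thesis using t(1) by blast
qed

lemma coded_add:
  fixes r r' :: "'d \<Rightarrow> 'b::real_normed_vector"
  assumes "coded D t r" "coded D t r'"
  shows "coded D t (\<lambda>d. r d + r' d)"
  unfolding coded_def
proof (intro allI impI)
  fix e :: real assume "0 < e"
  then have "0 < e / 2" by simp
  then obtain \<delta> \<delta>' where \<delta>: "0 < \<delta>" "\<And>d d'. d \<in> D \<Longrightarrow> d' \<in> D \<Longrightarrow> \<bar>t d - t d'\<bar> < \<delta> \<Longrightarrow> dist (r d) (r d') < e / 2"
    "0 < \<delta>'" "\<And>d d'. d \<in> D \<Longrightarrow> d' \<in> D \<Longrightarrow> \<bar>t d - t d'\<bar> < \<delta>' \<Longrightarrow> dist (r' d) (r' d') < e / 2"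
    using assms unfolding coded_def by metis
  show "\<exists>\<delta>>0. \<forall>d\<in>D. \<forall>d'\<in>D. \<bar>t d - t d'\<bar> < \<delta> \<longrightarrow> dist (r d + r' d) (r d' + r' d') < e"
  proof (intro exI[of _ "min \<delta> \<delta>'"] conjI ballI impI)
    fix d d' assume "d \<in> D" "d' \<in> D" "\<bar>t d - t d'\<bar> < min \<delta> \<delta>'"
    then have "dist (r d) (r d') < e / 2" "dist (r' d) (r' d') < e / 2" using \<delta> by auto
    then show "dist (r d + r' d) (r d' + r' d') < e" using dist_triangle_add[of "r d" "r' d" "r d'" "r' d'"] by linarith
  qed (use \<delta> in simp)
qed

lemma coded_mult:
  fixes r :: "'d \<Rightarrow> 'b::real_normed_field"
  assumes "coded D t r" shows "coded D t (\<lambda>d. c * r d)"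
proof (cases "c = 0")
  case True
  then show ?thesis by (auto simp: coded_def intro: exI[of _ 1])
next
  case False
  show ?thesis
    unfolding coded_def
  proof (intro allI impI)
    fix e :: real assume "0 < e"
    then have "0 < e / norm c" using False by simp
    then obtain \<delta> where \<delta>: "0 < \<delta>" "\<And>d d'. d \<in> D \<Longrightarrow> d' \<in> D \<Longrightarrow> \<bar>t d - t d'\<bar> < \<delta> \<Longrightarrow> dist (r d) (r d') < e / norm c"
      using assms unfolding coded_def by metis
    have "dist (c * a) (c * b) < e" if "dist a b < e / norm c" for a b
    proof -
      have "dist (c * a) (c * b) = norm c * dist a b" by (simp add: dist_norm norm_mult flip: right_diff_distrib)
      then show ?thesis using that False by (simp add: pos_less_divide_eq mult.commute)
    qed
    then show "\<exists>\<delta>>0. \<forall>d\<in>D. \<forall>d'\<in>D. \<bar>t d - t d'\<bar> < \<delta> \<longrightarrow> dist (c * r d) (c * r d') < e"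
      using \<delta> by blast
  qed
qed

lemma coded_uniform_limit:
  assumes "\<And>e. 0 < e \<Longrightarrow> \<exists>r'. coded D t r' \<and> (\<forall>d\<in>D. dist (r d) (r' d) < e)"
  shows "coded D t r"
  unfolding coded_def
proof (intro allI impI)
  fix e :: real assume "0 < e"
  then have "0 < e / 3" by simp
  then obtain r' where r': "coded D t r'" "\<And>d. d \<in> D \<Longrightarrow> dist (r d) (r' d) < e / 3" using assms by blast
  obtain \<delta> where \<delta>: "0 < \<delta>" "\<And>d d'. d \<in> D \<Longrightarrow> d' \<in> D \<Longrightarrow> \<bar>t d - t d'\<bar> < \<delta> \<Longrightarrow> dist (r' d) (r' d') < e / 3"
    using r'(1) \<open>0 < e / 3\<close> unfolding coded_def by metis
  have "dist (r d) (r d') < e" if "d \<in> D" "d' \<in> D" "\<bar>t d - t d'\<bar> < \<delta>" for d d'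
    using r'(2)[OF that(1)] r'(2)[OF that(2)] \<delta>(2)[OF that] dist_triangle[of "r d" "r d'" "r' d"]
      dist_triangle2[of "r' d" "r d'" "r' d'"] by linarith
  then show "\<exists>\<delta>>0. \<forall>d\<in>D. \<forall>d'\<in>D. \<bar>t d - t d'\<bar> < \<delta> \<longrightarrow> dist (r d) (r d') < e" using \<delta>(1) by blast
qed

text \<open>A uniformly continuous function of the code extends continuously to limits of codes. The
  filters at different points are chosen independently; uniformity makes their limits fit together
  and forces the value \<open>r d\<close> at the code of \<open>d\<close>.\<close>

lemma coded_extension:
  assumes r: "coded D t r"
    and F: "\<And>y. y \<in> S \<Longrightarrow> F y \<noteq> bot" "\<And>y. y \<in> S \<Longrightarrow> (t \<longlongrightarrow> y) (F y)"
      "\<And>y. y \<in> S \<Longrightarrow> \<forall>\<^sub>F d in F y. d \<in> D" "\<And>y. y \<in> S \<Longrightarrow> (r \<longlongrightarrow> R y) (F y)"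
  shows "continuous_on S R" "d \<in> D \<Longrightarrow> t d \<in> S \<Longrightarrow> R (t d) = r d"
proof -
  have near: "\<exists>d\<in>D. \<bar>t d - y\<bar> < \<delta> \<and> dist (r d) (R y) < e" if "y \<in> S" "0 < \<delta>" "0 < e" for y \<delta> e
  proof -
    have "\<forall>\<^sub>F d in F y. d \<in> D \<and> \<bar>t d - y\<bar> < \<delta> \<and> dist (r d) (R y) < e"
      using tendstoD[OF F(2)[OF that(1)] that(2)] tendstoD[OF F(4)[OF that(1)] that(3)] F(3)[OF that(1)]
      by eventually_elim (auto simp: dist_real_def)
    then show ?thesis using eventually_happens'[OF F(1)[OF that(1)]] by blast
  qed
  show "continuous_on S R"
    unfolding continuous_on_iff
  proof (intro ballI allI impI)
    fix y and e :: real assume y: "y \<in> S" and "0 < e"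
    then have e: "0 < e / 3" by simp
    obtain \<delta> where \<delta>: "0 < \<delta>" "\<And>d d'. d \<in> D \<Longrightarrow> d' \<in> D \<Longrightarrow> \<bar>t d - t d'\<bar> < \<delta> \<Longrightarrow> dist (r d) (r d') < e / 3"
      using r e unfolding coded_def by metis
    have \<delta>3: "0 < \<delta> / 3" using \<delta> by simp
    have "dist (R y') (R y) < e" if y': "y' \<in> S" "dist y' y < \<delta> / 3" for y'
    proof -
      obtain d where d: "d \<in> D" "\<bar>t d - y\<bar> < \<delta> / 3" "dist (r d) (R y) < e / 3" using near[OF y \<delta>3 e] by blast
      obtain d' where d': "d' \<in> D" "\<bar>t d' - y'\<bar> < \<delta> / 3" "dist (r d') (R y') < e / 3" using near[OF y'(1) \<delta>3 e] by blast
      have "\<bar>t d' - t d\<bar> < \<delta>" using d(2) d'(2) y'(2) by (simp add: dist_real_def abs_if split: if_splits)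
      then have "dist (r d') (r d) < e / 3" using \<delta>(2) d d' by blast
      then show ?thesis
        using d(3) d'(3) dist_triangle3[of "R y'" "R y" "r d'"] dist_triangle[of "r d'" "R y" "r d"] by linarith
    qed
    then show "\<exists>\<delta>>0. \<forall>y'\<in>S. dist y' y < \<delta> \<longrightarrow> dist (R y') (R y) < e" using \<delta>3 by blast
  qed
  show "R (t d) = r d" if d: "d \<in> D" "t d \<in> S"
  proof -
    have "dist (R (t d)) (r d) \<le> 0"
    proof (rule field_le_epsilon)
      fix e :: real assume "0 < e"
      then have e: "0 < e / 2" by simp
      obtain \<delta> where \<delta>: "0 < \<delta>" "\<And>d d'. d \<in> D \<Longrightarrow> d' \<in> D \<Longrightarrow> \<bar>t d - t d'\<bar> < \<delta> \<Longrightarrow> dist (r d) (r d') < e / 2"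
        using r e unfolding coded_def by metis
      obtain d' where d': "d' \<in> D" "\<bar>t d' - t d\<bar> < \<delta>" "dist (r d') (R (t d)) < e / 2" using near[OF d(2) \<delta>(1) e] by blast
      then have "dist (r d') (r d) < e / 2" using \<delta>(2) d by blast
      then show "dist (R (t d)) (r d) \<le> 0 + e" using d'(3) dist_triangle3[of "R (t d)" "r d" "r d'"] by linarith
    qed
    then show ?thesis by simp
  qed
qed

text \<open>The codes lie in a bounded interval, so their distributions are tight and Helly's
  selection theorem applies. Weak convergence is tested by functions on the whole line; a function
  given on \<open>S\<close> is extended by Tietze's theorem, and the extension has the same integral
  because \<open>M\<close> is concentrated on \<open>S\<close>.\<close>

lemma limit_measure:
  fixes t :: "'d \<Rightarrow> real" and p :: "nat \<Rightarrow> 'd pmf"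
  assumes t: "\<And>d. 0 \<le> t d \<and> t d \<le> 3 / 2" and p: "\<And>n. set_pmf (p n) \<subseteq> D"
  defines "S \<equiv> closure (t ` D)"
  shows "\<exists>M s. strict_mono s \<and> real_distribution M \<and> (AE y in M. y \<in> S) \<and>
    (\<forall>f::real \<Rightarrow> real. continuous_on S f \<longrightarrow>
      (\<lambda>n. expect (p (s n)) (\<lambda>d. f (t d))) \<longlonglongrightarrow> (\<integral>y. (if y \<in> S then f y else 0) \<partial>M))"
proof -
  define \<nu> where "\<nu> n = distr (measure_pmf (p n)) borel t" for n
  have rd: "real_distribution (\<nu> n)" for n
    unfolding \<nu>_def by (rule prob_space.real_distribution_distr[OF prob_space_measure_pmf]) simp
  have "tight \<nu>"
    unfolding tight_def
  proof (intro conjI allI impI rd)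
    fix \<epsilon> :: real assume "0 < \<epsilon>"
    have "- 1 < t x \<and> t x \<le> 2" for x using t[of x] by linarith
    then have "t -` {-1<..2} = UNIV" by auto
    then have "measure (\<nu> n) {-1<..2} = 1" for n
      by (simp add: \<nu>_def measure_distr)
    then show "\<exists>a b. a < b \<and> (\<forall>n. 1 - \<epsilon> < measure (\<nu> n) {a<..b})"
      using \<open>0 < \<epsilon>\<close> by (intro exI[of _ "- 1"] exI[of _ 2]) simp
  qed
  from tight_imp_convergent_subsubsequence[OF this strict_mono_id]
  obtain s M where s: "strict_mono (s :: nat \<Rightarrow> nat)" and M: "real_distribution M" and "weak_conv_m (\<nu> \<circ> id \<circ> s) M"
    by blast
  then have wc: "weak_conv_m (\<lambda>n. \<nu> (s n)) M" by (simp add: o_def)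
  interpret M: real_distribution M by (rule M)
  obtain d0 where "d0 \<in> set_pmf (p 0)" using set_pmf_not_empty[of "p 0"] by blast
  then have S_ne: "S \<noteq> {}" using p by (auto simp: S_def)
  have S_closed: "closed S" by (simp add: S_def)
  have tS: "t d \<in> S" if "d \<in> D" for d
    unfolding S_def using that closure_subset by fastforce
  have conv: "(\<lambda>n. expect (p (s n)) (\<lambda>d. g (t d))) \<longlonglongrightarrow> (\<integral>y. g y \<partial>M)"
    if g: "continuous_on UNIV g" "\<And>y. \<bar>g y\<bar> \<le> B" for g :: "real \<Rightarrow> real" and B
  proof -
    have "(\<lambda>n. integral\<^sup>L (\<nu> (s n)) g) \<longlonglongrightarrow> integral\<^sup>L M g"
      by (rule weak_conv_imp_integral_bdd_continuous_conv[OF rd M wc])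
         (use g in \<open>auto simp: continuous_on_eq_continuous_at\<close>)
    moreover have "integral\<^sup>L (\<nu> (s n)) g = expect (p (s n)) (\<lambda>d. g (t d))" for n
      unfolding \<nu>_def by (rule integral_distr) (use g in \<open>auto intro: borel_measurable_continuous_onI\<close>)
    ultimately show ?thesis by simp
  qed
  have AE_S: "AE y in M. y \<in> S"
  proof -
    \<comment> \<open>A bounded continuous function vanishing exactly on \<open>S\<close>: its
      averages along the sequence are 0, hence so is its integral over \<open>M\<close>.\<close>
    let ?h = "\<lambda>y. min 1 (infdist y S)"
    have h: "continuous_on UNIV ?h" "\<And>y. \<bar>?h y\<bar> \<le> 1"
      by (auto intro!: continuous_intros simp: infdist_nonneg abs_le_iff)
    have "expect (p (s n)) (\<lambda>d. ?h (t d)) = 0" for n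
    proof -
      have "expect (p (s n)) (\<lambda>d. ?h (t d)) = expect (p (s n)) (\<lambda>d. 0)"
        by (rule expect_cong) (use p tS in force)
      then show ?thesis by simp
    qed
    then have lim0: "(\<lambda>n::nat. 0::real) \<longlonglongrightarrow> (\<integral>y. ?h y \<partial>M)" using conv[OF h] by simp
    have "(\<integral>y. ?h y \<partial>M) = 0" by (rule LIMSEQ_unique[OF lim0 tendsto_const])
    moreover have "integrable M ?h"
      by (rule M.integrable_const_bound[of _ 1])
         (use h M.measurable_finite_borel[OF borel_measurable_continuous_onI[OF h(1)]] in auto)
    ultimately have "AE y in M. ?h y = 0"
      by (subst (asm) integral_nonneg_eq_0_iff_AE) (auto simp: infdist_nonneg)
    then show ?thesis
      by eventually_elim (use in_closed_iff_infdist_zero[OF S_closed S_ne] in \<open>auto simp: min_def split: if_splits\<close>)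
  qed
  have "(\<lambda>n. expect (p (s n)) (\<lambda>d. f (t d))) \<longlonglongrightarrow> (\<integral>y. (if y \<in> S then f y else 0) \<partial>M)"
    if f: "continuous_on S f" for f :: "real \<Rightarrow> real"
  proof -
    have "bounded (t ` D)" unfolding bounded_iff using t by (intro exI[of _ "3/2"]) auto
    then have "compact S" by (simp add: S_def)
    then have "bounded (f ` S)" using f compact_continuous_image compact_imp_bounded by blast
    then obtain B where B: "\<And>y. y \<in> S \<Longrightarrow> norm (f y) \<le> B" "0 \<le> B" unfolding bounded_pos by (metis imageI less_imp_le)
    obtain g where g: "continuous_on UNIV g" "\<And>y. y \<in> S \<Longrightarrow> g y = f y" "\<And>y. y \<in> UNIV \<Longrightarrow> norm (g y) \<le> B"
      by (rule Tietze[OF f _ B(2) B(1), of UNIV]) (use S_closed in auto)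
    have "(\<lambda>n. expect (p (s n)) (\<lambda>d. g (t d))) \<longlonglongrightarrow> (\<integral>y. g y \<partial>M)"
      using g(3) by (intro conv[OF g(1), of B]) auto
    moreover have "expect (p (s n)) (\<lambda>d. g (t d)) = expect (p (s n)) (\<lambda>d. f (t d))" for n
      by (rule expect_cong) (use p tS g(2) in blast)
    moreover have "(\<integral>y. g y \<partial>M) = (\<integral>y. (if y \<in> S then f y else 0) \<partial>M)"
    proof (rule integral_cong_AE)
      have "(\<lambda>y. if y \<in> S then f y else 0) = (\<lambda>y. indicator S y * g y)" using g(2) by (auto simp: indicator_def)
      then show "(\<lambda>y. if y \<in> S then f y else 0) \<in> borel_measurable M"
        using borel_measurable_continuous_onI[OF g(1)] S_closed by (simp add: M.measurable_finite_borel)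
    qed (use AE_S g(2) M.measurable_finite_borel[OF borel_measurable_continuous_onI[OF g(1)]] in auto)
    ultimately show ?thesis by simp
  qed
  then show ?thesis using s M AE_S by blast
qed

subsection \<open>Arens extensions\<close>

text \<open>The head of the list is the outermost limit.\<close>

primrec ext :: "(nat \<Rightarrow> ('x::real_normed_vector \<Rightarrow>\<^sub>L 'k::real_or_complex) \<Rightarrow> 'k) \<Rightarrow>
    ((nat \<Rightarrow> 'x) \<Rightarrow> 'k) \<Rightarrow> nat list \<Rightarrow> (nat \<Rightarrow> 'x) \<Rightarrow> 'k" where
  "ext \<phi> \<omega> [] x = \<omega> x"
| "ext \<phi> \<omega> (i # is) x = \<phi> i (Blinfun (\<lambda>a. ext \<phi> \<omega> is (x(i := a))))"

context normed_space_over
begin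

definition functional :: "(('x \<Rightarrow>\<^sub>L 'k) \<Rightarrow> 'k) \<Rightarrow> bool" where
  "functional \<phi> \<longleftrightarrow> (\<forall>f\<in>dual_space scale. \<forall>g\<in>dual_space scale. \<phi> (f + g) = \<phi> f + \<phi> g) \<and>
    (\<forall>c. \<forall>f\<in>dual_space scale. \<phi> (dual_scale c f) = c * \<phi> f) \<and> (\<forall>f\<in>dual_space scale. norm (\<phi> f) \<le> norm f)"

lemma functional_add: "functional \<phi> \<Longrightarrow> f \<in> dual_space scale \<Longrightarrow> g \<in> dual_space scale \<Longrightarrow> \<phi> (f + g) = \<phi> f + \<phi> g"
  and functional_scale: "functional \<phi> \<Longrightarrow> f \<in> dual_space scale \<Longrightarrow> \<phi> (dual_scale c f) = c * \<phi> f"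
  and functional_norm: "functional \<phi> \<Longrightarrow> f \<in> dual_space scale \<Longrightarrow> norm (\<phi> f) \<le> norm f"
  by (auto simp: functional_def)

lemma functional_zero: "functional \<phi> \<Longrightarrow> \<phi> 0 = 0"
  using functional_norm[of \<phi> 0] zero_dual by simp

lemma functional_sum:
  assumes "functional \<phi>" "\<And>i. i \<in> I \<Longrightarrow> f i \<in> dual_space scale"
  shows "\<phi> (\<Sum>i\<in>I. f i) = (\<Sum>i\<in>I. \<phi> (f i))"
  using assms(2)
  by (induction I rule: infinite_finite_induct)
     (auto simp: functional_zero[OF assms(1)] functional_add[OF assms(1)] dual_sum)

lemma functional_diff:
  assumes "functional \<phi>" "f \<in> dual_space scale" "g \<in> dual_space scale"
  shows "\<phi> (f - g) = \<phi> f - \<phi> g"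
  using functional_add[OF assms(1) dual_diff[OF assms(2,3)] assms(3)] by simp

text \<open>By Goldstine's theorem these limits make up the unit ball of the bidual. Keeping a net
  as part of the definition supplies the nets over which Arens extensions are computed.\<close>

definition ball_limit :: "(('x \<Rightarrow>\<^sub>L 'k) \<Rightarrow> 'k) \<Rightarrow> bool" where
  "ball_limit \<phi> \<longleftrightarrow> (\<exists>F. F \<noteq> bot \<and> (\<forall>\<^sub>F x in F. norm x \<le> 1) \<and> (canonical_embedding scale \<longlongrightarrow> \<phi>) F)"

lemma ball_limit_functional:
  assumes "ball_limit \<phi>"
  shows "functional \<phi>" "f \<notin> dual_space scale \<Longrightarrow> \<phi> f = 0"
proof -
  obtain F where F: "F \<noteq> bot" "\<forall>\<^sub>F x in F. norm x \<le> 1"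
    "\<And>f. ((\<lambda>x. canonical_embedding scale x f) \<longlongrightarrow> \<phi> f) F"
    using assms unfolding ball_limit_def tendsto_fun_iff by blast
  have lim: "(blinfun_apply f \<longlongrightarrow> \<phi> f) F" if "f \<in> dual_space scale" for f
    using F(3)[of f] that by (simp add: canonical_embedding_def)
  have "\<phi> (f + g) = \<phi> f + \<phi> g" if "f \<in> dual_space scale" "g \<in> dual_space scale" for f g
  proof (rule tendsto_unique[OF F(1) lim[OF dual_add[OF that]]])
    show "(blinfun_apply (f + g) \<longlongrightarrow> \<phi> f + \<phi> g) F"
      using tendsto_add[OF lim[OF that(1)] lim[OF that(2)]] by (simp add: plus_blinfun.rep_eq)
  qed
  moreover have "\<phi> (dual_scale c f) = c * \<phi> f" if "f \<in> dual_space scale" for f c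
  proof (rule tendsto_unique[OF F(1) lim[OF dual_dual_scale[OF that]]])
    show "(blinfun_apply (dual_scale c f) \<longlongrightarrow> c * \<phi> f) F"
    proof -
      have "blinfun_apply (dual_scale c f) = (\<lambda>x. c * f x)" by auto
      then show ?thesis using tendsto_mult_left[OF lim[OF that], of c] by simp
    qed
  qed
  moreover have "norm (\<phi> f) \<le> norm f" if "f \<in> dual_space scale" for f
  proof (rule tendsto_upperbound[OF tendsto_norm[OF lim[OF that]] _ F(1)])
    show "\<forall>\<^sub>F x in F. norm (blinfun_apply f x) \<le> norm f"
      using F(2)
    proof eventually_elim
      case (elim x)
      then have "norm f * norm x \<le> norm f * 1" by (intro mult_left_mono) auto
      then show ?case using norm_blinfun[of f x] by linarith
    qed
  qed
  ultimately show "functional \<phi>" unfolding functional_def by blast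
  show "\<phi> f = 0" if "f \<notin> dual_space scale"
    using tendsto_unique[OF F(1) F(3)[of f], of 0] that by (simp add: canonical_embedding_def)
qed

lemma ball_limit_bidual:
  assumes "ball_limit \<phi>"
  shows "\<phi> \<in> bidual_space scale" "bidual_norm scale \<phi> \<le> 1"
proof -
  note fn = ball_limit_functional(1)[OF assms]
  show "\<phi> \<in> bidual_space scale"
    unfolding bidual_space_def using fn ball_limit_functional(2)[OF assms]
    by (auto simp: functional_def intro!: exI[of _ 1])
  show "bidual_norm scale \<phi> \<le> 1"
    unfolding bidual_norm_def
  proof (rule cSUP_least)
    show "{f \<in> dual_space scale. norm f \<le> 1} \<noteq> {}" using zero_dual by (auto intro: exI[of _ 0])
    fix f assume "f \<in> {f \<in> dual_space scale. norm f \<le> 1}"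
    then show "norm (\<phi> f) \<le> 1" using functional_norm[OF fn, of f] by simp
  qed
qed

text \<open>The state in the middle of an iterated limit: the coordinates in \<open>is\<close> are
  consumed and no longer influence the value, and only the remaining ones enter multilinearity and
  bound.\<close>

definition partial_mlin :: "nat \<Rightarrow> real \<Rightarrow> nat list \<Rightarrow> ((nat \<Rightarrow> 'x) \<Rightarrow> 'k) \<Rightarrow> bool" where
  "partial_mlin N B is e \<longleftrightarrow> (\<forall>x y. (\<forall>j<N. j \<notin> set is \<longrightarrow> x j = y j) \<longrightarrow> e x = e y) \<and>
    (\<forall>j<N. j \<notin> set is \<longrightarrow> (\<forall>x a b. e (x(j := a + b)) = e (x(j := a)) + e (x(j := b)))) \<and>
    (\<forall>j<N. j \<notin> set is \<longrightarrow> (\<forall>x c a. e (x(j := scale c a)) = c * e (x(j := a)))) \<and>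
    (\<forall>x. norm (e x) \<le> B * (\<Prod>j\<in>{..<N} - set is. norm (x j)))"

lemma partial_mlinD:
  assumes "partial_mlin N B is e"
  shows "(\<And>j. j < N \<Longrightarrow> j \<notin> set is \<Longrightarrow> x j = y j) \<Longrightarrow> e x = e y"
    "j < N \<Longrightarrow> j \<notin> set is \<Longrightarrow> e (x(j := a + b)) = e (x(j := a)) + e (x(j := b))"
    "j < N \<Longrightarrow> j \<notin> set is \<Longrightarrow> e (x(j := scale c a)) = c * e (x(j := a))"
    "norm (e x) \<le> B * (\<Prod>j\<in>{..<N} - set is. norm (x j))"
  using assms unfolding partial_mlin_def by blast+

text \<open>\<open>ext\<close> forms \<open>Blinfun\<close> of a slice, which is meaningful only for
  a bounded linear one. Once the slice is known to lie in the dual, a bidual element can act on it,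
  and the norm bound feeds the next round.\<close>

lemma partial_mlin_slice:
  assumes e: "partial_mlin N B is e" and i: "i < N" "i \<notin> set is"
  shows "blinfun_apply (Blinfun (\<lambda>a. e (x(i := a)))) = (\<lambda>a. e (x(i := a)))"
    "Blinfun (\<lambda>a. e (x(i := a))) \<in> dual_space scale"
    "norm (Blinfun (\<lambda>a. e (x(i := a)))) \<le> \<bar>B\<bar> * (\<Prod>j\<in>{..<N} - set (i # is). norm (x j))"
proof -
  have split: "{..<N} - set is = insert i ({..<N} - set (i # is))" using i by auto
  have bound: "norm (e (x(i := a))) \<le> \<bar>B\<bar> * (\<Prod>j\<in>{..<N} - set (i # is). norm (x j)) * norm a" for a
  proof -
    have "norm (e (x(i := a))) \<le> B * (\<Prod>j\<in>{..<N} - set is. norm ((x(i := a)) j))" by (rule partial_mlinD(4)[OF e])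
    also have "(\<Prod>j\<in>{..<N} - set is. norm ((x(i := a)) j)) = norm a * (\<Prod>j\<in>{..<N} - set (i # is). norm (x j))"
      unfolding split by (subst prod.insert) (auto intro!: prod.cong)
    also have "B * \<dots> \<le> \<bar>B\<bar> * \<dots>" by (intro mult_right_mono mult_nonneg_nonneg prod_nonneg) auto
    finally show ?thesis by (simp add: mult_ac del: fun_upd_apply)
  qed
  have bl: "bounded_linear (\<lambda>a. e (x(i := a)))"
  proof (rule bounded_linear_intro)
    show "e (x(i := a + b)) = e (x(i := a)) + e (x(i := b))" for a b by (rule partial_mlinD(2)[OF e i])
    show "e (x(i := r *\<^sub>R a)) = r *\<^sub>R e (x(i := a))" for r a
      using partial_mlinD(3)[OF e i, of x "of_real r" a] by (simp add: scale_of_real scaleR_conv_of_real)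
    show "norm (e (x(i := a))) \<le> norm a * (\<bar>B\<bar> * (\<Prod>j\<in>{..<N} - set (i # is). norm (x j)))" for a
      using bound[of a] by (simp add: mult_ac)
  qed
  show app: "blinfun_apply (Blinfun (\<lambda>a. e (x(i := a)))) = (\<lambda>a. e (x(i := a)))"
    by (rule bounded_linear_Blinfun_apply[OF bl])
  show "Blinfun (\<lambda>a. e (x(i := a))) \<in> dual_space scale"
    unfolding dual_space_iff[OF normed_space_over_axioms] app by (simp add: partial_mlinD(3)[OF e i])
  show "norm (Blinfun (\<lambda>a. e (x(i := a)))) \<le> \<bar>B\<bar> * (\<Prod>j\<in>{..<N} - set (i # is). norm (x j))"
  proof (rule norm_blinfun_bound)
    show "0 \<le> \<bar>B\<bar> * (\<Prod>j\<in>{..<N} - set (i # is). norm (x j))" by (intro mult_nonneg_nonneg prod_nonneg) auto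
    show "norm (blinfun_apply (Blinfun (\<lambda>a. e (x(i := a)))) a) \<le>
        \<bar>B\<bar> * (\<Prod>j\<in>{..<N} - set (i # is). norm (x j)) * norm a" for a
      unfolding app by (rule bound)
  qed
qed

lemma partial_mlin_ext:
  assumes \<omega>: "mlin N scale (*) \<omega>" "\<And>x. norm (\<omega> x) \<le> B * (\<Prod>j<N. norm (x j))" and "0 \<le> B"
    and "distinct is" "set is \<subseteq> {..<N}" "\<And>i. i \<in> set is \<Longrightarrow> functional (\<phi> i)"
  shows "partial_mlin N B is (ext \<phi> \<omega> is)"
  using assms(4-)
proof (induction "is")
  case Nil
  show ?case
    unfolding partial_mlin_def using \<omega> by (simp add: mlin_def)
next
  case (Cons i "is")
  then have e: "partial_mlin N B is (ext \<phi> \<omega> is)" and i: "i < N" "i \<notin> set is" and \<phi>: "functional (\<phi> i)" by auto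
  note sl = partial_mlin_slice[OF e i]
  let ?L = "\<lambda>x. Blinfun (\<lambda>a. ext \<phi> \<omega> is (x(i := a)))"
  show ?case
    unfolding partial_mlin_def ext.simps
  proof (intro conjI allI impI)
    fix x y :: "nat \<Rightarrow> 'x" assume eq: "\<forall>j<N. j \<notin> set (i # is) \<longrightarrow> x j = y j"
    have "ext \<phi> \<omega> is (x(i := a)) = ext \<phi> \<omega> is (y(i := a))" for a
      by (rule partial_mlinD(1)[OF e]) (use eq in auto)
    then show "\<phi> i (?L x) = \<phi> i (?L y)" by simp
  next
    fix j and x :: "nat \<Rightarrow> 'x" and a b :: 'x assume j: "j < N" "j \<notin> set (i # is)"
    then have swap: "(x(j := c))(i := d) = (x(i := d))(j := c)" for c d by (auto simp: fun_upd_twist)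
    have L_app: "blinfun_apply (?L (x(j := c))) d = ext \<phi> \<omega> is (x(i := d, j := c))" for c d
      by (simp only: sl(1)) (simp only: swap)
    have j': "j < N" "j \<notin> set is" using j by auto
    have "?L (x(j := a + b)) = ?L (x(j := a)) + ?L (x(j := b))"
      by (rule blinfun_eqI) (simp only: L_app blinfun.add_left partial_mlinD(2)[OF e j'])
    then show "\<phi> i (?L (x(j := a + b))) = \<phi> i (?L (x(j := a))) + \<phi> i (?L (x(j := b)))"
      using functional_add[OF \<phi> sl(2) sl(2)] by metis
    fix c
    have "?L (x(j := scale c a)) = dual_scale c (?L (x(j := a)))"
      by (rule blinfun_eqI) (simp only: L_app dual_scale_apply partial_mlinD(3)[OF e j'])
    then show "\<phi> i (?L (x(j := scale c a))) = c * \<phi> i (?L (x(j := a)))"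
      using functional_scale[OF \<phi> sl(2)] by metis
  next
    fix x
    show "norm (\<phi> i (?L x)) \<le> B * (\<Prod>j\<in>{..<N} - set (i # is). norm (x j))"
      using order_trans[OF functional_norm[OF \<phi> sl(2)] sl(3), of x] \<open>0 \<le> B\<close> by simp
  qed
qed

end

section \<open>Iterated weak-star limits as iterated application of functionals\<close>

lemma iterated_limit_unique:
  assumes "has_iterated_wstar_limit sZ \<Psi> F is x \<zeta>" "has_iterated_wstar_limit sZ \<Psi> F is x \<zeta>'"
    and "\<And>i. i \<in> set is \<Longrightarrow> F i \<noteq> bot"
  shows "\<zeta> = \<zeta>'"
  using assms
proof (induction "is" arbitrary: x \<zeta> \<zeta>')
  case Nil
  then show ?case by simp
next
  case (Cons i "is")
  obtain h where h: "\<And>a. has_iterated_wstar_limit sZ \<Psi> F is (x(i := a)) (h a)" "(h \<longlongrightarrow> \<zeta>) (F i)"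
    using Cons.prems(1) by auto
  obtain h' where h': "\<And>a. has_iterated_wstar_limit sZ \<Psi> F is (x(i := a)) (h' a)" "(h' \<longlongrightarrow> \<zeta>') (F i)"
    using Cons.prems(2) by auto
  have "h a = h' a" for a using Cons.IH[OF h(1) h'(1)] Cons.prems(3) by simp
  then have "h = h'" ..
  show ?case
  proof
    fix g
    show "\<zeta> g = \<zeta>' g"
      using tendsto_unique[of "F i" "\<lambda>a. h a g" "\<zeta> g" "\<zeta>' g"] h(2) h'(2) Cons.prems(3) \<open>h = h'\<close>
      by (simp add: tendsto_fun_iff)
  qed
qed

context normed_space_pair
begin

lemma mlin_dual:
  assumes \<Psi>: "mlin N sX sZ \<Psi>" and B: "\<And>x. norm (\<Psi> x) \<le> B * (\<Prod>i<N. norm (x i))" and g: "g \<in> dual_space sZ"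
  shows "mlin N sX (*) (\<lambda>x. blinfun_apply g (\<Psi> x))"
    "norm (blinfun_apply g (\<Psi> x)) \<le> (norm g * B) * (\<Prod>i<N. norm (x i))"
proof -
  show "mlin N sX (*) (\<lambda>x. blinfun_apply g (\<Psi> x))"
    unfolding mlin_def
  proof (intro conjI allI impI)
    fix x y :: "nat \<Rightarrow> 'x" assume "\<forall>i<N. x i = y i"
    then have "\<Psi> x = \<Psi> y" by (intro mlin_cong[OF \<Psi>]) auto
    then show "g (\<Psi> x) = g (\<Psi> y)" by simp
  qed (simp_all add: mlin_add[OF \<Psi>] mlin_scale[OF \<Psi>] blinfun.add_right Z.dual_apply_scale[OF g] del: fun_upd_apply)
  have "norm (blinfun_apply g (\<Psi> x)) \<le> norm g * norm (\<Psi> x)" by (rule norm_blinfun)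
  also have "\<dots> \<le> norm g * (B * (\<Prod>i<N. norm (x i)))" by (intro mult_left_mono B) simp
  finally show "norm (blinfun_apply g (\<Psi> x)) \<le> (norm g * B) * (\<Prod>i<N. norm (x i))" by (simp add: mult.assoc)
qed

text \<open>Vanishing outside the dual is the normalization of the elements of the bidual.\<close>

definition arens_value :: "(nat \<Rightarrow> ('x \<Rightarrow>\<^sub>L 'k) \<Rightarrow> 'k) \<Rightarrow> ((nat \<Rightarrow> 'x) \<Rightarrow> 'z) \<Rightarrow> nat list \<Rightarrow> (nat \<Rightarrow> 'x) \<Rightarrow> ('z \<Rightarrow>\<^sub>L 'k) \<Rightarrow> 'k" where
  "arens_value \<phi> \<Psi> is x g = (if g \<in> dual_space sZ then ext \<phi> (\<lambda>x. blinfun_apply g (\<Psi> x)) is x else 0)"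

text \<open>With the inner limits taken, what remains is, for each \<open>g\<close>, an element of
  the dual evaluated at \<open>a\<close>. Weak-star convergence of the net to
  \<open>\<phi> i\<close> is precisely convergence of such evaluations, whichever net is
  used.\<close>

lemma iterated_limit_arens_value:
  assumes \<Psi>: "mlin N sX sZ \<Psi>" "\<And>x. norm (\<Psi> x) \<le> B * (\<Prod>i<N. norm (x i))" "0 \<le> B"
    and "distinct is" "set is \<subseteq> {..<N}" "\<And>i. i \<in> set is \<Longrightarrow> X.functional (\<phi> i)"
    "\<And>i. i \<in> set is \<Longrightarrow> bounded_wstar_net sX (F i) (\<phi> i)"
  shows "has_iterated_wstar_limit sZ \<Psi> F is x (arens_value \<phi> \<Psi> is x)"
  using assms(4-)
proof (induction "is" arbitrary: x)
  case Nil
  show ?case by (auto simp: arens_value_def canonical_embedding_def)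
next
  case (Cons i "is")
  show ?case
    unfolding has_iterated_wstar_limit.simps
  proof (intro exI[of _ "\<lambda>a. arens_value \<phi> \<Psi> is (x(i := a))"] conjI allI)
    show "has_iterated_wstar_limit sZ \<Psi> F is (x(i := a)) (arens_value \<phi> \<Psi> is (x(i := a)))" for a
      using Cons by simp
    have i: "i < N" "i \<notin> set is" using Cons.prems by auto
    show "((\<lambda>a. arens_value \<phi> \<Psi> is (x(i := a))) \<longlongrightarrow> arens_value \<phi> \<Psi> (i # is) x) (F i)"
      unfolding tendsto_fun_iff
    proof
      fix g
      show "((\<lambda>a. arens_value \<phi> \<Psi> is (x(i := a)) g) \<longlongrightarrow> arens_value \<phi> \<Psi> (i # is) x g) (F i)"
      proof (cases "g \<in> dual_space sZ")
        case True
        let ?\<omega> = "\<lambda>x. blinfun_apply g (\<Psi> x)"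
        have e: "X.partial_mlin N (norm g * B) is (ext \<phi> ?\<omega> is)"
          by (rule X.partial_mlin_ext[OF mlin_dual[OF \<Psi>(1,2) True]]) (use \<Psi>(3) Cons.prems in auto)
        note sl = X.partial_mlin_slice[OF e i, of x]
        have "(canonical_embedding sX \<longlongrightarrow> \<phi> i) (F i)" using Cons.prems by (simp add: bounded_wstar_net_def)
        then have "((\<lambda>a. canonical_embedding sX a (Blinfun (\<lambda>a. ext \<phi> ?\<omega> is (x(i := a))))) \<longlongrightarrow>
            \<phi> i (Blinfun (\<lambda>a. ext \<phi> ?\<omega> is (x(i := a))))) (F i)"
          by (simp only: tendsto_fun_iff)
        then show ?thesis
          using True by (simp add: arens_value_def canonical_embedding_def sl(1,2) del: fun_upd_apply)
      qed (simp add: arens_value_def)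
    qed
  qed
qed

text \<open>One functional \<open>g\<close> in the dual ball witnesses the norm in the bidual of the
  codomain for every order of limits; the opposite estimate is the bound carried by
  \<open>partial_mlin\<close>.\<close>

lemma arens_attain:
  assumes \<Psi>: "mlin N sX sZ \<Psi>" "\<forall>x\<in>unit_tuples N. norm (\<Psi> x) \<le> B0"
    and \<phi>: "\<And>i. i < N \<Longrightarrow> X.ball_limit (\<phi> i)" and g: "g \<in> dual_space sZ" "norm g \<le> 1"
    and att: "\<And>\<sigma>. \<sigma> permutes {..<N} \<Longrightarrow>
      multilinear_norm N \<Psi> \<le> norm (ext \<phi> (\<lambda>x. blinfun_apply g (\<Psi> x)) (map \<sigma> [0..<N]) (\<lambda>_. 0))"
  shows "arens_extensions_attain_norm_at_same_tuple N sX sZ \<Psi>"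
  unfolding arens_extensions_attain_norm_at_same_tuple_def
proof (intro exI[of _ \<phi>] conjI allI impI)
  fix j assume "j < N"
  then show "\<phi> j \<in> bidual_space sX" "bidual_norm sX (\<phi> j) \<le> 1" using X.ball_limit_bidual[OF \<phi>] by auto
next
  fix \<sigma> assume \<sigma>: "\<sigma> permutes {..<N}"
  define ms where "ms = map \<sigma> [0..<N]"
  define B where "B = multilinear_norm N \<Psi>"
  have unit: "norm (\<Psi> x) \<le> B" if "x \<in> unit_tuples N" for x
    unfolding B_def by (rule multilinear_norm_ge[OF \<Psi> that])
  have B: "norm (\<Psi> x) \<le> B * (\<Prod>i<N. norm (x i))" for x
    by (rule mlin_bound[OF \<Psi>(1) unit])
  have "0 \<le> B" using unit[OF unit_tuples_ne] norm_ge_zero order_trans by blast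
  have ms: "distinct ms" "set ms = {..<N}"
    using permutes_inj_on[OF \<sigma>, of "{0..<N}"] permutes_image[OF \<sigma>]
    by (auto simp: ms_def distinct_map atLeast0LessThan)
  have fn: "X.functional (\<phi> i)" if "i \<in> set ms" for i
    using X.ball_limit_functional(1)[OF \<phi>] that ms by simp
  have ar: "arens_extension N sX sZ \<Psi> \<sigma> \<phi> = arens_value \<phi> \<Psi> ms (\<lambda>_. 0)"
    unfolding arens_extension_def ms_def[symmetric]
  proof (rule the_equality)
    show "\<forall>F. (\<forall>j<N. bounded_wstar_net sX (F j) (\<phi> j)) \<longrightarrow>
        has_iterated_wstar_limit sZ \<Psi> F ms (\<lambda>_. 0) (arens_value \<phi> \<Psi> ms (\<lambda>_. 0))"
      by (intro allI impI iterated_limit_arens_value[OF \<Psi>(1) B \<open>0 \<le> B\<close>]) (use ms fn in auto)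
    fix \<zeta>
    assume \<zeta>: "\<forall>F. (\<forall>j<N. bounded_wstar_net sX (F j) (\<phi> j)) \<longrightarrow> has_iterated_wstar_limit sZ \<Psi> F ms (\<lambda>_. 0) \<zeta>"
    \<comment> \<open>Nets must exist for uniqueness: otherwise the condition under
      \<open>THE\<close> would hold vacuously for every value.\<close>
    have "\<exists>F. bounded_wstar_net sX F (\<phi> j)" if "j < N" for j
      using \<phi>[OF that] unfolding X.ball_limit_def bounded_wstar_net_def by blast
    then obtain F where F: "\<And>j. j < N \<Longrightarrow> bounded_wstar_net sX (F j) (\<phi> j)" by metis
    show "\<zeta> = arens_value \<phi> \<Psi> ms (\<lambda>_. 0)"
    proof (rule iterated_limit_unique)
      show "has_iterated_wstar_limit sZ \<Psi> F ms (\<lambda>_. 0) \<zeta>" using \<zeta> F by blast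
      show "has_iterated_wstar_limit sZ \<Psi> F ms (\<lambda>_. 0) (arens_value \<phi> \<Psi> ms (\<lambda>_. 0))"
        by (rule iterated_limit_arens_value[OF \<Psi>(1) B \<open>0 \<le> B\<close>]) (use ms fn F in auto)
      show "F i \<noteq> bot" if "i \<in> set ms" for i using F that ms by (simp add: bounded_wstar_net_def)
    qed
  qed
  have le: "norm (arens_value \<phi> \<Psi> ms (\<lambda>_. 0) f) \<le> B" if f: "f \<in> dual_space sZ" "norm f \<le> 1" for f
  proof -
    have "X.partial_mlin N (norm f * B) ms (ext \<phi> (\<lambda>x. blinfun_apply f (\<Psi> x)) ms)"
      by (rule X.partial_mlin_ext[OF mlin_dual[OF \<Psi>(1) B f(1)]]) (use \<open>0 \<le> B\<close> ms fn in auto)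
    from X.partial_mlinD(4)[OF this, of "\<lambda>_. 0"]
    have "norm (arens_value \<phi> \<Psi> ms (\<lambda>_. 0) f) \<le> norm f * B" using f ms by (simp add: arens_value_def)
    also have "\<dots> \<le> 1 * B" using f \<open>0 \<le> B\<close> by (intro mult_right_mono)
    finally show ?thesis by simp
  qed
  show "bidual_norm sZ (arens_extension N sX sZ \<Psi> \<sigma> \<phi>) = multilinear_norm N \<Psi>"
    unfolding ar bidual_norm_def B_def[symmetric]
  proof (rule antisym)
    show "(SUP f\<in>{f \<in> dual_space sZ. norm f \<le> 1}. norm (arens_value \<phi> \<Psi> ms (\<lambda>_. 0) f)) \<le> B"
      by (rule cSUP_least) (use le g in auto)
    have "B \<le> norm (arens_value \<phi> \<Psi> ms (\<lambda>_. 0) g)" using att[OF \<sigma>] g by (simp add: B_def arens_value_def ms_def)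
    also have "\<dots> \<le> (SUP f\<in>{f \<in> dual_space sZ. norm f \<le> 1}. norm (arens_value \<phi> \<Psi> ms (\<lambda>_. 0) f))"
      using g le by (intro cSUP_upper bdd_aboveI2[where M = B]) auto
    finally show "B \<le> (SUP f\<in>{f \<in> dual_space sZ. norm f \<le> 1}. norm (arens_value \<phi> \<Psi> ms (\<lambda>_. 0) f))" .
  qed
qed

end

subsection \<open>Limits of the discrete measures\<close>

text \<open>Compactness gives a cluster point of the image filter; intersecting \<open>G\<close>
  with the preimages of its neighbourhoods yields convergence. Filters are used since the index set
  is arbitrary, where subsequences need not suffice.\<close>

lemma scalar_cluster_filter:
  fixes f :: "'d \<Rightarrow> 'i \<Rightarrow> 'k::real_or_complex"
  assumes "G \<noteq> bot" "\<forall>\<^sub>F d in G. \<forall>i. norm (f d i) \<le> b i"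
  shows "\<exists>F p. F \<noteq> bot \<and> F \<le> G \<and> (\<forall>i. ((\<lambda>d. f d i) \<longlongrightarrow> p i) F)"
proof -
  let ?U = "{h :: 'i \<Rightarrow> 'k. \<forall>i. norm (h i) \<le> b i}"
  have "filtermap f G \<noteq> bot" using assms(1) by (simp add: filtermap_bot_iff)
  moreover have "eventually (\<lambda>h. h \<in> ?U) (filtermap f G)" using assms(2) by (simp add: eventually_filtermap)
  ultimately obtain p where p: "inf (nhds p) (filtermap f G) \<noteq> bot"
    using compact_scalar_functions[of b] unfolding compact_filter by blast
  define F where "F = inf G (filtercomap f (nhds p))"
  have "F \<noteq> bot"
  proof
    assume "F = bot"
    then have "eventually (\<lambda>_. False) F" by simp
    then obtain P Q where P: "eventually P G" and Q: "eventually Q (filtercomap f (nhds p))"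
      and PQ: "\<And>d. P d \<Longrightarrow> Q d \<Longrightarrow> False" unfolding F_def eventually_inf by blast
    obtain R where R: "eventually R (nhds p)" "\<And>d. R (f d) \<Longrightarrow> Q d" using Q unfolding eventually_filtercomap by blast
    have "eventually (\<lambda>h. \<not> R h) (filtermap f G)"
      unfolding eventually_filtermap using P by (rule eventually_mono) (use PQ R(2) in blast)
    then have "eventually (\<lambda>_. False) (inf (nhds p) (filtermap f G))"
      unfolding eventually_inf using R(1) by blast
    then show False using p by (simp add: eventually_False)
  qed
  moreover have "F \<le> G" by (simp add: F_def)
  moreover have "(f \<longlongrightarrow> p) F"
    by (rule filterlim_mono[OF filterlim_filtercomap order_refl]) (simp add: F_def)
  then have "\<forall>i. ((\<lambda>d. f d i) \<longlongrightarrow> p i) F" unfolding tendsto_fun_iff .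
  ultimately show ?thesis by blast
qed

context normed_space_over
begin

lemma partial_mlin_sum:
  assumes e: "partial_mlin N B is e" and i: "i < N" "i \<notin> set is"
  shows "e (x(i := (\<Sum>j<(m::nat). scale (c j) (z j)))) = (\<Sum>j<m. c j * e (x(i := z j)))"
proof (induction m)
  case 0
  have "e (x(i := scale 0 0)) = 0 * e (x(i := 0))" by (rule partial_mlinD(3)[OF e i])
  then show ?case by (simp del: fun_upd_apply)
next
  case (Suc m)
  then show ?case
    by (simp add: partial_mlinD(2)[OF e i] partial_mlinD(3)[OF e i] del: fun_upd_apply)
qed

text \<open>Points that vary with a parameter through finitely many scalar coefficients. The class
  \<open>\<A>\<close> is left open because two are used: functions continuous on the closed set of
  codes, and \<open>bounded_borel\<close>.\<close>

definition finite_combination :: "(real \<Rightarrow> 'k) set \<Rightarrow> 'x set \<Rightarrow> (real \<Rightarrow> 'x) \<Rightarrow> bool" where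
  "finite_combination \<A> Y \<xi> \<longleftrightarrow> (\<exists>(m::nat) c z. (\<forall>j<m. c j \<in> \<A> \<and> z j \<in> Y) \<and> (\<forall>y. \<xi> y = (\<Sum>j<m. scale (c j y) (z j))))"

lemma finite_combination_const: "(\<lambda>_. 1) \<in> \<A> \<Longrightarrow> z \<in> Y \<Longrightarrow> finite_combination \<A> Y (\<lambda>_. z)"
  unfolding finite_combination_def by (intro exI[of _ "1::nat"] exI[of _ "\<lambda>_ _. 1"] exI[of _ "\<lambda>_. z"]) simp

text \<open>Multilinear expansion, one coordinate at a time: coefficients come out as factors, so
  closure of \<open>\<A>\<close> under sums and products reduces everything to constant tuples from
  \<open>Y\<close>. Consumed coordinates are skipped, as they do not influence the value.\<close>

lemma expand_finite_combinations:
  assumes add: "\<And>f g. f \<in> \<A> \<Longrightarrow> g \<in> \<A> \<Longrightarrow> (\<lambda>y. f y + g y) \<in> \<A>"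
    and mult: "\<And>f g. f \<in> \<A> \<Longrightarrow> g \<in> \<A> \<Longrightarrow> (\<lambda>y. f y * g y) \<in> \<A>"
    and zero: "(\<lambda>_. 0) \<in> \<A>"
    and e: "\<And>y. partial_mlin N (B y) is (e y)"
    and const: "\<And>x. (\<And>i. i < N \<Longrightarrow> x i \<in> Y) \<Longrightarrow> (\<lambda>y. e y x) \<in> \<A>"
    and \<xi>: "\<And>i. i < N \<Longrightarrow> finite_combination \<A> Y (\<lambda>y. \<xi> y i)" and "y0 \<in> Y"
  shows "(\<lambda>y. e y (\<xi> y)) \<in> \<A>"
proof -
  have sum: "(\<lambda>y. \<Sum>j<(m::nat). f j y) \<in> \<A>" if "\<And>j. j < m \<Longrightarrow> f j \<in> \<A>" for f m
    using that by (induction m) (auto intro: zero add)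
  have "(\<lambda>y. e y (\<lambda>i. if i < m then \<xi> y i else x i)) \<in> \<A>" if "m \<le> N" "\<And>i. i < N \<Longrightarrow> x i \<in> Y" for m x
    using that
  proof (induction m arbitrary: x)
    case 0
    then show ?case using const by simp
  next
    case (Suc m)
    let ?f = "\<lambda>x y i. if i < m then \<xi> y i else x i"
    have m: "m < N" using Suc.prems by simp
    have Suc_eq: "(\<lambda>i. if i < Suc m then \<xi> y i else x i) = (?f x y)(m := \<xi> y m)" for y
      by (auto simp: less_Suc_eq)
    show ?case
    proof (cases "m \<in> set is")
      case True
      have "e y (\<lambda>i. if i < Suc m then \<xi> y i else x i) = e y (?f x y)" for y
        by (rule partial_mlinD(1)[OF e]) (use True in \<open>auto simp: less_Suc_eq\<close>)
      then show ?thesis using Suc by simp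
    next
      case False
      obtain k :: nat and c z where c: "\<And>j. j < k \<Longrightarrow> c j \<in> \<A> \<and> z j \<in> Y"
        "\<And>y. \<xi> y m = (\<Sum>j<k. scale (c j y) (z j))"
        using \<xi>[OF m] unfolding finite_combination_def by blast
      have "e y (\<lambda>i. if i < Suc m then \<xi> y i else x i) = (\<Sum>j<k. c j y * e y ((?f x y)(m := z j)))" for y
        unfolding Suc_eq c(2) by (rule partial_mlin_sum[OF e m False])
      moreover have "(?f x y)(m := z j) = ?f (x(m := z j)) y" for y j by auto
      ultimately have eq: "e y (\<lambda>i. if i < Suc m then \<xi> y i else x i) = (\<Sum>j<k. c j y * e y (?f (x(m := z j)) y))" for y
        by simp
      have "(\<lambda>y. e y (?f (x(m := z j)) y)) \<in> \<A>" if "j < k" for j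
        using Suc.prems c(1)[OF that] by (intro Suc.IH) auto
      then show ?thesis unfolding eq using c(1) by (intro sum mult) auto
    qed
  qed
  from this[OF order_refl, of "\<lambda>_. y0"] have "(\<lambda>y. e y (\<lambda>i. if i < N then \<xi> y i else y0)) \<in> \<A>"
    using \<open>y0 \<in> Y\<close> by simp
  moreover have "e y (\<lambda>i. if i < N then \<xi> y i else y0) = e y (\<xi> y)" for y
    by (rule partial_mlinD(1)[OF e]) simp
  ultimately show ?thesis by simp
qed

lemma ball_limit_zero: "ball_limit (\<lambda>_. 0)"
  unfolding ball_limit_def
proof (intro exI[of _ "principal {0}"] conjI)
  show "(canonical_embedding scale \<longlongrightarrow> (\<lambda>_. 0)) (principal {0})"
    unfolding tendsto_fun_iff
    by (auto intro!: tendsto_eventually simp: eventually_principal canonical_embedding_def)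
qed (auto simp: eventually_principal principal_eq_bot_iff)

end

section \<open>The codomain as a dual space\<close>

locale dual_setting = form_space sX sW N
  for sX :: "'k::real_or_complex \<Rightarrow> 'x::real_normed_vector \<Rightarrow> 'x"
    and sW :: "'k \<Rightarrow> 'w::real_normed_vector \<Rightarrow> 'w" and N +
  fixes sZ :: "'k \<Rightarrow> 'z::real_normed_vector \<Rightarrow> 'z" and J :: "'z \<Rightarrow> ('w \<Rightarrow>\<^sub>L 'k)"
  assumes Z_space: "normed_space_over sZ"
    and J_linear: "Vector_Spaces.linear sZ dual_scale J"
    and J_norm: "norm (J z) = norm z"
    and J_range: "range J = dual_space sW"
begin

sublocale XZ: normed_space_pair sX sZ
  by (intro normed_space_pair.intro X.normed_space_over_axioms Z_space)

lemma J_add: "J (a + b) = J a + J b" and J_scale: "J (sZ c a) = dual_scale c (J a)"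
  using J_linear unfolding linear_spaces_iff[OF Z_space normed_space_over_dual_scale] by blast+

lemma J_eq_iff: "J a = J b \<longleftrightarrow> a = b"
proof
  assume "J a = J b"
  moreover have "J a = J (a - b) + J b" using J_add[of "a - b" b] by simp
  ultimately have "norm (a - b) = 0" using J_norm[of "a - b"] by simp
  then show "a = b" by simp
qed simp

lemma J_dual: "J z \<in> dual_space sW" using J_range by blast

lemma norm_J_apply: "norm (J z w) \<le> norm z * norm w"
  using norm_blinfun[of "J z" w] by (simp add: J_norm)

definition form :: "((nat \<Rightarrow> 'x) \<Rightarrow> 'z) \<Rightarrow> (nat \<Rightarrow> 'x) \<times> 'w \<Rightarrow> 'k" where
  "form \<Psi> d = J (\<Psi> (fst d)) (snd d)"

lemma form_forms:
  assumes \<Psi>: "mlin N sX sZ \<Psi>" and B: "\<And>x. norm (\<Psi> x) \<le> B * (\<Prod>i<N. norm (x i))"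
  shows "form \<Psi> \<in> forms B"
  unfolding forms_def mem_Collect_eq
proof (intro conjI allI)
  show "mlin N sX (*) (\<lambda>x. form \<Psi> (x, w))" for w
    unfolding mlin_def
  proof (intro conjI allI impI)
    fix x y :: "nat \<Rightarrow> 'x" assume "\<forall>i<N. x i = y i"
    then have "\<Psi> x = \<Psi> y" by (intro mlin_cong[OF \<Psi>]) auto
    then show "form \<Psi> (x, w) = form \<Psi> (y, w)" by (simp add: form_def)
  qed (simp_all add: form_def mlin_add[OF \<Psi>] mlin_scale[OF \<Psi>] J_add J_scale blinfun.add_left del: fun_upd_apply)
  show "form \<Psi> (x, v + w) = form \<Psi> (x, v) + form \<Psi> (x, w)" for x v w
    by (simp add: form_def blinfun.add_right)
  show "form \<Psi> (x, sW c w) = c * form \<Psi> (x, w)" for x c w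
    by (simp add: form_def W.dual_apply_scale[OF J_dual])
  show "norm (form \<Psi> (x, w)) \<le> B * (\<Prod>i<N. norm (x i)) * norm w" for x w
    unfolding form_def fst_conv snd_conv
    by (rule order_trans[OF norm_J_apply]) (intro mult_right_mono B norm_ge_zero)
qed

text \<open>Every bounded form comes from a map because \<open>J\<close> reaches the whole dual of
  \<open>W\<close>. Here it matters that the codomain is a dual: the perturbation is found among
  forms and has to be realized by a map.\<close>

lemma form_surj:
  assumes \<theta>: "\<theta> \<in> forms B" and "0 \<le> B"
  shows "\<exists>\<Psi>. mlin N sX sZ \<Psi> \<and> form \<Psi> = \<theta> \<and> (\<forall>x. norm (\<Psi> x) \<le> B * (\<Prod>i<N. norm (x i)))"
proof -
  have bl: "bounded_linear (\<lambda>w. \<theta> (x, w))" for x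
  proof (rule bounded_linear_intro)
    show "\<theta> (x, v + w) = \<theta> (x, v) + \<theta> (x, w)" for v w by (rule formsD(2)[OF \<theta>])
    show "\<theta> (x, r *\<^sub>R w) = r *\<^sub>R \<theta> (x, w)" for r w
      using formsD(3)[OF \<theta>, of x "of_real r" w] by (simp add: W.scale_of_real scaleR_conv_of_real)
    show "norm (\<theta> (x, w)) \<le> norm w * (B * (\<Prod>i<N. norm (x i)))" for w
      using formsD(4)[OF \<theta>, of x w] by (simp add: mult_ac)
  qed
  define L where "L x = Blinfun (\<lambda>w. \<theta> (x, w))" for x
  have L_app: "blinfun_apply (L x) w = \<theta> (x, w)" for x w
    by (simp add: L_def bounded_linear_Blinfun_apply[OF bl])
  have "L x \<in> dual_space sW" for x
    by (simp add: dual_space_iff[OF W.normed_space_over_axioms] L_app formsD(3)[OF \<theta>])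
  then have "\<exists>z. J z = L x" for x using J_range by (metis imageE)
  then obtain \<Psi> where \<Psi>: "\<And>x. J (\<Psi> x) = L x" by metis
  have "mlin N sX sZ \<Psi>"
    unfolding mlin_def J_eq_iff[symmetric] J_add J_scale \<Psi>
  proof (intro conjI allI impI blinfun_eqI)
    fix x y :: "nat \<Rightarrow> 'x" and w assume "\<forall>i<N. x i = y i"
    then show "L x w = L y w" unfolding L_app by (intro mlin_cong[OF formsD(1)[OF \<theta>]]) auto
  qed (simp_all add: L_app blinfun.add_left mlin_add[OF formsD(1)[OF \<theta>]] mlin_scale[OF formsD(1)[OF \<theta>]] del: fun_upd_apply)
  moreover have "form \<Psi> = \<theta>" by (auto simp: form_def \<Psi> L_app)
  moreover have "norm (\<Psi> x) \<le> B * (\<Prod>i<N. norm (x i))" for x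
  proof -
    have "norm (L x) \<le> B * (\<Prod>i<N. norm (x i))"
      by (rule norm_blinfun_bound) (auto simp: L_app formsD(4)[OF \<theta>] intro!: mult_nonneg_nonneg prod_nonneg \<open>0 \<le> B\<close>)
    then show ?thesis by (metis J_norm \<Psi>)
  qed
  ultimately show ?thesis by blast
qed

lemma functional_partial_mlin:
  assumes \<Psi>: "mlin N sX sZ \<Psi>" and B: "\<And>x. norm (\<Psi> x) \<le> B * (\<Prod>i<N. norm (x i))" and "0 \<le> B"
    and "g \<in> dual_space sZ" "norm g \<le> 1" "distinct is" "set is \<subseteq> {..<N}" "\<And>i. i \<in> set is \<Longrightarrow> X.functional (\<phi> i)"
  shows "X.partial_mlin N B is (ext \<phi> (\<lambda>x. blinfun_apply g (\<Psi> x)) is)"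
proof (rule X.partial_mlin_ext)
  show "mlin N sX (*) (\<lambda>x. blinfun_apply g (\<Psi> x))" by (rule XZ.mlin_dual(1)[OF \<Psi> B assms(4)])
  fix x
  have "norm (blinfun_apply g (\<Psi> x)) \<le> (norm g * B) * (\<Prod>i<N. norm (x i))" by (rule XZ.mlin_dual(2)[OF \<Psi> B assms(4)])
  also have "\<dots> \<le> (1 * B) * (\<Prod>i<N. norm (x i))" using assms(3,5) by (intro mult_right_mono prod_nonneg) auto
  finally show "norm (blinfun_apply g (\<Psi> x)) \<le> B * (\<Prod>i<N. norm (x i))" by simp
qed (use assms in auto)

text \<open>Coded functions form a vector space, so in each coordinate the property passes from
  \<open>Q\<close> to its span. The inner induction counts the coordinates already released to the
  span.\<close>

lemma coded_form:
  assumes \<Psi>: "mlin N sX sZ \<Psi>"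
    and base: "\<And>x. (\<And>i. i < N \<Longrightarrow> x i \<in> Q) \<Longrightarrow> coded D t (\<lambda>d. J (\<Psi> x) (snd d))"
    and x: "\<And>i. i < N \<Longrightarrow> x i \<in> X.span Q"
  shows "coded D t (\<lambda>d. J (\<Psi> x) (snd d))"
proof -
  have "coded D t (\<lambda>d. J (\<Psi> x) (snd d))"
    if "\<And>i. i < N \<Longrightarrow> i < m \<Longrightarrow> x i \<in> X.span Q" "\<And>i. i < N \<Longrightarrow> m \<le> i \<Longrightarrow> x i \<in> Q" for m x
    using that
  proof (induction m arbitrary: x)
    case 0
    then show ?case by (intro base) auto
  next
    case (Suc m)
    show ?case
    proof (cases "m < N")
      case False
      then show ?thesis using Suc.prems by (intro Suc.IH) auto
    next
      case True
      have "coded D t (\<lambda>d. J (\<Psi> (x(m := a))) (snd d))" if "a \<in> X.span Q" for a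
        using that
      proof (induction rule: X.span_induct)
        case base
        have z: "J (\<Psi> (x(m := 0))) = 0"
          using J_norm[of 0] by (simp add: XZ.mlin_zero[OF \<Psi> True] del: fun_upd_apply)
        have c0: "coded D t (\<lambda>d. (0::'k))" by (auto simp: coded_def intro: exI[of _ 1])
        show ?case
          unfolding X.subspace_def mem_Collect_eq
          by (auto simp only: z mlin_add[OF \<Psi> True] mlin_scale[OF \<Psi> True] J_add J_scale blinfun.add_left
              dual_scale_apply zero_blinfun.rep_eq intro: c0 coded_add coded_mult)
      next
        case (step a)
        show ?case by (rule Suc.IH) (use Suc.prems step True in \<open>auto simp: less_Suc_eq\<close>)
      qed
      from this[OF Suc.prems(1)[OF True]] show ?thesis by simp
    qed
  qed
  from this[of N x] show ?thesis using x by simp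
qed

end

context dual_setting
begin

text \<open>The weak limit of the discrete measures, parametrized by codes. A point \<open>y\<close>
  of \<open>S\<close> stands for a limit of points of \<open>D\<close>: bidual elements
  \<open>\<phi> y i\<close>, and the functional \<open>g y\<close> that sends \<open>z\<close> to
  the limit of \<open>J z\<close> at the predual variable. Countably many functions are coded, the
  \<open>q m\<close> in each coordinate and \<Psi> at tuples from \<open>Q\<close>; density and
  linearity extend the continuity to the whole dual and to the span of \<open>Q\<close>. At
  finite-rank arguments the integrand is a polynomial in such functions, so its averages
  converge.\<close>

lemma limit_data:
  fixes p :: "nat \<Rightarrow> ((nat \<Rightarrow> 'x) \<times> 'w) pmf"
  assumes \<Psi>: "mlin N sX sZ \<Psi>" and B: "\<And>x. norm (\<Psi> x) \<le> B * (\<Prod>i<N. norm (x i))" and "0 \<le> B"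
    and Q: "X.norming Q" and sep: "separable_space (top_of_set X.V)" and p: "\<And>n. set_pmf (p n) \<subseteq> D"
  shows "\<exists>(M::real measure) S \<phi> g s. real_distribution M \<and> closed S \<and> (AE y in M. y \<in> S) \<and>
    (\<forall>y i. X.ball_limit (\<phi> y i)) \<and> (\<forall>y. g y \<in> dual_space sZ \<and> norm (g y) \<le> 1) \<and>
    (\<forall>y i f. y \<notin> S \<longrightarrow> \<phi> y i f = 0) \<and> (\<forall>y. y \<notin> S \<longrightarrow> g y = 0) \<and>
    (\<forall>i<N. \<forall>f\<in>X.V. continuous_on S (\<lambda>y. \<phi> y i f)) \<and>
    (\<forall>x. (\<forall>i<N. x i \<in> X.span Q) \<longrightarrow> continuous_on S (\<lambda>y. blinfun_apply (g y) (\<Psi> x))) \<and>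
    strict_mono s \<and>
    (\<forall>(m::nat \<Rightarrow> nat) b z. (\<forall>i<N. \<forall>j<m i. b i j \<in> X.V \<and> z i j \<in> X.span Q) \<longrightarrow>
      (\<lambda>n. expect (p (s n)) (\<lambda>d. re (J (\<Psi> (\<lambda>i. \<Sum>j<m i. sX (blinfun_apply (b i j) (fst d i)) (z i j))) (snd d))))
        \<longlonglongrightarrow> (\<integral>y. re (blinfun_apply (g y) (\<Psi> (\<lambda>i. \<Sum>j<m i. sX (\<phi> y i (b i j)) (z i j)))) \<partial>M))"
proof -
  obtain q :: "nat \<Rightarrow> _" where q: "range q \<subseteq> X.V" "\<And>f e. f \<in> X.V \<Longrightarrow> 0 < e \<Longrightarrow> \<exists>i. norm (f - q i) < e"
    using X.dense_sequence_exists[OF sep] by blast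
  have Q_ne: "Q \<noteq> {}" using Q X.zero_dual unfolding X.norming_def by (metis all_not_in_conv zero_less_one)
  define U where "U = (\<lambda>f i. if i < N then f i else 0) ` (PiE {..<N} (\<lambda>_. Q))"
  have U_count: "countable U"
    unfolding U_def using Q by (intro countable_image countable_PiE) (auto simp: X.norming_def)
  have U_ne: "U \<noteq> {}" unfolding U_def using Q_ne by (simp add: PiE_eq_empty_iff)
  \<comment> \<open>One sequence for the coding: even indices carry the functionals, with coordinate
    and number paired, odd indices the values of \<Psi> at the countable set \<open>U\<close> of
    tuples.\<close>
  define r where "r c d = (let k = c div 2 in if even c
      then (case prod_decode k of (i, m) \<Rightarrow> if i < N then blinfun_apply (q m) (fst d i) else 0)
      else J (\<Psi> (from_nat_into U k)) (snd d))" for c :: nat and d :: "(nat \<Rightarrow> 'x) \<times> 'w"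
  define bd where "bd c = (let k = c div 2 in if even c then norm (q (snd (prod_decode k))) else norm (\<Psi> (from_nat_into U k)))" for c :: nat
  have apply_le: "norm (blinfun_apply f a) \<le> norm f" if "norm a \<le> 1" for f :: "'x \<Rightarrow>\<^sub>L 'k" and a
    using norm_blinfun[of f a] mult_left_mono[OF that norm_ge_zero[of f]] by simp
  have J_le: "norm (J z w) \<le> norm z" if "norm w \<le> 1" for z w
    using norm_J_apply[of z w] mult_left_mono[OF that norm_ge_zero[of z]] by simp
  have "r c ` D \<subseteq> {k. norm k \<le> bd c}" for c
    by (auto simp: r_def bd_def Let_def D_def unit_tuples_def apply_le J_le split: prod.split)
  from coding_functions[of "\<lambda>c. {k. norm k \<le> bd c}" r D, OF compact_scalar_ball this]
  obtain t where t: "\<And>d. 0 \<le> t d \<and> t d \<le> 3 / 2" and coded: "\<And>c. coded D t (r c)" by blast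
  have coded_q: "coded D t (\<lambda>d. q m (fst d i))" if "i < N" for i m
  proof -
    have "r (2 * prod_encode (i, m)) = (\<lambda>d. q m (fst d i))" using that by (auto simp: r_def fun_eq_iff)
    then show ?thesis using coded[of "2 * prod_encode (i, m)"] by simp
  qed
  have coded_f: "coded D t (\<lambda>d. blinfun_apply f (fst d i))" if i: "i < N" and f: "f \<in> X.V" for i f
  proof (rule coded_uniform_limit)
    fix e :: real assume "0 < e"
    then obtain m where m: "norm (f - q m) < e" using q(2)[OF f] by blast
    have "dist (f (fst d i)) (q m (fst d i)) < e" if "d \<in> D" for d
    proof -
      have "norm ((f - q m) (fst d i)) \<le> norm (f - q m)"
        using that i by (intro apply_le) (auto simp: D_def unit_tuples_def)
      then show ?thesis using m by (simp add: dist_norm blinfun.diff_left)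
    qed
    then show "\<exists>r'. coded D t r' \<and> (\<forall>d\<in>D. dist (blinfun_apply f (fst d i)) (r' d) < e)"
      using coded_q[OF i] by blast
  qed
  have coded_J: "coded D t (\<lambda>d. J (\<Psi> x) (snd d))" if x: "\<And>i. i < N \<Longrightarrow> x i \<in> X.span Q" for x
  proof (rule coded_form[OF \<Psi> _ x])
    fix x :: "nat \<Rightarrow> 'x" assume xQ: "\<And>i. i < N \<Longrightarrow> x i \<in> Q"
    let ?u = "\<lambda>i. if i < N then x i else 0"
    have "restrict x {..<N} \<in> PiE {..<N} (\<lambda>_. Q)" using xQ by auto
    moreover have "?u = (\<lambda>i. if i < N then restrict x {..<N} i else 0)" by auto
    ultimately have "?u \<in> U" unfolding U_def by blast
    then obtain k where k: "from_nat_into U k = ?u" using from_nat_into_surj[OF U_count] by blast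
    have "\<Psi> ?u = \<Psi> x" by (rule mlin_cong[OF \<Psi>]) simp
    then have e: "\<Psi> (from_nat_into U k) = \<Psi> x" using k by simp
    have "r (2 * k + 1) = (\<lambda>d. J (\<Psi> x) (snd d))" by (intro HOL.ext) (simp add: r_def e)
    then show "coded D t (\<lambda>d. J (\<Psi> x) (snd d))" using coded[of "2 * k + 1"] by simp
  qed
  define S where "S = closure (t ` D)"
  \<comment> \<open>The code, all functionals and the predual variable are followed along one
    filter; this lets additivity, homogeneity and bounds pass to the limits \<open>P\<close> and
    \<open>R\<close>.\<close>
  define W where "W y F P R \<longleftrightarrow> F \<noteq> bot \<and> (t \<longlongrightarrow> y) F \<and> (\<forall>\<^sub>F d in F. d \<in> D) \<and>
      (\<forall>i f. ((\<lambda>d. if f \<in> X.V \<and> i < N then blinfun_apply f (fst d i) else 0) \<longlongrightarrow> P i f) F) \<and>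
      (\<forall>z. ((\<lambda>d. J z (snd d)) \<longlongrightarrow> R z) F)" for y F P R
  have "\<exists>F P R. W y F P R" if yS: "y \<in> S" for y
  proof -
    obtain yy where yy: "\<And>n. yy n \<in> t ` D" "yy \<longlonglongrightarrow> y" using yS unfolding S_def closure_sequential by blast
    then have "\<forall>n. \<exists>d. d \<in> D \<and> yy n = t d" by blast
    then obtain dd where dd: "\<And>n. dd n \<in> D" "\<And>n. yy n = t (dd n)" by metis
    define G where "G = filtermap dd sequentially"
    \<comment> \<open>A disjoint sum of index sets puts both kinds of evaluation into one bounded
      family, so that a single cluster filter serves them all.\<close>
    define E :: "_ \<Rightarrow> (nat \<times> ('x \<Rightarrow>\<^sub>L 'k)) + 'z \<Rightarrow> 'k" where
      "E d = case_sum (\<lambda>(i, f). if f \<in> X.V \<and> i < N then blinfun_apply f (fst d i) else 0) (\<lambda>z. J z (snd d))" for d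
    have "norm (E d k) \<le> case_sum (\<lambda>(i, f). norm f) norm k" if "d \<in> D" for d k
      using that by (auto simp: E_def D_def unit_tuples_def apply_le J_le split: sum.split prod.split)
    then have Gev: "\<forall>\<^sub>F d in G. \<forall>k. norm (E d k) \<le> case_sum (\<lambda>(i, f). norm f) norm k"
      unfolding G_def eventually_filtermap using dd(1) by simp
    have Gne: "G \<noteq> bot" by (simp add: G_def filtermap_bot_iff)
    obtain F P where F: "F \<noteq> bot" "F \<le> G" and P: "\<And>k. ((\<lambda>d. E d k) \<longlongrightarrow> P k) F"
      using scalar_cluster_filter[OF Gne Gev] by blast
    have "yy = (\<lambda>n. t (dd n))" using dd(2) by auto
    then have "(t \<longlongrightarrow> y) G" using yy(2) unfolding G_def filterlim_filtermap by simp
    then have "(t \<longlongrightarrow> y) F" using F(2) by (rule tendsto_mono[rotated])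
    moreover have "\<forall>\<^sub>F d in G. d \<in> D" unfolding G_def eventually_filtermap using dd(1) by simp
    then have "\<forall>\<^sub>F d in F. d \<in> D" using F(2) by (simp add: le_filter_def)
    moreover have "((\<lambda>d. if f \<in> X.V \<and> i < N then blinfun_apply f (fst d i) else 0) \<longlongrightarrow> P (Inl (i, f))) F" for i f
      using P[of "Inl (i, f)"] by (simp add: E_def)
    moreover have "((\<lambda>d. J z (snd d)) \<longlongrightarrow> P (Inr z)) F" for z
      using P[of "Inr z"] by (simp add: E_def)
    ultimately have "W y F (\<lambda>i f. P (Inl (i, f))) (\<lambda>z. P (Inr z))"
      unfolding W_def using F(1) by blast
    then show ?thesis by blast
  qed
  then obtain F P R where "\<And>y. y \<in> S \<Longrightarrow> W y (F y) (P y) (R y)" by metis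
  then have F: "\<And>y. y \<in> S \<Longrightarrow> F y \<noteq> bot" "\<And>y. y \<in> S \<Longrightarrow> (t \<longlongrightarrow> y) (F y)"
      "\<And>y. y \<in> S \<Longrightarrow> \<forall>\<^sub>F d in F y. d \<in> D"
    and P: "\<And>y i f. y \<in> S \<Longrightarrow> ((\<lambda>d. if f \<in> X.V \<and> i < N then blinfun_apply f (fst d i) else 0) \<longlongrightarrow> P y i f) (F y)"
    and R: "\<And>y z. y \<in> S \<Longrightarrow> ((\<lambda>d. J z (snd d)) \<longlongrightarrow> R y z) (F y)"
    unfolding W_def by blast+
  define \<phi> where "\<phi> y i f = (if y \<in> S then P y i f else 0)" for y i f
  have ball: "X.ball_limit (\<phi> y i)" for y i
  proof (cases "y \<in> S")
    case False
    then have "\<phi> y i = (\<lambda>_. 0)" by (auto simp: \<phi>_def)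
    then show ?thesis using X.ball_limit_zero by simp
  next
    case True
    show ?thesis
      unfolding X.ball_limit_def
    proof (intro exI[of _ "filtermap (\<lambda>d. if i < N then fst d i else 0) (F y)"] conjI)
      show "filtermap (\<lambda>d. if i < N then fst d i else 0) (F y) \<noteq> bot" using F(1)[OF True] by (simp add: filtermap_bot_iff)
      show "\<forall>\<^sub>F x in filtermap (\<lambda>d. if i < N then fst d i else 0) (F y). norm x \<le> 1"
        unfolding eventually_filtermap using F(3)[OF True]
        by eventually_elim (auto simp: D_def unit_tuples_def)
      show "(canonical_embedding sX \<longlongrightarrow> \<phi> y i) (filtermap (\<lambda>d. if i < N then fst d i else 0) (F y))"
        unfolding filterlim_filtermap tendsto_fun_iff
      proof
        fix f
        have "canonical_embedding sX (if i < N then fst d i else 0) f =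
            (if f \<in> X.V \<and> i < N then blinfun_apply f (fst d i) else 0)" for d :: "(nat \<Rightarrow> 'x) \<times> 'w"
          by (simp add: canonical_embedding_def)
        then show "((\<lambda>d. canonical_embedding sX (if i < N then fst d i else 0) f) \<longlongrightarrow> \<phi> y i f) (F y)"
          using P[OF True, of f i] True by (simp add: \<phi>_def)
      qed
    qed
  qed
  define g where "g y = (if y \<in> S then Blinfun (R y) else 0)" for y
  have R_props: "R y (z + z') = R y z + R y z'" "R y (sZ c z) = c * R y z" "norm (R y z) \<le> norm z" if y: "y \<in> S" for y z z' c
  proof -
    show "R y (z + z') = R y z + R y z'"
      by (rule tendsto_unique[OF F(1)[OF y] R[OF y]])
         (use tendsto_add[OF R[OF y, of z] R[OF y, of z']] in \<open>simp add: J_add blinfun.add_left\<close>)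
    show "R y (sZ c z) = c * R y z"
      by (rule tendsto_unique[OF F(1)[OF y] R[OF y]])
         (use tendsto_mult_left[OF R[OF y, of z], of c] in \<open>simp add: J_scale\<close>)
    show "norm (R y z) \<le> norm z"
    proof (rule tendsto_upperbound[OF tendsto_norm[OF R[OF y]] _ F(1)[OF y]])
      show "\<forall>\<^sub>F d in F y. norm (J z (snd d)) \<le> norm z"
        using F(3)[OF y] by eventually_elim (auto simp: D_def intro: J_le)
    qed
  qed
  have g_app: "blinfun_apply (g y) z = R y z" if y: "y \<in> S" for y z
  proof -
    have "bounded_linear (R y)"
      by (rule bounded_linear_intro[where K = 1])
         (use R_props[OF y] R_props(2)[OF y, of "of_real _"] in \<open>auto simp: XZ.Z.scale_of_real scaleR_conv_of_real\<close>)
    then show ?thesis using y by (simp add: g_def bounded_linear_Blinfun_apply)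
  qed
  have g: "g y \<in> dual_space sZ" "norm (g y) \<le> 1" for y
  proof -
    show "g y \<in> dual_space sZ"
      by (cases "y \<in> S") (auto simp: dual_space_iff[OF Z_space] g_app R_props, simp add: g_def)
    show "norm (g y) \<le> 1"
    proof (cases "y \<in> S")
      case True
      then show ?thesis by (intro norm_blinfun_bound) (auto simp: g_app R_props)
    qed (simp add: g_def)
  qed
  have \<phi>_ext: "continuous_on S (\<lambda>y. \<phi> y i f)" "\<And>d. d \<in> D \<Longrightarrow> t d \<in> S \<Longrightarrow> \<phi> (t d) i f = f (fst d i)"
    if i: "i < N" and f: "f \<in> X.V" for i f
  proof -
    have lim: "((\<lambda>d. blinfun_apply f (fst d i)) \<longlongrightarrow> \<phi> y i f) (F y)" if "y \<in> S" for y
      using P[OF that, of f i] that i f by (simp add: \<phi>_def)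
    show "continuous_on S (\<lambda>y. \<phi> y i f)"
      by (rule coded_extension(1)[OF coded_f[OF i f], where F = F]) (use F lim in auto)
    show "\<phi> (t d) i f = f (fst d i)" if "d \<in> D" "t d \<in> S" for d
      by (rule coded_extension(2)[OF coded_f[OF i f], where F = F and S = S and R = "\<lambda>y. \<phi> y i f"]) (use F lim that in auto)
  qed
  have g_ext: "continuous_on S (\<lambda>y. g y (\<Psi> x))" "\<And>d. d \<in> D \<Longrightarrow> t d \<in> S \<Longrightarrow> g (t d) (\<Psi> x) = J (\<Psi> x) (snd d)"
    if x: "\<And>i. i < N \<Longrightarrow> x i \<in> X.span Q" for x
  proof -
    have lim: "((\<lambda>d. J (\<Psi> x) (snd d)) \<longlongrightarrow> g y (\<Psi> x)) (F y)" if "y \<in> S" for y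
      using R[OF that] that by (simp add: g_app)
    show "continuous_on S (\<lambda>y. g y (\<Psi> x))"
      by (rule coded_extension(1)[OF coded_J[OF x], where F = F]) (use F lim in auto)
    show "g (t d) (\<Psi> x) = J (\<Psi> x) (snd d)" if "d \<in> D" "t d \<in> S" for d
      by (rule coded_extension(2)[OF coded_J[OF x], where F = F and S = S and R = "\<lambda>y. g y (\<Psi> x)"]) (use F lim that in auto)
  qed
  obtain M s where s: "strict_mono s" and M: "real_distribution M" and AE_S: "AE y in M. y \<in> S"
    and conv: "\<And>f::real \<Rightarrow> real. continuous_on S f \<Longrightarrow>
      (\<lambda>n. expect (p (s n)) (\<lambda>d. f (t d))) \<longlonglongrightarrow> (\<integral>y. (if y \<in> S then f y else 0) \<partial>M)"
    using limit_measure[of t p D] t p unfolding S_def[symmetric] by blast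
  have tS: "t d \<in> S" if "d \<in> D" for d
    unfolding S_def using that closure_subset by fastforce
  have limit: "(\<lambda>n. expect (p (s n)) (\<lambda>d. re (J (\<Psi> (\<lambda>i. \<Sum>j<m i. sX (blinfun_apply (b i j) (fst d i)) (z i j))) (snd d))))
        \<longlonglongrightarrow> (\<integral>y. re (blinfun_apply (g y) (\<Psi> (\<lambda>i. \<Sum>j<m i. sX (\<phi> y i (b i j)) (z i j)))) \<partial>M)"
    if bz: "\<And>i j. i < N \<Longrightarrow> j < m i \<Longrightarrow> b i j \<in> X.V \<and> z i j \<in> X.span Q" for m :: "nat \<Rightarrow> nat" and b z
  proof -
    \<comment> \<open>The images of the \<open>\<phi> y i\<close> under the second adjoints of the
      finite-rank operators; they are points of the span of \<open>Q\<close> with coefficients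
      continuous on \<open>S\<close>.\<close>
    define \<xi> where "\<xi> y i = (\<Sum>j<m i. sX (\<phi> y i (b i j)) (z i j))" for y i
    define H where "H y = re (blinfun_apply (g y) (\<Psi> (\<xi> y)))" for y
    have "(\<lambda>y. blinfun_apply (g y) (\<Psi> (\<xi> y))) \<in> {f. continuous_on S f}"
    proof (rule X.expand_finite_combinations[where Y = "X.span Q" and B = "\<lambda>_. B" and N = N and ?y0.0 = 0
        and e = "\<lambda>y x. blinfun_apply (g y) (\<Psi> x)" and \<xi> = \<xi>])
      show "X.partial_mlin N B [] (\<lambda>x. blinfun_apply (g y) (\<Psi> x))" for y
        using functional_partial_mlin[OF \<Psi> B \<open>0 \<le> B\<close> g(1)[of y] g(2)[of y], of "[]"] by (simp add: ext.simps(1)[abs_def])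
      show "X.finite_combination {f. continuous_on S f} (X.span Q) (\<lambda>y. \<xi> y i)" if "i < N" for i
        unfolding X.finite_combination_def \<xi>_def using bz[OF that] \<phi>_ext(1)[OF that]
        by (intro exI[of _ "m i"] exI[of _ "\<lambda>j y. \<phi> y i (b i j)"] exI[of _ "z i"]) auto
    qed (use g_ext(1) X.span_zero in \<open>auto intro: continuous_intros\<close>)
    then have "continuous_on S H" unfolding H_def by (intro continuous_on_re) simp
    from conv[OF this] have c: "(\<lambda>n. expect (p (s n)) (\<lambda>d. H (t d))) \<longlonglongrightarrow> (\<integral>y. (if y \<in> S then H y else 0) \<partial>M)" .
    have "H (t d) = re (J (\<Psi> (\<lambda>i. \<Sum>j<m i. sX (blinfun_apply (b i j) (fst d i)) (z i j))) (snd d))" if d: "d \<in> D" for d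
    proof -
      have "\<xi> (t d) i \<in> X.span Q" if "i < N" for i
        unfolding \<xi>_def using bz[OF that] by (intro X.span_sum X.span_scale) auto
      then have "H (t d) = re (J (\<Psi> (\<xi> (t d))) (snd d))"
        unfolding H_def using g_ext(2)[of "\<xi> (t d)", OF _ d tS[OF d]] by simp
      also have "\<Psi> (\<xi> (t d)) = \<Psi> (\<lambda>i. \<Sum>j<m i. sX (blinfun_apply (b i j) (fst d i)) (z i j))"
      proof (rule mlin_cong[OF \<Psi>])
        fix i assume i: "i < N"
        show "\<xi> (t d) i = (\<Sum>j<m i. sX (blinfun_apply (b i j) (fst d i)) (z i j))"
          unfolding \<xi>_def by (rule sum.cong) (use bz[OF i] \<phi>_ext(2)[OF i _ d tS[OF d]] in auto)
      qed
      finally show ?thesis .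
    qed
    then have "expect (p (s n)) (\<lambda>d. H (t d)) =
        expect (p (s n)) (\<lambda>d. re (J (\<Psi> (\<lambda>i. \<Sum>j<m i. sX (blinfun_apply (b i j) (fst d i)) (z i j))) (snd d)))" for n
      using p by (intro expect_cong) blast
    moreover have "(if y \<in> S then H y else 0) = H y" for y by (simp add: H_def g_def)
    ultimately show ?thesis using c by (simp add: H_def \<xi>_def[abs_def])
  qed
  have S_closed: "closed S" by (simp add: S_def)
  have off: "\<phi> y i f = 0" "g y = 0" if "y \<notin> S" for y i f using that by (simp_all add: \<phi>_def g_def)
  show ?thesis
    by (intro exI[of _ M] exI[of _ S] exI[of _ \<phi>] exI[of _ g] exI[of _ s] conjI allI ballI impI;
        (rule M S_closed AE_S ball g(1) g(2) s | (rule off; assumption) | (rule \<phi>_ext(1); assumption) |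
          (rule g_ext(1); blast) | (rule limit; blast)))
qed

end

subsection \<open>Measurability of iterated limits\<close>

text \<open>Measurability is tested after embedding into the complex numbers, so that sums, products
  and limits of Borel functions are covered for the abstract scalar field.\<close>

definition bounded_borel :: "(real \<Rightarrow> 'k::real_or_complex) set" where
  "bounded_borel = {f. (\<lambda>y. emb (f y)) \<in> borel_measurable borel \<and> (\<exists>K. \<forall>y. norm (f y) \<le> K)}"

lemma bounded_borelI: "(\<lambda>y. emb (f y)) \<in> borel_measurable borel \<Longrightarrow> (\<And>y. norm (f y) \<le> K) \<Longrightarrow> f \<in> bounded_borel"
  by (auto simp: bounded_borel_def)

lemma bounded_borel_const: "(\<lambda>_. c) \<in> bounded_borel" by (auto simp: bounded_borel_def)

lemma bounded_borel_add:
  assumes "f \<in> bounded_borel" "g \<in> bounded_borel" shows "(\<lambda>y. f y + g y) \<in> bounded_borel"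
proof -
  obtain K L where "\<And>y. norm (f y) \<le> K" "\<And>y. norm (g y) \<le> L" using assms by (auto simp: bounded_borel_def)
  then have "norm (f y + g y) \<le> K + L" for y by (rule norm_triangle_mono)
  moreover have "(\<lambda>y. emb (f y + g y)) \<in> borel_measurable borel"
    unfolding emb_add using assms by (intro borel_measurable_add) (auto simp: bounded_borel_def)
  ultimately show ?thesis by (rule bounded_borelI[rotated])
qed

lemma bounded_borel_mult:
  assumes "f \<in> bounded_borel" "g \<in> bounded_borel" shows "(\<lambda>y. f y * g y) \<in> bounded_borel"
proof -
  obtain K L where KL: "\<And>y. norm (f y) \<le> K" "\<And>y. norm (g y) \<le> L" using assms by (auto simp: bounded_borel_def)
  have "norm (f y * g y) \<le> K * L" for y
    unfolding norm_mult using KL order_trans[OF norm_ge_zero KL(1)] by (intro mult_mono) auto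
  moreover have "(\<lambda>y. emb (f y * g y)) \<in> borel_measurable borel"
    unfolding emb_mult using assms by (intro borel_measurable_times) (auto simp: bounded_borel_def)
  ultimately show ?thesis by (rule bounded_borelI[rotated])
qed

lemma bounded_borel_integrable:
  assumes "real_distribution M" "f \<in> bounded_borel"
  shows "integrable M (\<lambda>y. re (f y))"
proof -
  interpret M: real_distribution M by (rule assms(1))
  obtain K where K: "\<And>y. norm (f y) \<le> K" using assms by (auto simp: bounded_borel_def)
  have "(\<lambda>y. re (f y)) \<in> borel_measurable borel"
    unfolding re_def using assms(2)
    by (intro borel_measurable_continuous_on[of Re]) (auto simp: bounded_borel_def intro: continuous_intros)
  then show ?thesis
    using K abs_re_le order_trans
    by (intro M.integrable_const_bound[of _ K] M.measurable_finite_borel AE_I2) (auto, blast)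
qed

lemma bounded_borel_continuous:
  fixes f :: "real \<Rightarrow> 'k::real_or_complex"
  assumes "closed S" "continuous_on S f" "\<And>y. y \<notin> S \<Longrightarrow> f y = 0" "\<And>y. norm (f y) \<le> K"
  shows "f \<in> bounded_borel"
proof (rule bounded_borelI[OF _ assms(4)])
  have "continuous_on S (\<lambda>y. emb (f y))"
    by (rule bounded_linear.continuous_on[OF bounded_linear_emb assms(2)])
  then have "(\<lambda>y. indicator S y *\<^sub>R emb (f y)) \<in> borel_measurable borel"
    using assms(1) by (intro borel_measurable_continuous_on_indicator) auto
  moreover have "emb (0::'k) = 0" by (metis norm_emb norm_eq_zero)
  then have "indicator S y *\<^sub>R emb (f y) = emb (f y)" for y
    using assms(3)[of y] by (cases "y \<in> S") auto
  ultimately show "(\<lambda>y. emb (f y)) \<in> borel_measurable borel" by simp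
qed

context normed_space_over
begin

text \<open>The norm of \<open>F y - v\<close> is a supremum over the countable set
  \<open>Q\<close>, so measurability of the evaluations at \<open>Q\<close> gives measurable
  preimages of closed norm balls.\<close>

lemma strongly_measurable:
  assumes Q: "norming Q" and F: "\<And>y. F y \<in> V" and meas: "\<And>a. a \<in> Q \<Longrightarrow> (\<lambda>y. blinfun_apply (F y) a) \<in> bounded_borel"
    and v: "v \<in> V"
  shows "{y. norm (F y - v) \<le> r} \<in> sets borel"
proof -
  have eq: "{y. norm (F y - v) \<le> r} = (\<Inter>a\<in>Q. {y. norm (emb (F y a) - emb (v a)) \<le> r})"
    using norming_le_iff[OF Q dual_diff[OF F v]] by (auto simp: blinfun.diff_left simp flip: emb_diff)
  have "{y \<in> space borel. norm (emb (F y a) - emb (v a)) \<le> r} \<in> sets borel" if "a \<in> Q" for a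
    using meas[OF that] by (intro borel_measurable_le borel_measurable_norm borel_measurable_diff) (auto simp: bounded_borel_def)
  then show ?thesis
    unfolding eq using Q by (intro sets.countable_INT'') (auto simp: norming_def)
qed

text \<open>Functional and argument both depend on \<open>y\<close>. Replacing \<open>F y\<close> by
  the first member of a dense sequence within \<open>(1/2)^l\<close> leaves a countable case
  distinction between measurable functions, and the norm bound on \<open>\<phi> y\<close> justifies
  the limit over \<open>l\<close>.\<close>

lemma functional_measurable:
  assumes Q: "norming Q" and sep: "separable_space (top_of_set V)"
    and F: "\<And>y. F y \<in> V" "\<And>y. norm (F y) \<le> K" and meas: "\<And>a. a \<in> Q \<Longrightarrow> (\<lambda>y. blinfun_apply (F y) a) \<in> bounded_borel"
    and \<phi>: "\<And>y. functional (\<phi> y)" "\<And>f. f \<in> V \<Longrightarrow> (\<lambda>y. \<phi> y f) \<in> bounded_borel"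
  shows "(\<lambda>y. \<phi> y (F y)) \<in> bounded_borel"
proof (rule bounded_borelI)
  show "norm (\<phi> y (F y)) \<le> K" for y using functional_norm[OF \<phi>(1) F(1)] F(2) order_trans by blast
  obtain q :: "nat \<Rightarrow> _" where q: "range q \<subseteq> V" "\<And>f e. f \<in> V \<Longrightarrow> 0 < e \<Longrightarrow> \<exists>i. norm (f - q i) < e"
    using dense_sequence_exists[OF sep] by blast
  define Nl where "Nl l y = (LEAST i. norm (F y - q i) \<le> (1/2)^l)" for l :: nat and y
  have Nl_meas: "Nl l \<in> measurable borel (count_space UNIV)" for l
  proof -
    have "Measurable.pred borel (\<lambda>y. norm (F y - q i) \<le> (1/2)^l)" for i
      unfolding pred_def using strongly_measurable[OF Q F(1) meas, of "q i"] q(1) by auto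
    then show ?thesis unfolding Nl_def by (rule measurable_Least)
  qed
  have Nl: "norm (F y - q (Nl l y)) \<le> (1/2)^l" for l y
  proof -
    obtain i where "norm (F y - q i) < (1/2)^l" using q(2)[OF F(1), of "(1/2)^l"] by fastforce
    then show ?thesis unfolding Nl_def by (intro LeastI[of "\<lambda>i. norm (F y - q i) \<le> (1/2)^l" i]) simp
  qed
  show "(\<lambda>y. emb (\<phi> y (F y))) \<in> borel_measurable borel"
  proof (rule borel_measurable_LIMSEQ_metric)
    fix l
    have "(\<lambda>y. emb (\<phi> y (q i))) \<in> borel_measurable borel" for i
      using \<phi>(2)[of "q i"] q(1) by (auto simp: bounded_borel_def)
    then show "(\<lambda>y. emb (\<phi> y (q (Nl l y)))) \<in> borel_measurable borel"
      using measurable_compose_countable[OF _ Nl_meas, of "\<lambda>i y. emb (\<phi> y (q i))"] by simp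
  next
    fix y
    have "(\<lambda>l. \<phi> y (q (Nl l y)) - \<phi> y (F y)) \<longlonglongrightarrow> 0"
    proof (rule Lim_null_comparison[where g = "\<lambda>l. (1/2)^l"])
      have "norm (\<phi> y (q (Nl l y)) - \<phi> y (F y)) \<le> (1/2)^l" for l
      proof -
        have qV: "q (Nl l y) \<in> V" using q(1) by auto
        show ?thesis
          using functional_norm[OF \<phi>(1)[of y] dual_diff[OF qV F(1)[of y]]] functional_diff[OF \<phi>(1)[of y] qV F(1)[of y]] Nl[of y l]
          by (simp add: norm_minus_commute)
      qed
      then show "\<forall>\<^sub>F l in sequentially. norm (\<phi> y (q (Nl l y)) - \<phi> y (F y)) \<le> (1/2)^l" by simp
    qed (rule LIMSEQ_realpow_zero; simp)
    then have "(\<lambda>l. \<phi> y (q (Nl l y))) \<longlonglongrightarrow> \<phi> y (F y)" by (rule LIM_zero_cancel)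
    then show "(\<lambda>l. emb (\<phi> y (q (Nl l y)))) \<longlonglongrightarrow> emb (\<phi> y (F y))" by (simp add: tendsto_emb_iff)
  qed
qed

lemma finite_combination_bounded:
  assumes "finite_combination bounded_borel Y \<xi>" shows "\<exists>K\<ge>0. \<forall>y. norm (\<xi> y) \<le> K"
proof -
  obtain m :: nat and c z where c: "\<And>j. j < m \<Longrightarrow> c j \<in> bounded_borel" "\<And>y. \<xi> y = (\<Sum>j<m. scale (c j y) (z j))"
    using assms unfolding finite_combination_def by blast
  have "\<exists>K. \<forall>y. norm (c j y) \<le> K" if "j < m" for j using c(1)[OF that] by (auto simp: bounded_borel_def)
  then obtain K where K: "\<And>j y. j < m \<Longrightarrow> norm (c j y) \<le> K j" by metis
  have "norm (\<xi> y) \<le> (\<Sum>j<m. K j * norm (z j))" for y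
    unfolding c(2) by (rule sum_norm_le) (auto simp: norm_scale intro!: mult_right_mono K)
  then have "norm (\<xi> y) \<le> \<bar>\<Sum>j<m. K j * norm (z j)\<bar>" for y by (meson abs_ge_self order_trans)
  then show ?thesis by (meson abs_ge_zero)
qed

lemma compose_difference:
  "\<exists>S :: ('x \<Rightarrow>\<^sub>L 'k) \<Rightarrow>\<^sub>L ('x \<Rightarrow>\<^sub>L 'k). \<forall>f. blinfun_apply S f = (f o\<^sub>L T) - f"
proof -
  have "bounded_linear (\<lambda>f :: 'x \<Rightarrow>\<^sub>L 'k. (f o\<^sub>L T) - f)"
    by (intro bounded_linear_sub bounded_linear_ident bounded_bilinear.bounded_linear_left[OF bounded_bilinear_blinfun_compose])
  from bounded_linear_Blinfun_apply[OF this] show ?thesis by (intro exI allI) (rule fun_cong)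
qed

text \<open>One operator serves two integrals: the approximation property is applied to the union of
  the two dominating compact sets, with \<eta> divided by the sum of the two constants as
  tolerance.\<close>

lemma simultaneous_approximation:
  assumes Q: "norming Q" and sep: "separable_space (top_of_set V)" and AP: "approximation_property dual_scale V"
    and M: "finite_measure M" "\<And>y. y \<in> space M \<Longrightarrow> F y \<in> V" "\<And>y. y \<in> space M \<Longrightarrow> norm (F y) \<le> B"
      "\<And>v r. v \<in> V \<Longrightarrow> {y\<in>space M. norm (F y - v) \<le> r} \<in> sets M"
    and M': "finite_measure M'" "\<And>y. y \<in> space M' \<Longrightarrow> F' y \<in> V" "\<And>y. y \<in> space M' \<Longrightarrow> norm (F' y) \<le> B'"
      "\<And>v r. v \<in> V \<Longrightarrow> {y\<in>space M'. norm (F' y - v) \<le> r} \<in> sets M'"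
    and "0 < \<eta>"
  shows "\<exists>(m::nat) b z. (\<forall>j<m. b j \<in> V \<and> z j \<in> span Q) \<and>
    (\<integral>\<^sup>+y. ennreal (norm ((\<Sum>j<m. dual_scale (blinfun_apply (F y) (z j)) (b j)) - F y)) \<partial>M) \<le> ennreal \<eta> \<and>
    (\<integral>\<^sup>+y. ennreal (norm ((\<Sum>j<m. dual_scale (blinfun_apply (F' y) (z j)) (b j)) - F' y)) \<partial>M') \<le> ennreal \<eta>"
proof -
  obtain L C where L: "compact L" "L \<subseteq> V" "0 < C"
    and dom: "\<And>(S :: ('x \<Rightarrow>\<^sub>L 'k) \<Rightarrow>\<^sub>L ('x \<Rightarrow>\<^sub>L 'k)) e. 0 \<le> e \<Longrightarrow> (\<forall>f\<in>L. norm (S f) \<le> e) \<Longrightarrow>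
      (\<integral>\<^sup>+y. ennreal (norm (S (F y))) \<partial>M) \<le> ennreal (C * e)"
    using compact_domination[of M F B, OF M(1) sep M(2-4)] by blast
  obtain L' C' where L': "compact L'" "L' \<subseteq> V" "0 < C'"
    and dom': "\<And>(S :: ('x \<Rightarrow>\<^sub>L 'k) \<Rightarrow>\<^sub>L ('x \<Rightarrow>\<^sub>L 'k)) e. 0 \<le> e \<Longrightarrow> (\<forall>f\<in>L'. norm (S f) \<le> e) \<Longrightarrow>
      (\<integral>\<^sup>+y. ennreal (norm (S (F' y))) \<partial>M') \<le> ennreal (C' * e)"
    using compact_domination[of M' F' B', OF M'(1) sep M'(2-4)] by blast
  define e where "e = \<eta> / (C + C')"
  have e: "0 < e" "C * e \<le> \<eta>" "C' * e \<le> \<eta>"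
    using L(3) L'(3) \<open>0 < \<eta>\<close> by (auto simp: e_def divide_simps mult_ac)
  have "compact (L \<union> L')" "L \<union> L' \<subseteq> V" using L L' by auto
  from finite_rank_approximation[OF Q AP this e(1)]
  obtain T where T: "finite_rank (span Q) T" "\<And>f. f \<in> L \<union> L' \<Longrightarrow> norm ((f o\<^sub>L T) - f) \<le> e" by blast
  obtain m :: nat and b z where mbz: "\<And>j. j < m \<Longrightarrow> b j \<in> V \<and> z j \<in> span Q"
    "\<And>x. blinfun_apply T x = (\<Sum>j<m. scale (blinfun_apply (b j) x) (z j))"
    using T(1) unfolding finite_rank_def by blast
  obtain S :: "('x \<Rightarrow>\<^sub>L 'k) \<Rightarrow>\<^sub>L ('x \<Rightarrow>\<^sub>L 'k)" where S: "\<And>f. blinfun_apply S f = (f o\<^sub>L T) - f"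
    using compose_difference by blast
  have S_V: "S f = (\<Sum>j<m. dual_scale (blinfun_apply f (z j)) (b j)) - f" if "f \<in> V" for f
    unfolding S dual_compose_finite_rank[OF that mbz(2)] ..
  have "(\<integral>\<^sup>+y. ennreal (norm ((\<Sum>j<m. dual_scale (blinfun_apply (F y) (z j)) (b j)) - F y)) \<partial>M) =
      (\<integral>\<^sup>+y. ennreal (norm (S (F y))) \<partial>M)"
    by (rule nn_integral_cong) (simp add: S_V M(2))
  also have "\<dots> \<le> ennreal (C * e)" using e(1) T(2) by (intro dom) (auto simp: S)
  also have "\<dots> \<le> ennreal \<eta>" by (rule ennreal_leI[OF e(2)])
  finally have 1: "(\<integral>\<^sup>+y. ennreal (norm ((\<Sum>j<m. dual_scale (blinfun_apply (F y) (z j)) (b j)) - F y)) \<partial>M) \<le> ennreal \<eta>" .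
  have "(\<integral>\<^sup>+y. ennreal (norm ((\<Sum>j<m. dual_scale (blinfun_apply (F' y) (z j)) (b j)) - F' y)) \<partial>M') =
      (\<integral>\<^sup>+y. ennreal (norm (S (F' y))) \<partial>M')"
    by (rule nn_integral_cong) (simp add: S_V M'(2))
  also have "\<dots> \<le> ennreal (C' * e)" using e(1) T(2) by (intro dom') (auto simp: S)
  also have "\<dots> \<le> ennreal \<eta>" by (rule ennreal_leI[OF e(3)])
  finally have 2: "(\<integral>\<^sup>+y. ennreal (norm ((\<Sum>j<m. dual_scale (blinfun_apply (F' y) (z j)) (b j)) - F' y)) \<partial>M') \<le> ennreal \<eta>" .
  show ?thesis using mbz(1) 1 2 by blast
qed

end

context dual_setting
begin

text \<open>Induction from the innermost limit outwards. The slice has to be measured only at points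
  of \<open>Q\<close>, so all tuples stay in the span of \<open>Q\<close>, where \<open>g y\<close>
  is measurable; \<open>functional_measurable\<close> then applies one more functional.\<close>

lemma ext_measurable:
  assumes \<Psi>: "mlin N sX sZ \<Psi>" and B: "\<And>x. norm (\<Psi> x) \<le> B * (\<Prod>i<N. norm (x i))" "0 \<le> B"
    and Q: "X.norming Q" and sep: "separable_space (top_of_set X.V)"
    and g: "\<And>y. g y \<in> dual_space sZ" "\<And>y. norm (g y) \<le> 1"
      "\<And>x. (\<And>i. i < N \<Longrightarrow> x i \<in> X.span Q) \<Longrightarrow> (\<lambda>y. blinfun_apply (g y) (\<Psi> x)) \<in> bounded_borel"
    and \<phi>: "\<And>y i. X.functional (\<phi> y i)" "\<And>i f. i < N \<Longrightarrow> f \<in> X.V \<Longrightarrow> (\<lambda>y. \<phi> y i f) \<in> bounded_borel"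
    and "distinct is" "set is \<subseteq> {..<N}" "\<And>i. i < N \<Longrightarrow> x i \<in> X.span Q"
  shows "(\<lambda>y. ext (\<phi> y) (\<lambda>x. blinfun_apply (g y) (\<Psi> x)) is x) \<in> bounded_borel"
  using assms(11-)
proof (induction "is" arbitrary: x)
  case Nil
  then show ?case using g(3) by simp
next
  case (Cons i "is")
  then have i: "i < N" "i \<notin> set is" by auto
  let ?e = "\<lambda>y. ext (\<phi> y) (\<lambda>x. blinfun_apply (g y) (\<Psi> x)) is"
  have e: "X.partial_mlin N B is (?e y)" for y
    by (rule functional_partial_mlin[OF \<Psi> B g(1,2)]) (use Cons.prems \<phi>(1) in auto)
  note sl = X.partial_mlin_slice[OF e i]
  show ?case
    unfolding ext.simps
  proof (rule X.functional_measurable[OF Q sep sl(2) sl(3) _ \<phi>(1) \<phi>(2)[OF i(1)]])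
    fix a assume a: "a \<in> Q"
    have "(\<lambda>y. ?e y (x(i := a))) \<in> bounded_borel"
      by (rule Cons.IH) (use Cons.prems a X.span_base in auto)
    then show "(\<lambda>y. blinfun_apply (Blinfun (\<lambda>a. ?e y (x(i := a)))) a) \<in> bounded_borel" by (simp only: sl(1))
  qed
qed

end

subsection \<open>Finite-rank approximation of iterated limits\<close>

context dual_setting
begin

lemma form_bounded:
  assumes B: "\<And>x. norm (\<Psi> x) \<le> B * (\<Prod>i<N. norm (x i))" "0 \<le> B"
    and \<zeta>: "\<And>j. j < N \<Longrightarrow> norm (x j) \<le> K" and w: "norm w \<le> 1"
  shows "\<bar>re (J (\<Psi> x) w)\<bar> \<le> B * K ^ N"
proof -
  have "\<bar>re (J (\<Psi> x) w)\<bar> \<le> norm (\<Psi> x) * norm w" using abs_re_le norm_J_apply order_trans by blast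
  also have "\<dots> \<le> norm (\<Psi> x) * 1" using w by (intro mult_left_mono) auto
  also have "\<dots> \<le> B * (\<Prod>i<N. norm (x i))" using B(1)[of x] by simp
  also have "\<dots> \<le> B * (\<Prod>i<N. K)" using \<zeta> B(2) by (intro mult_left_mono prod_mono) auto
  finally show ?thesis by simp
qed

text \<open>The outermost limit is peeled off. It is \<open>\<phi> y i\<close> applied to the slice
  \<open>F y\<close>; applying it to \<open>F y\<close> composed with a finite-rank operator amounts
  to inserting a point with coefficients \<open>\<phi> y i (b0 j)\<close> into coordinate
  \<open>i\<close>. The error is the mean of the norm of the difference of the two functionals. For
  the discrete measure the same operator acts on \<open>fst d i\<close>. As the inserted points are
  finite combinations, the induction runs over variable \<xi> and \<zeta>, and each coordinate gets
  its own operator, chosen after those of the outer limits.\<close>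

lemma iterated_limit_approximation:
  assumes \<Psi>: "mlin N sX sZ \<Psi>" and B: "\<And>x. norm (\<Psi> x) \<le> B * (\<Prod>i<N. norm (x i))" "0 \<le> B"
    and Q: "X.norming Q" and sep: "separable_space (top_of_set X.V)"
    and AP: "approximation_property dual_scale X.V"
    and M: "real_distribution M" and q: "set_pmf q \<subseteq> D"
    and g: "\<And>y. g y \<in> dual_space sZ" "\<And>y. norm (g y) \<le> 1"
      "\<And>x. (\<And>i. i < N \<Longrightarrow> x i \<in> X.span Q) \<Longrightarrow> (\<lambda>y. blinfun_apply (g y) (\<Psi> x)) \<in> bounded_borel"
    and \<phi>: "\<And>y i. X.functional (\<phi> y i)" "\<And>i f. i < N \<Longrightarrow> f \<in> X.V \<Longrightarrow> (\<lambda>y. \<phi> y i f) \<in> bounded_borel"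
    and "distinct is" "set is \<subseteq> {..<N}" and \<xi>: "\<And>i. i < N \<Longrightarrow> X.finite_combination bounded_borel (X.span Q) (\<lambda>y. \<xi> y i)"
    and \<zeta>: "\<And>d j. d \<in> D \<Longrightarrow> j \<in> set is \<Longrightarrow> \<zeta> d j = fst d j" "\<And>d j. d \<in> D \<Longrightarrow> j < N \<Longrightarrow> norm (\<zeta> d j) \<le> K"
    and "0 < \<eta>"
  shows "\<exists>(m::nat \<Rightarrow> nat) b z. (\<forall>i<N. \<forall>j<m i. b i j \<in> X.V \<and> z i j \<in> X.span Q) \<and>
    \<bar>(\<integral>y. re (ext (\<phi> y) (\<lambda>x. blinfun_apply (g y) (\<Psi> x)) is (\<xi> y)) \<partial>M) -
      (\<integral>y. re (blinfun_apply (g y) (\<Psi> (\<lambda>i. if i \<in> set is then \<Sum>j<m i. sX (\<phi> y i (b i j)) (z i j) else \<xi> y i))) \<partial>M)\<bar> \<le> \<eta> \<and>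
    \<bar>expect q (\<lambda>d. re (J (\<Psi> (\<zeta> d)) (snd d))) -
      expect q (\<lambda>d. re (J (\<Psi> (\<lambda>i. if i \<in> set is then \<Sum>j<m i. sX (blinfun_apply (b i j) (fst d i)) (z i j) else \<zeta> d i)) (snd d)))\<bar> \<le> \<eta>"
  using assms(14-)
proof (induction "is" arbitrary: \<xi> \<zeta> K \<eta>)
  case Nil
  then show ?case by (intro exI[of _ "\<lambda>_. 0"]) auto
next
  case (Cons i "is")
  interpret M: real_distribution M by (rule M)
  have i: "i < N" "i \<notin> set is" and d_is: "distinct is" "set is \<subseteq> {..<N}" using Cons.prems(1,2) by auto
  note \<xi> = Cons.prems(3) and \<zeta> = Cons.prems(4,5)
  have sp0: "0 \<in> X.span Q" by (rule X.span_zero)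
  define e where "e y = ext (\<phi> y) (\<lambda>x. blinfun_apply (g y) (\<Psi> x)) is" for y
  define e1 where "e1 y = ext (\<phi> y) (\<lambda>x. blinfun_apply (g y) (\<Psi> x)) (i # is)" for y
  have e: "X.partial_mlin N B is (e y)" for y
    unfolding e_def by (rule functional_partial_mlin[OF \<Psi> B g(1,2) d_is \<phi>(1)])
  have e1: "X.partial_mlin N B (i # is) (e1 y)" for y
    unfolding e1_def by (rule functional_partial_mlin[OF \<Psi> B g(1,2) Cons.prems(1,2) \<phi>(1)])
  have e_bm: "(\<lambda>y. e y (\<xi>' y)) \<in> bounded_borel" if "\<And>i. i < N \<Longrightarrow> X.finite_combination bounded_borel (X.span Q) (\<lambda>y. \<xi>' y i)" for \<xi>'
    by (rule X.expand_finite_combinations[where Y = "X.span Q", OF bounded_borel_add bounded_borel_mult bounded_borel_const e _ that sp0])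
       (auto simp: e_def intro!: ext_measurable[OF \<Psi> B Q sep g \<phi> d_is])
  have e1_bm: "(\<lambda>y. e1 y (\<xi> y)) \<in> bounded_borel"
    by (rule X.expand_finite_combinations[where Y = "X.span Q", OF bounded_borel_add bounded_borel_mult bounded_borel_const e1 _ \<xi> sp0])
       (auto simp only: e1_def intro!: ext_measurable[OF \<Psi> B Q sep g \<phi> Cons.prems(1,2)])
  define F where "F y = Blinfun (\<lambda>a. e y ((\<xi> y)(i := a)))" for y
  note slice = X.partial_mlin_slice[OF e i]
  have F_app: "blinfun_apply (F y) a = e y ((\<xi> y)(i := a))" for y a
    unfolding F_def by (simp only: slice(1))
  have F_V: "F y \<in> X.V" for y unfolding F_def by (rule slice(2))
  have upd_nice: "X.finite_combination bounded_borel (X.span Q) (\<lambda>y. ((\<xi> y)(i := h y)) k)" if "X.finite_combination bounded_borel (X.span Q) h" "k < N" for h k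
    using that \<xi>[of k] by (cases "k = i") auto
  have F_bm: "(\<lambda>y. blinfun_apply (F y) a) \<in> bounded_borel" if "a \<in> Q" for a
    unfolding F_app
    by (rule e_bm) (use that in \<open>intro upd_nice X.finite_combination_const bounded_borel_const X.span_base; simp\<close>)
  obtain KF where KF: "\<And>y. norm (F y) \<le> KF"
  proof -
    have "\<exists>K. \<forall>y. 0 \<le> K \<and> norm (\<xi> y j) \<le> K" if "j < N" for j
      using X.finite_combination_bounded[OF \<xi>[OF that]] by blast
    then obtain Kx where Kx: "\<And>j y. j < N \<Longrightarrow> norm (\<xi> y j) \<le> Kx j" by metis
    have "norm (F y) \<le> \<bar>B\<bar> * (\<Prod>j\<in>{..<N} - set (i # is). Kx j)" for y
      unfolding F_def by (rule order_trans[OF slice(3)]) (intro mult_left_mono prod_mono; use Kx in auto)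
    then show thesis by (rule that)
  qed
  \<comment> \<open>The slice for a point of \<open>D\<close>, where no limit is involved. The
    default 0 keeps membership in the dual and the norm bound valid for all
    \<open>d\<close>.\<close>
  define F' where "F' d = (if d \<in> D then Blinfun (\<lambda>a. J (\<Psi> ((\<zeta> d)(i := a))) (snd d)) else 0)" for d
  have part: "X.partial_mlin N B [] (\<lambda>x. J (\<Psi> x) (snd d))" if d: "d \<in> D" for d
  proof -
    have "form \<Psi> \<in> forms B" by (rule form_forms[OF \<Psi> B(1)])
    from formsD(1)[OF this, of "snd d"] have ml: "mlin N sX (*) (\<lambda>x. J (\<Psi> x) (snd d))" by (simp add: form_def)
    have "norm (J (\<Psi> x) (snd d)) \<le> B * (\<Prod>j<N. norm (x j))" for x
    proof -
      have "norm (J (\<Psi> x) (snd d)) \<le> norm (\<Psi> x) * norm (snd d)" by (rule norm_J_apply)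
      also have "\<dots> \<le> norm (\<Psi> x) * 1" using d by (intro mult_left_mono) (auto simp: D_def)
      finally show ?thesis using B(1)[of x] by simp
    qed
    from X.partial_mlin_ext[OF ml this B(2), of "[]"] show ?thesis by (simp add: ext.simps(1)[abs_def])
  qed
  have i': "i \<notin> set []" by simp
  have F'_app: "blinfun_apply (F' d) a = J (\<Psi> ((\<zeta> d)(i := a))) (snd d)" if "d \<in> D" for d a
    unfolding F'_def using that by (simp add: X.partial_mlin_slice(1)[OF part[OF that] i(1) i'] del: fun_upd_apply)
  have F'_V: "F' d \<in> X.V" for d
    unfolding F'_def using X.partial_mlin_slice(2)[OF part i(1) i'] X.zero_dual by (auto simp del: fun_upd_apply)
  have K0: "0 \<le> K"
  proof -
    obtain d where "d \<in> D" using q set_pmf_not_empty[of q] by blast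
    from \<zeta>(2)[OF this i(1)] show ?thesis using norm_ge_zero order_trans by blast
  qed
  have F'_norm: "norm (F' d) \<le> \<bar>B\<bar> * (\<Prod>j\<in>{..<N} - set [i]. K)" for d
  proof (cases "d \<in> D")
    case True
    have "norm (F' d) \<le> \<bar>B\<bar> * (\<Prod>j\<in>{..<N} - set [i]. norm (\<zeta> d j))"
      unfolding F'_def using X.partial_mlin_slice(3)[OF part[OF True] i(1) i', of "\<zeta> d"] True by (simp del: fun_upd_apply)
    also have "\<dots> \<le> \<bar>B\<bar> * (\<Prod>j\<in>{..<N} - set [i]. K)"
      using \<zeta>(2)[OF True] by (intro mult_left_mono prod_mono) auto
    finally show ?thesis .
  next
    case False
    then show ?thesis using K0 by (simp add: F'_def)
  qed
  have "0 < \<eta> / 2" using Cons.prems(6) by simp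
  have "\<exists>(m::nat) b z. (\<forall>j<m. b j \<in> X.V \<and> z j \<in> X.span Q) \<and>
    (\<integral>\<^sup>+y. ennreal (norm ((\<Sum>j<m. dual_scale (blinfun_apply (F y) (z j)) (b j)) - F y)) \<partial>M) \<le> ennreal (\<eta> / 2) \<and>
    (\<integral>\<^sup>+d. ennreal (norm ((\<Sum>j<m. dual_scale (blinfun_apply (F' d) (z j)) (b j)) - F' d)) \<partial>measure_pmf q) \<le> ennreal (\<eta> / 2)"
  proof (rule X.simultaneous_approximation[OF Q sep AP M.finite_measure_axioms F_V KF _ measure_pmf.finite_measure_axioms F'_V F'_norm _ \<open>0 < \<eta> / 2\<close>])
    fix v r assume "v \<in> X.V"
    from X.strongly_measurable[OF Q F_V F_bm this, of r]
    show "{y \<in> space M. norm (F y - v) \<le> r} \<in> sets M" by simp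
  qed simp
  then obtain m0 :: nat and b0 z0 where bz: "\<And>j. j < m0 \<Longrightarrow> b0 j \<in> X.V" "\<And>j. j < m0 \<Longrightarrow> z0 j \<in> X.span Q"
    and int1: "(\<integral>\<^sup>+y. ennreal (norm ((\<Sum>j<m0. dual_scale (blinfun_apply (F y) (z0 j)) (b0 j)) - F y)) \<partial>M) \<le> ennreal (\<eta> / 2)"
    and int2: "(\<integral>\<^sup>+d. ennreal (norm ((\<Sum>j<m0. dual_scale (blinfun_apply (F' d) (z0 j)) (b0 j)) - F' d)) \<partial>measure_pmf q) \<le> ennreal (\<eta> / 2)"
    by blast
  define t1 where "t1 y = (\<Sum>j<m0. sX (\<phi> y i (b0 j)) (z0 j))" for y
  define t2 where "t2 d = (\<Sum>j<m0. sX (blinfun_apply (b0 j) (fst d i)) (z0 j))" for d :: "(nat \<Rightarrow> 'x) \<times> 'w"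
  define \<xi>' where "\<xi>' y = (\<xi> y)(i := t1 y)" for y
  define \<zeta>' where "\<zeta>' d = (\<zeta> d)(i := t2 d)" for d
  have \<xi>': "X.finite_combination bounded_borel (X.span Q) (\<lambda>y. \<xi>' y k)" if "k < N" for k
    unfolding \<xi>'_def
  proof (rule upd_nice[OF _ that])
    show "X.finite_combination bounded_borel (X.span Q) t1"
      unfolding X.finite_combination_def t1_def using bz \<phi>(2)[OF i(1)]
      by (intro exI[of _ m0] exI[of _ "\<lambda>j y. \<phi> y i (b0 j)"] exI[of _ z0]) auto
  qed
  have close1: "\<bar>(\<integral>y. re (e1 y (\<xi> y)) \<partial>M) - (\<integral>y. re (e y (\<xi>' y)) \<partial>M)\<bar> \<le> \<eta> / 2"
  proof -
    let ?FT = "\<lambda>y. (\<Sum>j<m0. dual_scale (blinfun_apply (F y) (z0 j)) (b0 j))"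
    have FT_V: "?FT y \<in> X.V" for y using bz by (intro X.dual_sum X.dual_dual_scale) auto
    have ints: "integrable M (\<lambda>y. re (e1 y (\<xi> y)))" "integrable M (\<lambda>y. re (e y (\<xi>' y)))"
      by (rule bounded_borel_integrable[OF M e1_bm], rule bounded_borel_integrable[OF M e_bm[OF \<xi>']])
    have "norm (re (e1 y (\<xi> y)) - re (e y (\<xi>' y))) \<le> norm (?FT y - F y)" for y
    proof -
      have "e1 y (\<xi> y) = \<phi> y i (F y)" by (simp add: e1_def F_def e_def)
      moreover have "e y (\<xi>' y) = (\<Sum>j<m0. \<phi> y i (b0 j) * e y ((\<xi> y)(i := z0 j)))"
        unfolding \<xi>'_def t1_def by (rule X.partial_mlin_sum[OF e i])
      moreover have "\<phi> y i (?FT y) = (\<Sum>j<m0. \<phi> y i (dual_scale (blinfun_apply (F y) (z0 j)) (b0 j)))"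
        by (rule X.functional_sum[OF \<phi>(1)]) (use bz in \<open>auto intro: X.dual_dual_scale\<close>)
      moreover have "\<dots> = (\<Sum>j<m0. \<phi> y i (b0 j) * e y ((\<xi> y)(i := z0 j)))"
        by (rule sum.cong) (use bz in \<open>auto simp: X.functional_scale[OF \<phi>(1)] F_app mult.commute simp del: fun_upd_apply\<close>)
      \<comment> \<open>By linearity of \<open>\<phi> y i\<close> the error is its value at a
        difference of functionals, where the norm bound applies.\<close>
      ultimately have eq: "e1 y (\<xi> y) - e y (\<xi>' y) = - \<phi> y i (?FT y - F y)"
        using X.functional_diff[OF \<phi>(1) FT_V F_V, of y i y y] by simp
      have "norm (re (e1 y (\<xi> y)) - re (e y (\<xi>' y))) \<le> norm (e1 y (\<xi> y) - e y (\<xi>' y))"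
        using abs_re_le[of "e1 y (\<xi> y) - e y (\<xi>' y)"] by (simp add: re_diff)
      also have "\<dots> \<le> norm (?FT y - F y)"
        unfolding eq using X.functional_norm[OF \<phi>(1) X.dual_diff[OF FT_V F_V], of y i y y] by simp
      finally show ?thesis .
    qed
    then have "(\<integral>\<^sup>+y. ennreal (norm (re (e1 y (\<xi> y)) - re (e y (\<xi>' y)))) \<partial>M) \<le> ennreal (\<eta> / 2)"
      by (intro order_trans[OF nn_integral_mono int1] ennreal_leI)
    moreover have "ennreal (norm (\<integral>y. re (e1 y (\<xi> y)) - re (e y (\<xi>' y)) \<partial>M)) \<le>
        (\<integral>\<^sup>+y. ennreal (norm (re (e1 y (\<xi> y)) - re (e y (\<xi>' y)))) \<partial>M)"
      by (rule integral_norm_bound_ennreal[OF Bochner_Integration.integrable_diff[OF ints]])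
    ultimately have "ennreal (norm (\<integral>y. re (e1 y (\<xi> y)) - re (e y (\<xi>' y)) \<partial>M)) \<le> ennreal (\<eta> / 2)" by (rule order_trans[rotated])
    then show ?thesis using \<open>0 < \<eta> / 2\<close> Bochner_Integration.integral_diff[OF ints] by simp
  qed
  \<comment> \<open>The replaced coordinate need not stay within the old bound, which is therefore
    enlarged for the next round.\<close>
  define K' where "K' = max K (\<Sum>j<m0. norm (b0 j) * norm (z0 j))"
  have t2_norm: "norm (t2 d) \<le> (\<Sum>j<m0. norm (b0 j) * norm (z0 j))" if d: "d \<in> D" for d
    unfolding t2_def
  proof (rule sum_norm_le)
    fix j
    have "norm (blinfun_apply (b0 j) (fst d i)) \<le> norm (b0 j) * norm (fst d i)" by (rule norm_blinfun)
    also have "\<dots> \<le> norm (b0 j) * 1" using d i(1) by (intro mult_left_mono) (auto simp: D_def unit_tuples_def)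
    finally show "norm (sX (blinfun_apply (b0 j) (fst d i)) (z0 j)) \<le> norm (b0 j) * norm (z0 j)"
      by (simp add: X.norm_scale mult_right_mono)
  qed
  have \<zeta>'_norm: "norm (\<zeta>' d j) \<le> K'" if "d \<in> D" "j < N" for d j
    using \<zeta>(2)[OF that] t2_norm[OF that(1)] by (auto simp: \<zeta>'_def K'_def)
  have \<zeta>'_fst: "\<zeta>' d j = fst d j" if "d \<in> D" "j \<in> set is" for d j
    using \<zeta>(1)[OF that(1)] that i by (auto simp: \<zeta>'_def)
  have close2: "\<bar>expect q (\<lambda>d. re (J (\<Psi> (\<zeta> d)) (snd d))) - expect q (\<lambda>d. re (J (\<Psi> (\<zeta>' d)) (snd d)))\<bar> \<le> \<eta> / 2"
  proof -
    let ?FT = "\<lambda>d. (\<Sum>j<m0. dual_scale (blinfun_apply (F' d) (z0 j)) (b0 j))"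
    let ?f = "\<lambda>d. re (J (\<Psi> (\<zeta> d)) (snd d))" and ?f' = "\<lambda>d. re (J (\<Psi> (\<zeta>' d)) (snd d))"
    have ints: "integrable (measure_pmf q) ?f" "integrable (measure_pmf q) ?f'"
    proof -
      show "integrable (measure_pmf q) ?f"
        by (rule integrable_pmf_bounded[of _ _ "B * K ^ N"], rule form_bounded[OF B])
           (use q \<zeta>(2) in \<open>auto simp: D_def\<close>)
      show "integrable (measure_pmf q) ?f'"
        by (rule integrable_pmf_bounded[of _ _ "B * K' ^ N"], rule form_bounded[OF B])
           (use q \<zeta>'_norm in \<open>auto simp: D_def\<close>)
    qed
    have "norm (?f d - ?f' d) \<le> norm (?FT d - F' d)" if d: "d \<in> D" for d
    proof -
      have "(\<zeta> d)(i := fst d i) = \<zeta> d" using \<zeta>(1)[OF d, of i] by auto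
      then have 1: "J (\<Psi> (\<zeta> d)) (snd d) = blinfun_apply (F' d) (fst d i)" by (simp add: F'_app[OF d] del: fun_upd_apply)
      \<comment> \<open>Linearity of the slice moves the finite-rank operator from the point to the
        functional.\<close>
      have 2: "J (\<Psi> (\<zeta>' d)) (snd d) = blinfun_apply (?FT d) (fst d i)"
      proof -
        have "J (\<Psi> (\<zeta>' d)) (snd d) = blinfun_apply (F' d) (t2 d)" by (simp add: F'_app[OF d] \<zeta>'_def del: fun_upd_apply)
        also have "\<dots> = blinfun_apply (?FT d) (fst d i)"
          unfolding t2_def by (simp add: blinfun.sum_right blinfun.sum_left X.dual_apply_scale[OF F'_V] mult.commute)
        finally show ?thesis .
      qed
      have "norm (?f d - ?f' d) \<le> norm (blinfun_apply (F' d - ?FT d) (fst d i))"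
        unfolding 1 2 re_diff[symmetric] blinfun.diff_left[symmetric] real_norm_def by (rule abs_re_le)
      also have "\<dots> \<le> norm (F' d - ?FT d) * norm (fst d i)" by (rule norm_blinfun)
      also have "\<dots> \<le> norm (F' d - ?FT d) * 1"
        using d i(1) by (intro mult_left_mono) (auto simp: D_def unit_tuples_def)
      finally show ?thesis by (simp add: norm_minus_commute)
    qed
    then have "(\<integral>\<^sup>+d. ennreal (norm (?f d - ?f' d)) \<partial>measure_pmf q) \<le> (\<integral>\<^sup>+d. ennreal (norm (?FT d - F' d)) \<partial>measure_pmf q)"
      using q by (intro nn_integral_mono_AE) (auto simp: AE_measure_pmf_iff intro!: ennreal_leI)
    also note int2
    finally have "(\<integral>\<^sup>+d. ennreal (norm (?f d - ?f' d)) \<partial>measure_pmf q) \<le> ennreal (\<eta> / 2)" .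
    moreover have "ennreal (norm (expect q (\<lambda>d. ?f d - ?f' d))) \<le> (\<integral>\<^sup>+d. ennreal (norm (?f d - ?f' d)) \<partial>measure_pmf q)"
      by (rule integral_norm_bound_ennreal[OF Bochner_Integration.integrable_diff[OF ints]])
    ultimately have "ennreal (norm (expect q (\<lambda>d. ?f d - ?f' d))) \<le> ennreal (\<eta> / 2)" by (rule order_trans[rotated])
    then show ?thesis using \<open>0 < \<eta> / 2\<close> Bochner_Integration.integral_diff[OF ints] by simp
  qed
  obtain m :: "nat \<Rightarrow> nat" and b z where mbz: "\<forall>i<N. \<forall>j<m i. b i j \<in> X.V \<and> z i j \<in> X.span Q"
    and IH1: "\<bar>(\<integral>y. re (e y (\<xi>' y)) \<partial>M) -
      (\<integral>y. re (blinfun_apply (g y) (\<Psi> (\<lambda>k. if k \<in> set is then \<Sum>j<m k. sX (\<phi> y k (b k j)) (z k j) else \<xi>' y k))) \<partial>M)\<bar> \<le> \<eta> / 2"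
    and IH2: "\<bar>expect q (\<lambda>d. re (J (\<Psi> (\<zeta>' d)) (snd d))) -
      expect q (\<lambda>d. re (J (\<Psi> (\<lambda>k. if k \<in> set is then \<Sum>j<m k. sX (blinfun_apply (b k j) (fst d k)) (z k j) else \<zeta>' d k)) (snd d)))\<bar> \<le> \<eta> / 2"
    using Cons.IH[of \<xi>' \<zeta>' K' "\<eta> / 2", OF d_is] \<xi>' \<zeta>'_fst \<zeta>'_norm \<open>0 < \<eta> / 2\<close> unfolding e_def by blast
  define m1 where "m1 = m(i := m0)"
  define b1 where "b1 = b(i := b0)"
  define z1 where "z1 = z(i := z0)"
  have eq1: "(\<lambda>k. if k \<in> set is then \<Sum>j<m k. sX (\<phi> y k (b k j)) (z k j) else \<xi>' y k) =
      (\<lambda>k. if k \<in> set (i # is) then \<Sum>j<m1 k. sX (\<phi> y k (b1 k j)) (z1 k j) else \<xi> y k)" for y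
    using i(2) by (auto simp: m1_def b1_def z1_def \<xi>'_def t1_def)
  have eq2: "(\<lambda>k. if k \<in> set is then \<Sum>j<m k. sX (blinfun_apply (b k j) (fst d k)) (z k j) else \<zeta>' d k) =
      (\<lambda>k. if k \<in> set (i # is) then \<Sum>j<m1 k. sX (blinfun_apply (b1 k j) (fst d k)) (z1 k j) else \<zeta> d k)" for d
    using i(2) by (auto simp: m1_def b1_def z1_def \<zeta>'_def t2_def)
  have triangle: "\<bar>x - z\<bar> \<le> \<eta>" if "\<bar>x - y\<bar> \<le> \<eta> / 2" "\<bar>y - z\<bar> \<le> \<eta> / 2" for x y z :: real
    using that by linarith
  show ?case
  proof (intro exI[of _ m1] exI[of _ b1] exI[of _ z1] conjI)
    show "\<forall>i<N. \<forall>j<m1 i. b1 i j \<in> X.V \<and> z1 i j \<in> X.span Q"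
      using mbz bz by (auto simp: m1_def b1_def z1_def)
    show "\<bar>(\<integral>y. re (ext (\<phi> y) (\<lambda>x. blinfun_apply (g y) (\<Psi> x)) (i # is) (\<xi> y)) \<partial>M) -
      (\<integral>y. re (blinfun_apply (g y) (\<Psi> (\<lambda>k. if k \<in> set (i # is) then \<Sum>j<m1 k. sX (\<phi> y k (b1 k j)) (z1 k j) else \<xi> y k))) \<partial>M)\<bar> \<le> \<eta>"
      using triangle[OF close1 IH1] unfolding eq1 e1_def .
    show "\<bar>expect q (\<lambda>d. re (J (\<Psi> (\<zeta> d)) (snd d))) -
      expect q (\<lambda>d. re (J (\<Psi> (\<lambda>k. if k \<in> set (i # is) then \<Sum>j<m1 k. sX (blinfun_apply (b1 k j) (fst d k)) (z1 k j) else \<zeta> d k)) (snd d)))\<bar> \<le> \<eta>"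
      using triangle[OF close2 IH2] unfolding eq2 .
  qed
qed

end

subsection \<open>The dual case\<close>

context normed_space_pair
begin

text \<open>Attainment with its witnesses exposed: the reduction of property beta to the scalar case
  keeps the tuple and exchanges the functional.\<close>

definition attaining :: "nat \<Rightarrow> ((nat \<Rightarrow> 'x) \<Rightarrow> 'z) \<Rightarrow> (nat \<Rightarrow> ('x \<Rightarrow>\<^sub>L 'k) \<Rightarrow> 'k) \<Rightarrow> ('z \<Rightarrow>\<^sub>L 'k) \<Rightarrow> bool" where
  "attaining N \<Psi> \<phi> g \<longleftrightarrow> g \<in> dual_space sZ \<and> norm g \<le> 1 \<and> (\<forall>i<N. X.ball_limit (\<phi> i)) \<and>
    (\<forall>\<sigma>. \<sigma> permutes {..<N} \<longrightarrow>
      multilinear_norm N \<Psi> \<le> norm (ext \<phi> (\<lambda>x. blinfun_apply g (\<Psi> x)) (map \<sigma> [0..<N]) (\<lambda>_. 0)))"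

lemma attaining_arens:
  assumes "\<Psi> \<in> sym_multilinear N sX sZ" "attaining N \<Psi> \<phi> g"
  shows "arens_extensions_attain_norm_at_same_tuple N sX sZ \<Psi>"
proof -
  obtain B where B: "mlin N sX sZ \<Psi>" "\<forall>x\<in>unit_tuples N. norm (\<Psi> x) \<le> B"
    using assms(1) unfolding sym_multilinear_iff by blast
  show ?thesis by (rule arens_attain[OF B, of \<phi> g]) (use assms(2) in \<open>auto simp: attaining_def\<close>)
qed

end

lemma permutation_list:
  assumes "\<sigma> permutes {..<N}"
  shows "distinct (map \<sigma> [0..<N])" "set (map \<sigma> [0..<N]) = {..<N}"
  using permutes_inj_on[OF assms, of "{0..<N}"] permutes_image[OF assms]
  by (auto simp: distinct_map atLeast0LessThan)

context dual_setting
begin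

text \<open>Different operators may act on different coordinates, so these forms are in general not
  symmetric; for their sake the averages were made to converge on all forms.\<close>

lemma compose_bounded:
  fixes m :: "nat \<Rightarrow> nat" and b :: "nat \<Rightarrow> nat \<Rightarrow> 'x \<Rightarrow>\<^sub>L 'k"
  assumes \<Psi>: "mlin N sX sZ \<Psi>" and B: "\<And>x. norm (\<Psi> x) \<le> B * (\<Prod>i<N. norm (x i))" "0 \<le> B"
    and b: "\<And>i j. i < N \<Longrightarrow> j < m i \<Longrightarrow> b i j \<in> X.V"
  shows "\<exists>C. form (\<lambda>x. \<Psi> (\<lambda>i. \<Sum>j<m i. sX (blinfun_apply (b i j) (x i)) (z i j))) \<in> forms C"
proof -
  let ?T = "\<lambda>i a. \<Sum>j<m i. sX (blinfun_apply (b i j) a) (z i j)"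
  have T_upd: "(\<lambda>k. ?T k ((x(i := a)) k)) = (\<lambda>k. ?T k (x k))(i := ?T i a)" for x i a by auto
  have "mlin N sX sZ (\<lambda>x. \<Psi> (\<lambda>i. ?T i (x i)))"
    unfolding mlin_def
  proof (intro conjI allI impI)
    fix x y :: "nat \<Rightarrow> 'x" assume "\<forall>i<N. x i = y i"
    then show "\<Psi> (\<lambda>i. ?T i (x i)) = \<Psi> (\<lambda>i. ?T i (y i))" by (intro mlin_cong[OF \<Psi>]) simp
  next
    fix i and x :: "nat \<Rightarrow> 'x" and a a' :: 'x and c assume i: "i < N"
    have "?T i (a + a') = ?T i a + ?T i a'"
      by (simp add: blinfun.add_right X.scale_left_distrib sum.distrib)
    then show "\<Psi> (\<lambda>k. ?T k ((x(i := a + a')) k)) = \<Psi> (\<lambda>k. ?T k ((x(i := a)) k)) + \<Psi> (\<lambda>k. ?T k ((x(i := a')) k))"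
      unfolding T_upd by (simp only: mlin_add[OF \<Psi> i])
    have "?T i (sX c a) = sX c (?T i a)"
      using b[OF i] by (simp add: X.dual_apply_scale X.scale_sum_right)
    then show "\<Psi> (\<lambda>k. ?T k ((x(i := sX c a)) k)) = sZ c (\<Psi> (\<lambda>k. ?T k ((x(i := a)) k)))"
      unfolding T_upd by (simp only: mlin_scale[OF \<Psi> i])
  qed
  moreover define C where "C i = (\<Sum>j<m i. norm (b i j) * norm (z i j))" for i
  have T_norm: "norm (?T i a) \<le> C i * norm a" for i a
    unfolding C_def sum_distrib_right
  proof (rule sum_norm_le)
    fix j
    have "norm (sX (blinfun_apply (b i j) a) (z i j)) \<le> (norm (b i j) * norm a) * norm (z i j)"
      unfolding X.norm_scale by (intro mult_right_mono norm_blinfun) simp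
    then show "norm (sX (blinfun_apply (b i j) a) (z i j)) \<le> norm (b i j) * norm (z i j) * norm a" by (simp add: mult_ac)
  qed
  have "norm (\<Psi> (\<lambda>i. ?T i (x i))) \<le> (B * (\<Prod>i<N. C i)) * (\<Prod>i<N. norm (x i))" for x
  proof -
    have "norm (\<Psi> (\<lambda>i. ?T i (x i))) \<le> B * (\<Prod>i<N. norm (?T i (x i)))" by (rule B(1))
    also have "\<dots> \<le> B * (\<Prod>i<N. C i * norm (x i))"
      by (intro mult_left_mono prod_mono conjI T_norm norm_ge_zero B(2))
    finally show ?thesis by (simp add: prod.distrib mult.assoc)
  qed
  ultimately show ?thesis using form_forms by blast
qed

text \<open>Each order of limits gives a function of \<open>y\<close> of modulus at most
  \<open>m\<close>, and its average over \<open>M\<close> is \<open>m\<close>: it is near the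
  average of a finite-rank modification, this is the limit of the averages along \<open>p\<close>,
  that limit is twice the average of the modification over \<open>q\<close>, and the latter is near
  twice the average of \<Psi> itself, which is \<open>m\<close>.\<close>

lemma dual_attaining:
  assumes sep: "separable_space (top_of_set X.V)" and AP: "approximation_property dual_scale X.V"
    and \<Phi>: "\<Phi> \<in> sym_multilinear N sX sZ" and "0 < \<epsilon>"
  shows "\<exists>\<Psi>\<in>sym_multilinear N sX sZ. multilinear_norm N (\<lambda>x. \<Phi> x - \<Psi> x) \<le> \<epsilon> \<and> (\<exists>\<phi> g. XZ.attaining N \<Psi> \<phi> g)"
proof -
  obtain B0 where \<Phi>_mlin: "mlin N sX sZ \<Phi>" and B0: "\<And>x. x \<in> unit_tuples N \<Longrightarrow> norm (\<Phi> x) \<le> B0"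
    and \<Phi>_sym: "\<And>\<pi> x. \<pi> permutes {..<N} \<Longrightarrow> \<Phi> (x \<circ> \<pi>) = \<Phi> x"
    using \<Phi> unfolding XZ.sym_multilinear_iff by blast
  have "form \<Phi> \<in> sforms B0"
    using form_forms[OF \<Phi>_mlin XZ.mlin_bound[OF \<Phi>_mlin B0]] \<Phi>_sym by (simp add: sforms_def form_def)
  from attaining_perturbation[OF this \<open>0 < \<epsilon>\<close>]
  obtain \<phi>0 p q m where \<phi>0: "\<phi>0 \<in> sforms 1" and p: "\<And>n::nat. set_pmf (p n) \<subseteq> D" and q: "set_pmf q \<subseteq> D"
    and max: "\<And>d. d \<in> D \<Longrightarrow> norm (form \<Phi> d - of_real \<epsilon> * \<phi>0 d) \<le> m"
    and att: "2 * expect q (\<lambda>d. re (form \<Phi> d - of_real \<epsilon> * \<phi>0 d)) = m"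
    and lim: "\<And>C \<Theta>. \<Theta> \<in> forms C \<Longrightarrow> (\<lambda>n. expect (p n) (\<lambda>d. re (\<Theta> d))) \<longlonglongrightarrow> 2 * expect q (\<lambda>d. re (\<Theta> d))"
    by blast
  define \<Theta> where "\<Theta> d = form \<Phi> d - of_real \<epsilon> * \<phi>0 d" for d
  have \<Theta>s: "\<Theta> \<in> sforms (B0 + \<epsilon>)"
    using sforms_combination[OF \<open>form \<Phi> \<in> sforms B0\<close> \<phi>0, of 1 "- of_real \<epsilon>"] \<open>0 < \<epsilon>\<close> unfolding \<Theta>_def by simp
  have m0: "0 \<le> m"
  proof -
    obtain d where "d \<in> D" using q set_pmf_not_empty[of q] by blast
    then show ?thesis using max norm_ge_zero order_trans by blast
  qed
  have \<Theta>m: "\<Theta> \<in> forms m"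
    by (rule forms_norm_le(1)[OF sforms_forms[OF \<Theta>s]]) (use max re_le order_trans in \<open>unfold \<Theta>_def, blast\<close>)
  obtain \<Psi> where \<Psi>: "mlin N sX sZ \<Psi>" and form_\<Psi>: "form \<Psi> = \<Theta>"
    and B: "\<And>x. norm (\<Psi> x) \<le> m * (\<Prod>i<N. norm (x i))"
    using form_surj[OF \<Theta>m m0] by blast
  have J_form: "J (\<Psi> x) w = \<Theta> (x, w)" for x w using form_\<Psi> by (auto simp: form_def fun_eq_iff)
  have unit: "norm (\<Psi> x) \<le> m" if "x \<in> unit_tuples N" for x
  proof -
    have "(\<Prod>i<N. norm (x i)) \<le> 1" using that by (intro prod_le_1) (auto simp: unit_tuples_def)
    then have "m * (\<Prod>i<N. norm (x i)) \<le> m * 1" using m0 by (intro mult_left_mono)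
    then show ?thesis using B[of x] by linarith
  qed
  have \<Psi>_sym: "\<Psi> (x \<circ> \<pi>) = \<Psi> x" if "\<pi> permutes {..<N}" for \<pi> x
    unfolding J_eq_iff[symmetric]
    by (rule blinfun_eqI) (use \<Theta>s that in \<open>simp add: J_form sforms_def\<close>)
  have \<Psi>_in: "\<Psi> \<in> sym_multilinear N sX sZ"
    unfolding XZ.sym_multilinear_iff using \<Psi> unit \<Psi>_sym by blast
  have dist: "multilinear_norm N (\<lambda>x. \<Phi> x - \<Psi> x) \<le> \<epsilon>"
  proof (rule multilinear_norm_le)
    fix x :: "nat \<Rightarrow> 'x" assume x: "x \<in> unit_tuples N"
    have J_diff: "J (\<Phi> x - \<Psi> x) = J (\<Phi> x) - J (\<Psi> x)" using J_add[of "\<Phi> x - \<Psi> x" "\<Psi> x"] by simp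
    have "norm (J (\<Phi> x - \<Psi> x)) \<le> \<epsilon>"
    proof (rule norm_blinfun_bound)
      fix w
      have "J (\<Phi> x - \<Psi> x) w = of_real \<epsilon> * \<phi>0 (x, w)"
        unfolding J_diff blinfun.diff_left J_form by (simp add: \<Theta>_def form_def)
      then have "norm (J (\<Phi> x - \<Psi> x) w) = \<epsilon> * norm (\<phi>0 (x, w))" using \<open>0 < \<epsilon>\<close> by (simp add: norm_mult)
      also have "norm (\<phi>0 (x, w)) \<le> 1 * (\<Prod>i<N. norm (x i)) * norm w" by (rule formsD(4)[OF sforms_forms[OF \<phi>0]])
      also have "\<dots> \<le> 1 * norm w"
        using x by (intro mult_right_mono) (auto simp: unit_tuples_def intro!: prod_le_1)
      finally show "norm (J (\<Phi> x - \<Psi> x) w) \<le> \<epsilon> * norm w" using \<open>0 < \<epsilon>\<close> by simp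
    qed (use \<open>0 < \<epsilon>\<close> in simp)
    then show "norm (\<Phi> x - \<Psi> x) \<le> \<epsilon>" by (simp add: J_norm)
  qed
  obtain Q where Q: "X.norming Q" using X.norming_exists[OF sep] by blast
  obtain M :: "real measure" and S \<phi> g s where M: "real_distribution M" and S: "closed S"
    and ball': "\<forall>y i. X.ball_limit (\<phi> y i)" and g': "\<forall>y. g y \<in> dual_space sZ \<and> norm (g y) \<le> 1"
    and off': "\<forall>y i f. y \<notin> S \<longrightarrow> \<phi> y i f = 0" "\<forall>y. y \<notin> S \<longrightarrow> g y = 0"
    and cont': "\<forall>i<N. \<forall>f\<in>X.V. continuous_on S (\<lambda>y. \<phi> y i f)"
      "\<forall>x. (\<forall>i<N. x i \<in> X.span Q) \<longrightarrow> continuous_on S (\<lambda>y. blinfun_apply (g y) (\<Psi> x))"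
    and s: "strict_mono s"
    and conv: "\<forall>(m::nat \<Rightarrow> nat) b z. (\<forall>i<N. \<forall>j<m i. b i j \<in> X.V \<and> z i j \<in> X.span Q) \<longrightarrow>
      (\<lambda>n. expect (p (s n)) (\<lambda>d. re (J (\<Psi> (\<lambda>i. \<Sum>j<m i. sX (blinfun_apply (b i j) (fst d i)) (z i j))) (snd d))))
        \<longlonglongrightarrow> (\<integral>y. re (blinfun_apply (g y) (\<Psi> (\<lambda>i. \<Sum>j<m i. sX (\<phi> y i (b i j)) (z i j)))) \<partial>M)"
    using limit_data[OF \<Psi> B m0 Q sep, of p, OF p] by (elim exE conjE) (rule that; assumption)
  note conv = conv[THEN spec, THEN spec, THEN spec, THEN mp]
  have ball: "X.ball_limit (\<phi> y i)" and g: "g y \<in> dual_space sZ" "norm (g y) \<le> 1" for y i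
    using ball' g' by auto
  have off: "\<And>y i f. y \<notin> S \<Longrightarrow> \<phi> y i f = 0" "\<And>y. y \<notin> S \<Longrightarrow> g y = 0" using off' by auto
  have \<phi>_cont: "\<And>i f. i < N \<Longrightarrow> f \<in> X.V \<Longrightarrow> continuous_on S (\<lambda>y. \<phi> y i f)" using cont'(1) by blast
  have g_cont: "continuous_on S (\<lambda>y. blinfun_apply (g y) (\<Psi> x))" if "\<And>i. i < N \<Longrightarrow> x i \<in> X.span Q" for x
    using cont'(2) that by blast
  interpret M: real_distribution M by (rule M)
  note fn = X.ball_limit_functional(1)[OF ball]
  have \<phi>_bm: "(\<lambda>y. \<phi> y i f) \<in> bounded_borel" if "i < N" "f \<in> X.V" for i f
    by (rule bounded_borel_continuous[OF S(1) \<phi>_cont[OF that] off(1) X.functional_norm[OF fn that(2)]])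
  have g_bm: "(\<lambda>y. blinfun_apply (g y) (\<Psi> x)) \<in> bounded_borel" if "\<And>i. i < N \<Longrightarrow> x i \<in> X.span Q" for x
  proof (rule bounded_borel_continuous[OF S(1) g_cont[OF that]])
    show "norm (blinfun_apply (g y) (\<Psi> x)) \<le> norm (\<Psi> x)" for y
      using norm_blinfun[of "g y" "\<Psi> x"] mult_right_mono[OF g(2)[of y] norm_ge_zero[of "\<Psi> x"]] by simp
  qed (use off(2) in simp_all)
  let ?e = "\<lambda>\<sigma> y. ext (\<phi> y) (\<lambda>x. blinfun_apply (g y) (\<Psi> x)) (map \<sigma> [0..<N]) (\<lambda>_. 0)"
  have e_le: "norm (?e \<sigma> y) \<le> m" if "\<sigma> permutes {..<N}" for \<sigma> y
  proof -
    note l = permutation_list[OF that]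
    have "X.partial_mlin N m (map \<sigma> [0..<N]) (ext (\<phi> y) (\<lambda>x. blinfun_apply (g y) (\<Psi> x)) (map \<sigma> [0..<N]))"
      by (rule functional_partial_mlin[OF \<Psi> B m0 g l(1) _ fn]) (simp only: l(2) order_refl)
    from X.partial_mlinD(4)[OF this, of "\<lambda>_. 0"] show ?thesis by (simp only: l(2)) simp
  qed
  have e_bm: "(\<lambda>y. ?e \<sigma> y) \<in> bounded_borel" if "\<sigma> permutes {..<N}" for \<sigma>
  proof -
    note l = permutation_list[OF that]
    show ?thesis
      by (rule ext_measurable[OF \<Psi> B m0 Q sep g g_bm fn \<phi>_bm l(1)]) (simp_all only: l(2) order_refl X.span_zero)
  qed
  have integral_e: "(\<integral>y. re (?e \<sigma> y) \<partial>M) = m" if \<sigma>: "\<sigma> permutes {..<N}" for \<sigma>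
  proof -
    note l = permutation_list[OF \<sigma>]
    \<comment> \<open>One third of the error is spent on \<open>M\<close> and two thirds on
      \<open>q\<close>, whose average enters doubled.\<close>
    have "\<bar>(\<integral>y. re (?e \<sigma> y) \<partial>M) - m\<bar> \<le> 0 + \<eta>" if "0 < \<eta>" for \<eta>
    proof -
      have "0 < \<eta> / 3" using that by simp
      have nice0: "X.finite_combination bounded_borel (X.span Q) (\<lambda>y. 0)" by (rule X.finite_combination_const[OF bounded_borel_const X.span_zero])
      have fst_le: "\<And>d j. d \<in> D \<Longrightarrow> j < N \<Longrightarrow> norm (fst d j) \<le> 1" by (auto simp: D_def unit_tuples_def)
      have sub: "set (map \<sigma> [0..<N]) \<subseteq> {..<N}" by (simp only: l(2) order_refl)
      have "\<exists>(k::nat \<Rightarrow> nat) b z. (\<forall>i<N. \<forall>j<k i. b i j \<in> X.V \<and> z i j \<in> X.span Q) \<and>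
        \<bar>(\<integral>y. re (?e \<sigma> y) \<partial>M) - (\<integral>y. re (blinfun_apply (g y) (\<Psi> (\<lambda>i. if i \<in> set (map \<sigma> [0..<N])
            then \<Sum>j<k i. sX (\<phi> y i (b i j)) (z i j) else 0))) \<partial>M)\<bar> \<le> \<eta> / 3 \<and>
        \<bar>expect q (\<lambda>d. re (J (\<Psi> (fst d)) (snd d))) - expect q (\<lambda>d. re (J (\<Psi> (\<lambda>i. if i \<in> set (map \<sigma> [0..<N])
            then \<Sum>j<k i. sX (blinfun_apply (b i j) (fst d i)) (z i j) else fst d i)) (snd d)))\<bar> \<le> \<eta> / 3"
      proof (rule iterated_limit_approximation[OF \<Psi> B m0 Q sep AP M q g])
        show "(\<lambda>y. blinfun_apply (g y) (\<Psi> x)) \<in> bounded_borel" if "\<And>i. i < N \<Longrightarrow> x i \<in> X.span Q" for x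
          by (rule g_bm[OF that])
        show "norm (fst d j) \<le> 1" if "d \<in> D" "j < N" for d j by (rule fst_le[OF that])
      qed (use \<phi>_bm fn l(1) sub nice0 \<open>0 < \<eta> / 3\<close> in blast)+
      then obtain k :: "nat \<Rightarrow> nat" and b z where bz: "\<forall>i<N. \<forall>j<k i. b i j \<in> X.V \<and> z i j \<in> X.span Q"
        and a1: "\<bar>(\<integral>y. re (?e \<sigma> y) \<partial>M) - (\<integral>y. re (blinfun_apply (g y) (\<Psi> (\<lambda>i. if i \<in> set (map \<sigma> [0..<N])
            then \<Sum>j<k i. sX (\<phi> y i (b i j)) (z i j) else 0))) \<partial>M)\<bar> \<le> \<eta> / 3"
        and a2: "\<bar>expect q (\<lambda>d. re (J (\<Psi> (fst d)) (snd d))) - expect q (\<lambda>d. re (J (\<Psi> (\<lambda>i. if i \<in> set (map \<sigma> [0..<N])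
            then \<Sum>j<k i. sX (blinfun_apply (b i j) (fst d i)) (z i j) else fst d i)) (snd d)))\<bar> \<le> \<eta> / 3"
        by (elim exE conjE) (rule that; assumption)
      \<comment> \<open>The list for \<open>\<sigma>\<close> exhausts the coordinates below
        \<open>N\<close>, so \<Psi> never sees the other branch.\<close>
      have c1: "\<Psi> (\<lambda>i. if i \<in> set (map \<sigma> [0..<N]) then h i else h' i) = \<Psi> h" for h h'
        by (rule mlin_cong[OF \<Psi>]) (simp only: l(2) lessThan_iff if_True)
      obtain C where C: "form (\<lambda>x. \<Psi> (\<lambda>i. \<Sum>j<k i. sX (blinfun_apply (b i j) (x i)) (z i j))) \<in> forms C"
        using compose_bounded[OF \<Psi> B m0, of k b z] bz by blast
      \<comment> \<open>Two computations of one limit: weak convergence along the subsequence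
        \<open>s\<close>, and convergence of the full sequence at the form of the
        modification.\<close>
      have L: "(\<integral>y. re (blinfun_apply (g y) (\<Psi> (\<lambda>i. \<Sum>j<k i. sX (\<phi> y i (b i j)) (z i j)))) \<partial>M) =
          2 * expect q (\<lambda>d. re (J (\<Psi> (\<lambda>i. \<Sum>j<k i. sX (blinfun_apply (b i j) (fst d i)) (z i j))) (snd d)))"
        using LIMSEQ_unique[OF conv[OF bz] LIMSEQ_subseq_LIMSEQ[OF lim[OF C] s, unfolded o_def form_def]] .
      have m_eq: "m = 2 * expect q (\<lambda>d. re (J (\<Psi> (fst d)) (snd d)))"
        using att by (simp add: J_form \<Theta>_def)
      show ?thesis using a1 a2 unfolding c1 L m_eq by linarith
    qed
    then have "\<bar>(\<integral>y. re (?e \<sigma> y) \<partial>M) - m\<bar> \<le> 0" by (rule field_le_epsilon)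
    then show ?thesis by simp
  qed
  have "AE y in M. re (?e \<sigma> y) = m" if \<sigma>: "\<sigma> permutes {..<N}" for \<sigma>
  proof -
    have int: "integrable M (\<lambda>y. re (?e \<sigma> y))" by (rule bounded_borel_integrable[OF M e_bm[OF \<sigma>]])
    have "(\<integral>y. m - re (?e \<sigma> y) \<partial>M) = 0"
      using integral_e[OF \<sigma>] int M.prob_space by (subst Bochner_Integration.integral_diff) auto
    moreover have "integrable M (\<lambda>y. m - re (?e \<sigma> y))" using int by auto
    moreover have "0 \<le> m - re (?e \<sigma> y)" for y using re_le[of "?e \<sigma> y"] e_le[OF \<sigma>, of y] by linarith
    ultimately have "AE y in M. m - re (?e \<sigma> y) = 0"
      by (subst (asm) integral_nonneg_eq_0_iff_AE) auto
    then show ?thesis by eventually_elim simp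
  qed
  then have "AE y in M. \<forall>\<sigma>\<in>Perms. re (?e \<sigma> y) = m"
    by (intro AE_finite_allI finite_Perms) simp
  \<comment> \<open>An almost sure event of a probability measure has a point; it supplies the
    bidual tuple and the functional.\<close>
  then obtain y where y: "\<And>\<sigma>. \<sigma> permutes {..<N} \<Longrightarrow> re (?e \<sigma> y) = m"
    using eventually_happens'[OF M.ae_filter_bot] by blast
  have "multilinear_norm N \<Psi> \<le> m" by (rule multilinear_norm_le) (rule unit)
  then have "XZ.attaining N \<Psi> (\<phi> y) (g y)"
    unfolding XZ.attaining_def
  proof (intro conjI allI impI g ball)
    fix \<sigma> assume "\<sigma> permutes {..<N}"
    from y[OF this] re_le[of "?e \<sigma> y"] \<open>multilinear_norm N \<Psi> \<le> m\<close>
    show "multilinear_norm N \<Psi> \<le> norm (?e \<sigma> y)" by linarith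
  qed
  then show ?thesis using \<Psi>_in dist by blast
qed

end

subsection \<open>Property beta\<close>

lemma mlin_combination:
  fixes f g :: "(nat \<Rightarrow> 'x::real_normed_vector) \<Rightarrow> 'k::real_normed_field"
  assumes "mlin N s (*) f" "mlin N s (*) g"
  shows "mlin N s (*) (\<lambda>x. c * f x + c' * g x)"
  unfolding mlin_def
proof (intro conjI allI impI)
  fix x y :: "nat \<Rightarrow> 'x" assume eq: "\<forall>i<N. x i = y i"
  have "f x = f y" "g x = g y"
    by (rule mlin_cong[OF assms(1)], use eq in simp) (rule mlin_cong[OF assms(2)], use eq in simp)
  then show "c * f x + c' * g x = c * f y + c' * g y" by simp
qed (simp_all add: mlin_add[OF assms(1)] mlin_add[OF assms(2)] mlin_scale[OF assms(1)] mlin_scale[OF assms(2)]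
    algebra_simps del: fun_upd_apply)

context normed_space_over
begin

text \<open>Induction is needed because each \<open>Blinfun\<close> inside \<open>ext\<close> has to
  be recognized as a multiple of a slice already known to be bounded linear.\<close>

lemma ext_scale:
  assumes \<omega>: "mlin N scale (*) \<omega>" "\<And>x. norm (\<omega> x) \<le> B * (\<Prod>j<N. norm (x j))" "0 \<le> B"
    and "distinct is" "set is \<subseteq> {..<N}" "\<And>i. i \<in> set is \<Longrightarrow> functional (\<phi> i)"
  shows "ext \<phi> (\<lambda>x. c * \<omega> x) is x = c * ext \<phi> \<omega> is x"
  using assms(4-)
proof (induction "is" arbitrary: x)
  case Nil
  show ?case by simp
next
  case (Cons i "is")
  then have e: "partial_mlin N B is (ext \<phi> \<omega> is)"
    by (intro partial_mlin_ext[OF \<omega>]) auto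
  have i: "i < N" "i \<notin> set is" using Cons.prems by auto
  note sl = partial_mlin_slice[OF e i, of x]
  have "Blinfun (\<lambda>a. ext \<phi> (\<lambda>x. c * \<omega> x) is (x(i := a))) = Blinfun (\<lambda>a. c * ext \<phi> \<omega> is (x(i := a)))"
    using Cons by simp
  also have "\<dots> = dual_scale c (Blinfun (\<lambda>a. ext \<phi> \<omega> is (x(i := a))))"
  proof (rule blinfun_eqI)
    fix a
    have "bounded_linear (\<lambda>a. c * ext \<phi> \<omega> is (x(i := a)))"
      using bounded_linear_const_mult[OF blinfun.bounded_linear_right[of "Blinfun (\<lambda>a. ext \<phi> \<omega> is (x(i := a)))"], of c]
      unfolding sl(1) .
    then show "blinfun_apply (Blinfun (\<lambda>a. c * ext \<phi> \<omega> is (x(i := a)))) a =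
        blinfun_apply (dual_scale c (Blinfun (\<lambda>a. ext \<phi> \<omega> is (x(i := a))))) a"
      by (simp only: bounded_linear_Blinfun_apply dual_scale_apply sl(1))
  qed
  finally have eq: "Blinfun (\<lambda>a. ext \<phi> (\<lambda>x. c * \<omega> x) is (x(i := a))) =
    dual_scale c (Blinfun (\<lambda>a. ext \<phi> \<omega> is (x(i := a))))" .
  show ?case
    unfolding ext.simps eq by (rule functional_scale[OF _ sl(2)]) (use Cons.prems in simp)
qed

text \<open>The scalar field is its own dual, a scalar acting by multiplication, so the dual case
  covers scalar forms.\<close>

lemma scalar_dual_setting:
  "dual_setting scale ((*) :: 'k \<Rightarrow> 'k \<Rightarrow> 'k) ((*) :: 'k \<Rightarrow> 'k \<Rightarrow> 'k) blinfun_mult_right"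
proof (intro dual_setting.intro form_space.intro dual_setting_axioms.intro normed_space_over_axioms normed_space_over_mult)
  show "Vector_Spaces.linear (*) dual_scale (blinfun_mult_right :: 'k \<Rightarrow> 'k \<Rightarrow>\<^sub>L 'k)"
    unfolding linear_spaces_iff[OF normed_space_over_mult normed_space_over_dual_scale]
    by (auto intro!: blinfun_eqI simp: blinfun.add_left distrib_right mult.assoc)
  show "norm (blinfun_mult_right c) = norm c" for c :: 'k
  proof (rule antisym)
    show "norm (blinfun_mult_right c) \<le> norm c"
      by (rule norm_blinfun_bound) (auto simp: norm_mult)
    show "norm c \<le> norm (blinfun_mult_right c)"
      using norm_blinfun[of "blinfun_mult_right c" 1] by simp
  qed
  show "range blinfun_mult_right = dual_space ((*) :: 'k \<Rightarrow> 'k \<Rightarrow> 'k)"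
  proof (intro set_eqI iffI)
    fix f :: "'k \<Rightarrow>\<^sub>L 'k" assume "f \<in> range blinfun_mult_right"
    then show "f \<in> dual_space (*)" by (auto simp: dual_space_iff[OF normed_space_over_mult])
  next
    fix f :: "'k \<Rightarrow>\<^sub>L 'k" assume "f \<in> dual_space (*)"
    then have eq: "blinfun_apply f (c * 1) = c * f 1" for c by (simp only: dual_space_iff[OF normed_space_over_mult])
    have "f = blinfun_mult_right (f 1)"
    proof (rule blinfun_eqI)
      fix c show "blinfun_apply f c = blinfun_apply (blinfun_mult_right (f 1)) c" using eq[of c] by (simp add: mult.commute)
    qed
    then show "f \<in> range blinfun_mult_right" by blast
  qed
qed

end

section \<open>Perturbation in the direction of one coordinate\<close>

context normed_space_pair
begin

text \<open>Lindenstrauss's argument. Adding \<open>h\<close> in the direction of \<open>z\<close>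
  turns the \<open>g\<close>-coordinate into \<open>(1 + \<eta>) * \<Psi>0\<close>, since
  \<open>g z = 1\<close>, and this form attains its norm. Every other coordinate sees
  \<open>h\<close> with a factor at most \<open>t < 1\<close>, so the lift by \<eta> lets the chosen
  coordinate overtake them all, and the norm of the new map is the norm of that coordinate.\<close>

lemma beta_attaining:
  assumes sep: "separable_space (top_of_set X.V)" and AP: "approximation_property dual_scale X.V"
    and beta: "property_beta sZ"
    and \<Phi>: "\<Phi> \<in> sym_multilinear N sX sZ" and "0 < \<epsilon>"
  shows "\<exists>\<Psi>\<in>sym_multilinear N sX sZ. multilinear_norm N (\<lambda>x. \<Phi> x - \<Psi> x) < \<epsilon> \<and> (\<exists>\<phi> g. attaining N \<Psi> \<phi> g)"
proof -
  obtain B0 where \<Phi>_mlin: "mlin N sX sZ \<Phi>" and B0: "\<forall>x\<in>unit_tuples N. norm (\<Phi> x) \<le> B0"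
    and \<Phi>_sym: "\<And>\<pi> x. \<pi> permutes {..<N} \<Longrightarrow> \<Phi> (x \<circ> \<pi>) = \<Phi> x"
    using \<Phi> unfolding sym_multilinear_iff by blast
  define \<nu> where "\<nu> = multilinear_norm N \<Phi>"
  have \<Phi>_le: "norm (\<Phi> x) \<le> \<nu>" if "x \<in> unit_tuples N" for x
    unfolding \<nu>_def by (rule multilinear_norm_ge[OF \<Phi>_mlin B0 that])
  have \<nu>0: "0 \<le> \<nu>" using \<Phi>_le[OF unit_tuples_ne] norm_ge_zero order_trans by blast
  show ?thesis
  proof (cases "\<nu> = 0")
    case True
    have "multilinear_norm N (\<lambda>x. \<Phi> x - \<Phi> x) \<le> 0" by (rule multilinear_norm_le) simp
    then have "multilinear_norm N (\<lambda>x. \<Phi> x - \<Phi> x) < \<epsilon>" using \<open>0 < \<epsilon>\<close> by simp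
    \<comment> \<open>A map of norm 0 attains at any tuple; it is treated apart because \<eta> is
      defined by a division by \<open>\<nu>\<close>.\<close>
    moreover have "attaining N \<Phi> (\<lambda>_ _. 0) 0"
      unfolding attaining_def using True X.ball_limit_zero Z.zero_dual by (simp add: \<nu>_def)
    ultimately show ?thesis using \<Phi> by blast
  next
    case False
    then have \<nu>: "0 < \<nu>" using \<nu>0 by simp
    obtain S t where S: "\<And>z g. (z, g) \<in> S \<Longrightarrow> g \<in> dual_space sZ" and t: "0 \<le> t" "t < 1"
      and S1: "\<And>z g. (z, g) \<in> S \<Longrightarrow> norm z = 1 \<and> norm g = 1 \<and> blinfun_apply g z = 1"
      and S2: "\<And>p p'. p \<in> S \<Longrightarrow> p' \<in> S \<Longrightarrow> p \<noteq> p' \<Longrightarrow> norm (blinfun_apply (snd p) (fst p')) \<le> t"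
      and S3: "\<And>z. norm z = Sup (insert 0 ((\<lambda>p. norm (blinfun_apply (snd p) z)) ` S))"
    proof -
      from beta obtain S :: "('z \<times> ('z \<Rightarrow>\<^sub>L 'k)) set" and t :: real where
        1: "S \<subseteq> UNIV \<times> dual_space sZ" "0 \<le> t" "t < 1" and
        2: "\<forall>(z, g)\<in>S. norm z = 1 \<and> norm g = 1 \<and> blinfun_apply g z = 1" and
        3: "\<forall>p\<in>S. \<forall>q\<in>S. p \<noteq> q \<longrightarrow> norm (blinfun_apply (snd p) (fst q)) \<le> t" and
        4: "\<forall>z. norm z = Sup (insert 0 ((\<lambda>p. norm (blinfun_apply (snd p) z)) ` S))"
        unfolding property_beta_def by (elim exE conjE)
      show thesis
      proof (rule that[of S t])
        show "g \<in> dual_space sZ" if "(z, g) \<in> S" for z g using 1(1) that by blast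
        show "norm z = 1 \<and> norm g = 1 \<and> blinfun_apply g z = 1" if "(z, g) \<in> S" for z g using 2 that by blast
        show "norm (blinfun_apply (snd p) (fst p')) \<le> t" if "p \<in> S" "p' \<in> S" "p \<noteq> p'" for p p'
          using 3 that by blast
      qed (use 1(2,3) 4 in simp_all)
    qed
    \<comment> \<open>\<open>\<eta> * \<nu> \<le> \<epsilon> / 4\<close> keeps the perturbation
      small. The lead of the chosen coordinate over the others is
      \<open>(1 - t) * \<eta> * \<nu>\<close>, and \<delta> is a sixth of it because the errors from
      \<open>\<mu>\<close> versus \<open>\<nu>\<close> and \<open>\<Psi>0\<close> versus
      \<open>\<Phi>0\<close> add up to at most \<open>6 * \<delta>\<close>.\<close>
    define \<eta> where "\<eta> = min 1 (\<epsilon> / (4 * \<nu>))"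
    define \<delta> where "\<delta> = (1 - t) * \<eta> * \<nu> / 6"
    have \<eta>: "0 < \<eta>" "\<eta> \<le> 1" "\<eta> * \<nu> \<le> \<epsilon> / 4"
    proof -
      show "0 < \<eta>" "\<eta> \<le> 1" using \<open>0 < \<epsilon>\<close> \<nu> by (auto simp: \<eta>_def)
      have "\<eta> * \<nu> \<le> \<epsilon> / (4 * \<nu>) * \<nu>" using \<nu> by (intro mult_right_mono) (auto simp: \<eta>_def)
      then show "\<eta> * \<nu> \<le> \<epsilon> / 4" using \<nu> by simp
    qed
    have \<eta>\<nu>: "0 < \<eta> * \<nu>" using \<eta> \<nu> by simp
    have \<delta>_eq: "6 * \<delta> = (1 - t) * (\<eta> * \<nu>)" by (simp add: \<delta>_def)
    have \<delta>: "0 < \<delta>" using t \<eta>\<nu> \<delta>_eq by (metis diff_gt_0_iff_gt mult_pos_pos zero_less_mult_pos zero_less_numeral)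
    have "(1 - t) * (\<eta> * \<nu>) \<le> 1 * (\<eta> * \<nu>)" using t \<eta>\<nu> by (intro mult_right_mono) auto
    then have \<delta>_le: "6 * \<delta> \<le> \<eta> * \<nu>" using \<delta>_eq by simp
    have "\<eta> * \<nu> \<le> 1 * \<nu>" using \<eta> \<nu> by (intro mult_right_mono) auto
    then have \<delta>\<nu>: "6 * \<delta> \<le> \<nu>" using \<delta>_le by simp
    have "\<exists>x\<in>unit_tuples N. \<nu> - \<delta> < norm (\<Phi> x)"
    proof (rule ccontr)
      assume "\<not> ?thesis"
      then have "\<nu> \<le> \<nu> - \<delta>" unfolding \<nu>_def[symmetric] using multilinear_norm_le[of N \<Phi> "\<nu> - \<delta>"] by (simp add: \<nu>_def not_less)
      then show False using \<delta> by simp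
    qed
    then obtain x0 where x0: "x0 \<in> unit_tuples N" "\<nu> - \<delta> < norm (\<Phi> x0)" by blast
    \<comment> \<open>The functionals in \<open>S\<close> norm the codomain; the inserted 0 is
      admissible as \<open>\<nu> - \<delta>\<close> is nonnegative.\<close>
    have "\<exists>p\<in>S. \<nu> - \<delta> < norm (blinfun_apply (snd p) (\<Phi> x0))"
    proof (rule ccontr)
      assume "\<not> ?thesis"
      then have "norm (\<Phi> x0) \<le> \<nu> - \<delta>"
        unfolding S3[of "\<Phi> x0"] using \<delta>\<nu> \<nu> by (intro cSup_least) (auto simp: not_less)
      then show False using x0 by simp
    qed
    then obtain z g where zg: "(z, g) \<in> S" "\<nu> - \<delta> < norm (blinfun_apply g (\<Phi> x0))" by fastforce
    note g_dual = S[OF zg(1)]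
    have zg1: "norm z = 1" "norm g = 1" "blinfun_apply g z = 1" using S1[OF zg(1)] by auto
    interpret K: dual_setting sX "(*)" N "(*)" blinfun_mult_right by (rule X.scalar_dual_setting)
    define \<Phi>0 where "\<Phi>0 x = blinfun_apply g (\<Phi> x)" for x
    have \<Phi>B: "norm (\<Phi> x) \<le> \<nu> * (\<Prod>i<N. norm (x i))" for x by (rule mlin_bound[OF \<Phi>_mlin \<Phi>_le])
    have g_le: "norm (blinfun_apply g a) \<le> norm a" for a using norm_blinfun[of g a] zg1 by simp
    have \<Phi>0_mlin: "mlin N sX (*) \<Phi>0" unfolding \<Phi>0_def by (rule mlin_dual(1)[OF \<Phi>_mlin \<Phi>B g_dual])
    have \<Phi>0_le: "norm (\<Phi>0 x) \<le> \<nu>" if "x \<in> unit_tuples N" for x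
      unfolding \<Phi>0_def using g_le \<Phi>_le[OF that] order_trans by blast
    have "\<Phi>0 \<in> sym_multilinear N sX (*)"
      unfolding K.XK.sym_multilinear_iff using \<Phi>0_mlin \<Phi>0_le \<Phi>_sym by (auto simp: \<Phi>0_def)
    from K.dual_attaining[OF sep AP this \<delta>]
    obtain \<Psi>0 \<phi> g' where \<Psi>0: "\<Psi>0 \<in> sym_multilinear N sX (*)"
      and near: "multilinear_norm N (\<lambda>x. \<Phi>0 x - \<Psi>0 x) \<le> \<delta>" and att: "K.XK.attaining N \<Psi>0 \<phi> g'"
      by blast
    obtain B1 where \<Psi>0_mlin: "mlin N sX (*) \<Psi>0" and B1: "\<forall>x\<in>unit_tuples N. norm (\<Psi>0 x) \<le> B1"
      and \<Psi>0_sym: "\<And>\<pi> x. \<pi> permutes {..<N} \<Longrightarrow> \<Psi>0 (x \<circ> \<pi>) = \<Psi>0 x"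
      using \<Psi>0 unfolding K.XK.sym_multilinear_iff by blast
    define \<mu> where "\<mu> = multilinear_norm N \<Psi>0"
    have \<Psi>0_le: "norm (\<Psi>0 x) \<le> \<mu>" if "x \<in> unit_tuples N" for x
      unfolding \<mu>_def by (rule K.XK.multilinear_norm_ge[OF \<Psi>0_mlin B1 that])
    have diff_mlin: "mlin N sX (*) (\<lambda>x. \<Phi>0 x - \<Psi>0 x)"
      using mlin_combination[OF \<Phi>0_mlin \<Psi>0_mlin, of 1 "- 1"] by simp
    have near_le: "norm (\<Phi>0 x - \<Psi>0 x) \<le> \<delta>" if "x \<in> unit_tuples N" for x
    proof -
      have "\<forall>x\<in>unit_tuples N. norm (\<Phi>0 x - \<Psi>0 x) \<le> \<nu> + \<mu>"
        using \<Phi>0_le \<Psi>0_le norm_triangle_ineq4 by (metis add_mono order_trans)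
      from K.XK.multilinear_norm_ge[OF diff_mlin this that] near show ?thesis by simp
    qed
    have \<mu>_ge: "\<nu> - 2 * \<delta> \<le> \<mu>"
    proof -
      have "norm (\<Phi>0 x0) \<le> norm (\<Phi>0 x0 - \<Psi>0 x0) + norm (\<Psi>0 x0)"
        using norm_triangle_ineq[of "\<Phi>0 x0 - \<Psi>0 x0" "\<Psi>0 x0"] by simp
      then show ?thesis using near_le[OF x0(1)] \<Psi>0_le[OF x0(1)] zg(2) by (simp add: \<Phi>0_def)
    qed
    have \<mu>_le: "\<mu> \<le> \<nu> + \<delta>"
      unfolding \<mu>_def
    proof (rule multilinear_norm_le)
      fix x :: "nat \<Rightarrow> 'x" assume x: "x \<in> unit_tuples N"
      have "norm (\<Psi>0 x) \<le> norm (\<Phi>0 x) + norm (\<Phi>0 x - \<Psi>0 x)"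
        using norm_triangle_ineq4[of "\<Phi>0 x" "\<Phi>0 x - \<Psi>0 x"] by simp
      then show "norm (\<Psi>0 x) \<le> \<nu> + \<delta>" using \<Phi>0_le[OF x] near_le[OF x] by simp
    qed
    define h where "h x = of_real (1 + \<eta>) * \<Psi>0 x - \<Phi>0 x" for x
    have h_eq: "h x = of_real \<eta> * \<Psi>0 x - (\<Phi>0 x - \<Psi>0 x)" for x by (simp add: h_def algebra_simps)
    have h_le: "norm (h x) \<le> \<eta> * \<mu> + \<delta>" if x: "x \<in> unit_tuples N" for x
    proof -
      have "norm (h x) \<le> norm (of_real \<eta> * \<Psi>0 x) + norm (\<Phi>0 x - \<Psi>0 x)" unfolding h_eq by (rule norm_triangle_ineq4)
      also have "norm (of_real \<eta> * \<Psi>0 x) \<le> \<eta> * \<mu>" using \<eta> \<Psi>0_le[OF x] by (simp add: norm_mult)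
      finally show ?thesis using near_le[OF x] by simp
    qed
    have h_mlin: "mlin N sX (*) h"
      using mlin_combination[OF \<Psi>0_mlin \<Phi>0_mlin, of "of_real (1 + \<eta>)" "- 1"] by (simp add: h_def[abs_def])
    define \<Psi> where "\<Psi> x = \<Phi> x + sZ (h x) z" for x
    have \<Psi>_mlin: "mlin N sX sZ \<Psi>"
      unfolding mlin_def
    proof (intro conjI allI impI)
      fix x y :: "nat \<Rightarrow> 'x" assume eq: "\<forall>i<N. x i = y i"
      have "\<Phi> x = \<Phi> y" by (rule mlin_cong[OF \<Phi>_mlin]) (use eq in simp)
      moreover have "h x = h y" by (rule mlin_cong[OF h_mlin]) (use eq in simp)
      ultimately show "\<Psi> x = \<Psi> y" by (simp add: \<Psi>_def)
    qed (simp_all add: \<Psi>_def mlin_add[OF \<Phi>_mlin] mlin_add[OF h_mlin] mlin_scale[OF \<Phi>_mlin] mlin_scale[OF h_mlin]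
        Z.scale_left_distrib Z.scale_right_distrib algebra_simps del: fun_upd_apply)
    have g\<Psi>: "blinfun_apply g (\<Psi> x) = of_real (1 + \<eta>) * \<Psi>0 x" for x
      by (simp add: \<Psi>_def blinfun.add_right Z.dual_apply_scale[OF g_dual] zg1 h_def \<Phi>0_def)
    \<comment> \<open>Both sides are compared with
      \<open>\<nu> + \<eta> * \<nu> - 4 * \<delta>\<close>.\<close>
    have small: "\<nu> + t * (\<eta> * \<mu> + \<delta>) \<le> (1 + \<eta>) * \<mu>"
    proof -
      have "t * (\<eta> * \<mu> + \<delta>) \<le> t * (\<eta> * (\<nu> + \<delta>) + \<delta>)"
        using t \<eta> \<mu>_le by (intro mult_left_mono add_right_mono) auto
      also have "\<dots> = t * (\<eta> * \<nu>) + t * (\<eta> * \<delta> + \<delta>)" by (simp add: algebra_simps)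
      also have "t * (\<eta> * \<delta> + \<delta>) \<le> 1 * (1 * \<delta> + \<delta>)"
        using t \<eta> \<delta> by (intro mult_mono add_mono mult_right_mono) auto
      finally have 1: "t * (\<eta> * \<mu> + \<delta>) \<le> t * (\<eta> * \<nu>) + 2 * \<delta>" by simp
      have "(1 + \<eta>) * (\<nu> - 2 * \<delta>) \<le> (1 + \<eta>) * \<mu>" using \<mu>_ge \<eta> by (intro mult_left_mono) auto
      moreover have "(1 + \<eta>) * (\<nu> - 2 * \<delta>) = \<nu> + \<eta> * \<nu> - 2 * \<delta> - 2 * (\<eta> * \<delta>)" by (simp add: algebra_simps)
      moreover have "\<eta> * \<delta> \<le> 1 * \<delta>" using \<eta> \<delta> by (intro mult_right_mono) auto
      moreover have "t * (\<eta> * \<nu>) = \<eta> * \<nu> - 6 * \<delta>" using \<delta>_eq by (simp add: algebra_simps)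
      ultimately show ?thesis using 1 by linarith
    qed
    have \<mu>0: "0 \<le> \<mu>" using \<Psi>0_le[OF unit_tuples_ne] norm_ge_zero order_trans by blast
    have \<Psi>_le: "norm (\<Psi> x) \<le> (1 + \<eta>) * \<mu>" if x: "x \<in> unit_tuples N" for x
      unfolding S3[of "\<Psi> x"]
    proof (rule cSup_least)
      fix r assume "r \<in> insert 0 ((\<lambda>p. norm (blinfun_apply (snd p) (\<Psi> x))) ` S)"
      then consider "r = 0" | p where "p \<in> S" "r = norm (blinfun_apply (snd p) (\<Psi> x))" by blast
      then show "r \<le> (1 + \<eta>) * \<mu>"
      proof cases
        case 1
        then show ?thesis using \<mu>0 \<eta> by simp
      next
        case (2 p)
        show ?thesis
        proof (cases "p = (z, g)")
          case True
          then have "r = (1 + \<eta>) * norm (\<Psi>0 x)" using 2 \<eta> by (simp add: g\<Psi> norm_mult del: of_real_add)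
          then show ?thesis using \<Psi>0_le[OF x] \<eta> by simp
        next
          case False
          have p_dual: "snd p \<in> dual_space sZ" and p1: "norm (snd p) = 1"
            using S[of "fst p" "snd p"] S1[of "fst p" "snd p"] 2(1) by auto
          have "r = norm (blinfun_apply (snd p) (\<Phi> x) + h x * blinfun_apply (snd p) z)"
            using 2(2) by (simp add: \<Psi>_def blinfun.add_right Z.dual_apply_scale[OF p_dual])
          also have "\<dots> \<le> norm (blinfun_apply (snd p) (\<Phi> x)) + norm (h x) * norm (blinfun_apply (snd p) z)"
            using norm_triangle_ineq[of "blinfun_apply (snd p) (\<Phi> x)" "h x * blinfun_apply (snd p) z"] by (simp add: norm_mult)
          also have "norm (blinfun_apply (snd p) (\<Phi> x)) \<le> \<nu>"
            using norm_blinfun[of "snd p" "\<Phi> x"] p1 \<Phi>_le[OF x] by simp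
          also have "norm (h x) * norm (blinfun_apply (snd p) z) \<le> (\<eta> * \<mu> + \<delta>) * t"
            using S2[OF 2(1) zg(1) False] h_le[OF x] order_trans[OF norm_ge_zero h_le[OF x]] by (intro mult_mono) auto
          finally show ?thesis using small by (simp add: mult.commute)
        qed
      qed
    qed simp
    have "\<Psi> (x \<circ> \<pi>) = \<Psi> x" if "\<pi> permutes {..<N}" for \<pi> x
      using \<Phi>_sym[OF that] \<Psi>0_sym[OF that] by (simp add: \<Psi>_def h_def \<Phi>0_def)
    then have \<Psi>_in: "\<Psi> \<in> sym_multilinear N sX sZ"
      unfolding sym_multilinear_iff using \<Psi>_mlin \<Psi>_le by blast
    have "multilinear_norm N (\<lambda>x. \<Phi> x - \<Psi> x) \<le> \<eta> * \<mu> + \<delta>"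
    proof (rule multilinear_norm_le)
      fix x :: "nat \<Rightarrow> 'x" assume "x \<in> unit_tuples N"
      from h_le[OF this] show "norm (\<Phi> x - \<Psi> x) \<le> \<eta> * \<mu> + \<delta>" by (simp add: \<Psi>_def Z.norm_scale zg1)
    qed
    also have "\<eta> * \<mu> + \<delta> \<le> \<eta> * (\<nu> + \<delta>) + \<delta>" using \<mu>_le \<eta> by simp
    also have "\<eta> * (\<nu> + \<delta>) + \<delta> \<le> \<eta> * \<nu> + 2 * \<delta>"
      using mult_right_mono[of \<eta> 1 \<delta>] \<eta> \<delta> by (simp add: distrib_left)
    also have "\<dots> < \<epsilon>" using \<delta>_le \<eta>(3) \<eta>\<nu> \<open>0 < \<epsilon>\<close> by linarith
    finally have dist: "multilinear_norm N (\<lambda>x. \<Phi> x - \<Psi> x) < \<epsilon>" .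
    have ball: "X.ball_limit (\<phi> i)" if "i < N" for i using att that by (simp add: K.XK.attaining_def)
    have "attaining N \<Psi> \<phi> g"
      unfolding attaining_def
    proof (intro conjI allI impI)
      fix \<sigma> assume \<sigma>: "\<sigma> permutes {..<N}"
      note l = permutation_list[OF \<sigma>]
      let ?l = "map \<sigma> [0..<N]"
      have sub: "set ?l \<subseteq> {..<N}" by (simp only: l(2) order_refl)
      have fn: "X.functional (\<phi> i)" if "i \<in> set ?l" for i
        using X.ball_limit_functional(1)[OF ball] that sub by blast
      have sc: "ext \<phi> (\<lambda>x. c * \<Psi>0 x) ?l x = c * ext \<phi> \<Psi>0 ?l x" for c x
        by (rule X.ext_scale[OF \<Psi>0_mlin K.XK.mlin_bound[OF \<Psi>0_mlin \<Psi>0_le] \<mu>0 l(1) sub]) (assumption, rule fn)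
      have g'_dual: "g' \<in> dual_space (*)" and g'_norm: "norm g' \<le> 1" using att by (auto simp: K.XK.attaining_def)
      have g'_eq: "blinfun_apply g' (c * 1) = c * g' 1" for c
        using g'_dual by (simp only: dual_space_iff[OF normed_space_over_mult])
      \<comment> \<open>A functional on the scalar field is multiplication by \<open>g' 1\<close>,
        of modulus at most 1. Dropping this factor does not lessen the attained value, so
        \<open>g\<close> can take the place of \<open>g'\<close>.\<close>
      have g'_app: "blinfun_apply g' c = g' 1 * c" for c using g'_eq[of c] by (simp add: mult.commute)
      have c1: "norm (g' 1) \<le> 1" using norm_blinfun[of g' 1] g'_norm by simp
      have "\<mu> \<le> norm (ext \<phi> (\<lambda>x. g' 1 * \<Psi>0 x) ?l (\<lambda>_. 0))"
        using att \<sigma> unfolding K.XK.attaining_def \<mu>_def g'_app[symmetric] by blast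
      also have "\<dots> = norm (g' 1) * norm (ext \<phi> \<Psi>0 ?l (\<lambda>_. 0))" by (simp only: sc norm_mult)
      also have "\<dots> \<le> 1 * norm (ext \<phi> \<Psi>0 ?l (\<lambda>_. 0))" by (intro mult_right_mono c1) simp
      finally have "(1 + \<eta>) * \<mu> \<le> (1 + \<eta>) * norm (ext \<phi> \<Psi>0 ?l (\<lambda>_. 0))" using \<eta> by simp
      also have "\<dots> = norm (of_real (1 + \<eta>) * ext \<phi> \<Psi>0 ?l (\<lambda>_. 0))"
        unfolding norm_mult norm_of_real using \<eta> by simp
      also have "\<dots> = norm (ext \<phi> (\<lambda>x. blinfun_apply g (\<Psi> x)) ?l (\<lambda>_. 0))"
        unfolding g\<Psi> sc ..
      finally show "multilinear_norm N \<Psi> \<le> norm (ext \<phi> (\<lambda>x. blinfun_apply g (\<Psi> x)) ?l (\<lambda>_. 0))"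
        using multilinear_norm_le[of N \<Psi>, OF \<Psi>_le] by simp
    qed (use g_dual zg1 ball in auto)
    then show ?thesis using \<Psi>_in dist by blast
  qed
qed

end

theorem theorem3p1:
  fixes sX :: "'k::real_or_complex \<Rightarrow> 'x::banach \<Rightarrow> 'x"
    and sZ :: "'k \<Rightarrow> 'z::banach \<Rightarrow> 'z"
    and N :: nat
    and \<Phi> :: "(nat \<Rightarrow> 'x) \<Rightarrow> 'z"
    and \<epsilon> :: real
  assumes "normed_space_over sX" and "normed_space_over sZ"
    and "separable_space (top_of_set (dual_space sX))"
    and "approximation_property dual_scale (dual_space sX)"
    and "(\<exists>sW :: 'k \<Rightarrow> 'w::banach \<Rightarrow> 'w. normed_space_over sW \<and> isometric_to_dual_of sZ sW) \<or>
         property_beta sZ"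
    and "\<Phi> \<in> sym_multilinear N sX sZ"
    and "\<epsilon> > 0"
  shows "\<exists>\<Psi> \<in> sym_multilinear N sX sZ.
           multilinear_norm N (\<lambda>x. \<Phi> x - \<Psi> x) < \<epsilon> \<and>
           arens_extensions_attain_norm_at_same_tuple N sX sZ \<Psi>"
proof -
  interpret XZ: normed_space_pair sX sZ using assms(1,2) by (rule normed_space_pair.intro)
  have "\<exists>\<Psi>\<in>sym_multilinear N sX sZ. multilinear_norm N (\<lambda>x. \<Phi> x - \<Psi> x) < \<epsilon> \<and> (\<exists>\<phi> g. XZ.attaining N \<Psi> \<phi> g)"
    using assms(5)
  proof
    assume "\<exists>sW :: 'k \<Rightarrow> 'w::banach \<Rightarrow> 'w. normed_space_over sW \<and> isometric_to_dual_of sZ sW"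
    then obtain sW :: "'k \<Rightarrow> 'w \<Rightarrow> 'w" and J where W: "normed_space_over sW"
      and J: "Vector_Spaces.linear sZ dual_scale J" "\<forall>z. norm (J z) = norm z" "range J = dual_space sW"
      unfolding isometric_to_dual_of_def by blast
    interpret dual_setting sX sW N sZ J
      by (intro dual_setting.intro form_space.intro dual_setting_axioms.intro assms(1,2) W J(1,3)) (use J(2) in blast)
    \<comment> \<open>\<open>dual_attaining\<close> yields a weak inequality; half of \<epsilon>
      makes it strict.\<close>
    have "0 < \<epsilon> / 2" using assms(7) by simp
    from dual_attaining[OF assms(3,4,6) this] show ?thesis using assms(7) by force
  next
    assume "property_beta sZ"
    from XZ.beta_attaining[OF assms(3,4) this assms(6,7)] show ?thesis .
  qed
  then show ?thesis using XZ.attaining_arens by blast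
qed

end
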